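(* Let $p>2$. For every $R>0$ there exists $T=T(R)>0$ such that for every $\psi_0\in H^{1,2}(\mathbb{R}^2)$ with $\|\psi_0\|_{H^{1,2}}\le R$ the Cauchy problem $$\mathrm{i}\partial_t\psi+\partial_{xx}\psi-\partial_{yyyy}\psi+|\psi|^{p-2}\psi=0,\qquad \psi(0)=\psi_0,$$ has a unique solution $\psi\in C([0,T);H^{1,2}(\mathbb{R}^2))\cap C^1([0,T);H^{-1,-2}(\mathbb{R}^2))$. Moreover: (i) Mass and energy are conserved: $M(\psi(t))=M(\psi_0)$ and $E(\psi(t))=E(\psi_0)$ for all $t\in[0,T)$, where $$M(u)=\int_{\mathbb{R}^2}|u|^2\,dxdy,\qquad E(u)=\frac12\int_{\mathbb{R}^2}|\partial_xu|^2\,dxdy+\frac12\int_{\mathbb{R}^2}|\partial_{yy}u|^2\,dxdy-\frac1p\int_{\mathbb{R}^2}|u|^p\,dxdy.$$ (ii) Blow-up alternative: if $T$ now denotes the maximal (forward) existence time of the solution, then either $T=+\infty$, or $T<+\infty$ and $\|\psi(t)\|_{H^{1,2}}\to+\infty$ as $t\to T^-$.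
   Context: $H^{1,2}(\mathbb{R}^2)$ is the completion of $C_0^\infty(\mathbb{R}^2)$ (complex-valued functions of $(x,y)\in\mathbb{R}^2$) under the norm $\|u\|_{H^{1,2}}=\|\partial_xu\|_2+\|\partial_{yy}u\|_2+\|u\|_2$, where $\|\cdot\|_q$ is the $L^q(\mathbb{R}^2)$ norm; $H^{-1,-2}(\mathbb{R}^2)$ is its dual space. The equation is understood in $H^{-1,-2}(\mathbb{R}^2)$ for each $t$. *)

theory Defs
  imports "HOL-Analysis.Analysis"
begin

section \<open>The complex space \<open>L\<^sup>2(\<real>\<^sup>2)\<close>\<close>

definition square_integrable :: "(real \<times> real \<Rightarrow> complex) \<Rightarrow> bool" where
  "square_integrable f \<longleftrightarrow>
     f \<in> borel_measurable lborel \<and> integrable lborel (\<lambda>z. (cmod (f z))\<^sup>2)"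

definition L2_rel :: "(real \<times> real \<Rightarrow> complex) \<Rightarrow> (real \<times> real \<Rightarrow> complex) \<Rightarrow> bool" where
  "L2_rel f g \<longleftrightarrow> square_integrable f \<and> square_integrable g \<and> (AE z in lborel. f z = g z)"

lemma square_integrable_zero: "square_integrable (\<lambda>z. 0)"
  by (simp add: square_integrable_def)

lemma square_integrable_mult_integrable:
  assumes "square_integrable f" "square_integrable g"
  shows "integrable lborel (\<lambda>z. cmod (f z) * cmod (g z))"
proof (rule Bochner_Integration.integrable_bound)
  show "integrable lborel (\<lambda>z. (cmod (f z))\<^sup>2 + (cmod (g z))\<^sup>2)"
    using assms by (simp add: square_integrable_def)
  show "(\<lambda>z. cmod (f z) * cmod (g z)) \<in> borel_measurable lborel"
    using assms by (auto simp: square_integrable_def)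
  have "a * b \<le> a\<^sup>2 + b\<^sup>2" if "a \<ge> 0" "b \<ge> 0" for a b :: real
    using sum_squares_bound[of a b] mult_nonneg_nonneg[OF that] by linarith
  then show "AE z in lborel. norm (cmod (f z) * cmod (g z))
      \<le> norm ((cmod (f z))\<^sup>2 + (cmod (g z))\<^sup>2)"
    by simp
qed

lemma square_integrable_cmult:
  assumes "square_integrable f"
  shows "square_integrable (\<lambda>z. c * f z)"
  using assms by (auto simp: square_integrable_def norm_mult power_mult_distrib)

lemma square_integrable_scaleR:
  assumes "square_integrable f"
  shows "square_integrable (\<lambda>z. r *\<^sub>R f z)"
  using square_integrable_cmult[OF assms, of "of_real r"] by (simp add: scaleR_conv_of_real)

lemma square_integrable_add:
  assumes "square_integrable f" "square_integrable g"
  shows "square_integrable (\<lambda>z. f z + g z)"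
  unfolding square_integrable_def
proof
  show m: "(\<lambda>z. f z + g z) \<in> borel_measurable lborel"
    using assms by (auto simp: square_integrable_def)
  show "integrable lborel (\<lambda>z. (cmod (f z + g z))\<^sup>2)"
  proof (rule Bochner_Integration.integrable_bound)
    show "integrable lborel
        (\<lambda>z. (cmod (f z))\<^sup>2 + (cmod (g z))\<^sup>2 + 2 * (cmod (f z) * cmod (g z)))"
      using assms square_integrable_mult_integrable[OF assms]
      by (simp add: square_integrable_def)
    show "(\<lambda>z. (cmod (f z + g z))\<^sup>2) \<in> borel_measurable lborel"
      using m by simp
    have "(cmod (a + b))\<^sup>2 \<le> (cmod a)\<^sup>2 + (cmod b)\<^sup>2 + 2 * (cmod a * cmod b)" for a b
      using power_mono[OF norm_triangle_ineq[of a b], of 2]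
      by (simp add: power2_sum algebra_simps)
    then show "AE z in lborel. norm ((cmod (f z + g z))\<^sup>2)
       \<le> norm ((cmod (f z))\<^sup>2 + (cmod (g z))\<^sup>2 + 2 * (cmod (f z) * cmod (g z)))"
      by simp
  qed
qed

lemma square_integrable_times:
  assumes "square_integrable f" "square_integrable g"
  shows "integrable lborel (\<lambda>z. f z * g z)"
  by (rule Bochner_Integration.integrable_bound[OF square_integrable_mult_integrable[OF assms]])
    (use assms in \<open>auto simp: square_integrable_def norm_mult\<close>)

lemma square_integrable_inner:
  assumes "square_integrable f" "square_integrable g"
  shows "integrable lborel (\<lambda>z. f z \<bullet> g z)"
  by (rule Bochner_Integration.integrable_bound[OF square_integrable_mult_integrable[OF assms]])
    (use assms in \<open>auto simp: square_integrable_def norm_mult Cauchy_Schwarz_ineq2\<close>)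

quotient_type L2 = "real \<times> real \<Rightarrow> complex" / partial: L2_rel
proof (rule part_equivpI)
  show "\<exists>f. L2_rel f f"
    using square_integrable_zero by (auto simp: L2_rel_def)
  show "symp L2_rel"
    by (auto simp: symp_def L2_rel_def)
  show "transp L2_rel"
    unfolding transp_def L2_rel_def by (auto elim: AE_mp)
qed

instantiation L2 :: real_inner
begin

lift_definition zero_L2 :: L2 is "\<lambda>z. 0"
  by (simp add: L2_rel_def square_integrable_zero)

lift_definition plus_L2 :: "L2 \<Rightarrow> L2 \<Rightarrow> L2" is "\<lambda>f g z. f z + g z"
  unfolding L2_rel_def by (auto intro: square_integrable_add)

lift_definition scaleR_L2 :: "real \<Rightarrow> L2 \<Rightarrow> L2" is "\<lambda>r f z. r *\<^sub>R f z"
  unfolding L2_rel_def by (auto intro: square_integrable_scaleR)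

lift_definition uminus_L2 :: "L2 \<Rightarrow> L2" is "\<lambda>f z. - f z"
  unfolding L2_rel_def by (auto simp: square_integrable_def)

definition minus_L2 :: "L2 \<Rightarrow> L2 \<Rightarrow> L2" where
  "minus_L2 u v = u + - v"

lift_definition inner_L2 :: "L2 \<Rightarrow> L2 \<Rightarrow> real" is "\<lambda>f g. LINT z|lborel. f z \<bullet> g z"
  unfolding L2_rel_def
  by (rule integral_cong_AE) (auto simp: square_integrable_def)

lift_definition norm_L2 :: "L2 \<Rightarrow> real" is "\<lambda>f. sqrt (LINT z|lborel. (cmod (f z))\<^sup>2)"
  unfolding L2_rel_def
  by (rule arg_cong[where f = sqrt], rule integral_cong_AE) (auto simp: square_integrable_def)

definition sgn_L2 :: "L2 \<Rightarrow> L2" where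
  "sgn_L2 u = scaleR (inverse (norm u)) u"

definition dist_L2 :: "L2 \<Rightarrow> L2 \<Rightarrow> real" where
  "dist_L2 u v = norm (u - v)"

definition uniformity_L2 :: "(L2 \<times> L2) filter" where
  "uniformity_L2 = (INF e\<in>{0 <..}. principal {(u, v). dist u v < e})"

definition open_L2 :: "L2 set \<Rightarrow> bool" where
  "open_L2 U = (\<forall>x\<in>U. eventually (\<lambda>(x', y). x' = x \<longrightarrow> y \<in> U) uniformity)"

instance
proof
  fix u v w :: L2 and r s :: real
  show "u + v + w = u + (v + w)"
    by transfer (auto simp: L2_rel_def add.assoc intro!: square_integrable_add)
  show "u + v = v + u"
    by transfer (auto simp: L2_rel_def add.commute intro!: square_integrable_add)
  show "0 + u = u"
    by transfer (auto simp: L2_rel_def)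
  show "- u + u = 0"
    by transfer (auto simp: L2_rel_def square_integrable_zero)
  show "u - v = u + - v"
    by (rule minus_L2_def)
  show "r *\<^sub>R (u + v) = r *\<^sub>R u + r *\<^sub>R v"
    by transfer
      (auto simp: L2_rel_def algebra_simps intro!: square_integrable_add square_integrable_scaleR)
  show "(r + s) *\<^sub>R u = r *\<^sub>R u + s *\<^sub>R u"
    by transfer
      (auto simp: L2_rel_def scaleR_add_left intro!: square_integrable_add square_integrable_scaleR)
  show "r *\<^sub>R s *\<^sub>R u = (r * s) *\<^sub>R u"
    by transfer (auto simp: L2_rel_def intro: square_integrable_scaleR)
  show "1 *\<^sub>R u = u"
    by transfer (auto simp: L2_rel_def)
  show "sgn u = scaleR (inverse (norm u)) u"
    by (rule sgn_L2_def)
  show "dist u v = norm (u - v)"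
    by (rule dist_L2_def)
  show "(uniformity :: (L2 \<times> L2) filter) = (INF e\<in>{0 <..}. principal {(u, v). dist u v < e})"
    by (rule uniformity_L2_def)
  show "open U = (\<forall>x\<in>U. eventually (\<lambda>(x', y). x' = x \<longrightarrow> y \<in> U) uniformity)" for U :: "L2 set"
    by (rule open_L2_def)
  show "u \<bullet> v = v \<bullet> u"
    by transfer (simp add: inner_commute)
  show "(u + v) \<bullet> w = u \<bullet> w + v \<bullet> w"
    by transfer (auto simp: L2_rel_def inner_add_left square_integrable_inner)
  show "(r *\<^sub>R u) \<bullet> v = r * (u \<bullet> v)"
    by transfer simp
  show "0 \<le> u \<bullet> u"
    by transfer simp
  show "(u \<bullet> u = 0) = (u = 0)"
  proof transfer
    fix f assume "L2_rel f f"
    then have f: "square_integrable f" by (simp add: L2_rel_def)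
    have "(LINT z|lborel. f z \<bullet> f z) = 0 \<longleftrightarrow> (AE z in lborel. f z \<bullet> f z = 0)"
      by (rule integral_nonneg_eq_0_iff_AE[OF square_integrable_inner[OF f f]]) simp
    then show "((LINT z|lborel. f z \<bullet> f z) = 0) = L2_rel f (\<lambda>z. 0)"
      using f by (simp add: L2_rel_def square_integrable_zero)
  qed
  show "norm u = sqrt (u \<bullet> u)"
    by transfer (simp add: dot_square_norm)
qed

end

lift_definition cscale_L2 :: "complex \<Rightarrow> L2 \<Rightarrow> L2" is "\<lambda>c f z. c * f z"
  unfolding L2_rel_def by (auto intro: square_integrable_cmult)

text \<open>The bilinear pairing (no complex conjugation), so that functions act on test functions
  as distributions.\<close>

lift_definition L2_pair :: "L2 \<Rightarrow> L2 \<Rightarrow> complex" is "\<lambda>f g. LINT z|lborel. f z * g z"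
  unfolding L2_rel_def
  by (rule integral_cong_AE) (auto simp: square_integrable_def)

lemma norm_cscale_L2: "norm (cscale_L2 c u) = cmod c * norm u"
  by transfer (simp add: norm_mult power_mult_distrib real_sqrt_mult)

lemma bounded_linear_cscale_L2: "bounded_linear (cscale_L2 c)"
proof
  show "cscale_L2 c (u + v) = cscale_L2 c u + cscale_L2 c v" for u v
    by transfer
      (auto simp: L2_rel_def algebra_simps intro!: square_integrable_add square_integrable_cmult)
  show "cscale_L2 c (r *\<^sub>R u) = r *\<^sub>R cscale_L2 c u" for r u
    by transfer (auto simp: L2_rel_def intro!: square_integrable_cmult square_integrable_scaleR)
  show "\<exists>K. \<forall>u. norm (cscale_L2 c u) \<le> norm u * K"
    by (rule exI[of _ "cmod c"]) (simp add: norm_cscale_L2 mult.commute)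
qed

lemma cscale_L2_of_real: "cscale_L2 (of_real r) u = r *\<^sub>R u"
  by transfer (auto simp: L2_rel_def scaleR_conv_of_real intro: square_integrable_cmult)

lemma bounded_bilinear_L2_pair: "bounded_bilinear L2_pair"
proof
  show "L2_pair (u + u') v = L2_pair u v + L2_pair u' v" for u u' v
    by transfer (simp add: L2_rel_def distrib_right square_integrable_times)
  show "L2_pair u (v + v') = L2_pair u v + L2_pair u v'" for u v v'
    by transfer (simp add: L2_rel_def distrib_left square_integrable_times)
  show "L2_pair (r *\<^sub>R u) v = r *\<^sub>R L2_pair u v" for r u v
    by transfer simp
  show "L2_pair u (r *\<^sub>R v) = r *\<^sub>R L2_pair u v" for r u v
    by transfer simp
  have "cmod (L2_pair u v) \<le> norm u * norm v * 1" for u v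
  proof transfer
    fix f g assume "L2_rel f f" "L2_rel g g"
    then have f: "square_integrable f" and g: "square_integrable g"
      by (simp_all add: L2_rel_def)
    define f' g' :: "real \<times> real \<Rightarrow> complex"
      where "f' = (\<lambda>z. of_real (cmod (f z)))" and "g' = (\<lambda>z. of_real (cmod (g z)))"
    have f': "square_integrable f'" and g': "square_integrable g'"
      using f g by (auto simp: f'_def g'_def square_integrable_def)
    have "cmod (LINT z|lborel. f z * g z) \<le> (LINT z|lborel. cmod (f z * g z))"
      by (rule integral_norm_bound)
    also have "\<dots> = (LINT z|lborel. f' z \<bullet> g' z)"
      by (simp add: f'_def g'_def norm_mult inner_complex_def)
    also have "\<dots> = abs_L2 f' \<bullet> abs_L2 g'"
      using f' g' by (subst inner_L2.abs_eq) (auto simp: L2_rel_def)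
    also have "\<dots> \<le> norm (abs_L2 f') * norm (abs_L2 g')"
      by (rule norm_cauchy_schwarz)
    also have "\<dots> = sqrt (LINT z|lborel. (cmod (f z))\<^sup>2) * sqrt (LINT z|lborel. (cmod (g z))\<^sup>2)"
      using f' g' by (subst (1 2) norm_L2.abs_eq) (auto simp: L2_rel_def f'_def g'_def)
    finally show "cmod (LINT z|lborel. f z * g z)
      \<le> sqrt (LINT z|lborel. (cmod (f z))\<^sup>2) * sqrt (LINT z|lborel. (cmod (g z))\<^sup>2) * 1"
      by simp
  qed
  then show "\<exists>K. \<forall>u v. norm (L2_pair u v) \<le> norm u * norm v * K"
    by blast
qed


section \<open>Test functions\<close>

definition dX :: "(real \<times> real \<Rightarrow> complex) \<Rightarrow> real \<times> real \<Rightarrow> complex" where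
  "dX f = (\<lambda>(x, y). vector_derivative (\<lambda>s. f (s, y)) (at x))"

definition dY :: "(real \<times> real \<Rightarrow> complex) \<Rightarrow> real \<times> real \<Rightarrow> complex" where
  "dY f = (\<lambda>(x, y). vector_derivative (\<lambda>s. f (x, s)) (at y))"

primrec Ck :: "nat \<Rightarrow> (real \<times> real \<Rightarrow> complex) \<Rightarrow> bool" where
  "Ck 0 f \<longleftrightarrow> continuous_on UNIV f"
| "Ck (Suc k) f \<longleftrightarrow> (\<forall>z. f differentiable (at z)) \<and> Ck k (dX f) \<and> Ck k (dY f)"

definition test_functions :: "(real \<times> real \<Rightarrow> complex) set" where
  "test_functions = {f. (\<forall>k. Ck k f) \<and> compact (closure {z. f z \<noteq> 0})}"

lemma has_dX:
  assumes "f differentiable (at (x, y))"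
  shows "((\<lambda>s. f (s, y)) has_vector_derivative dX f (x, y)) (at x)"
proof -
  have "(f \<circ> (\<lambda>s. (s, y))) differentiable (at x)"
    by (rule differentiable_chain_at) (use assms in \<open>auto intro!: derivative_intros\<close>)
  then show ?thesis
    by (simp add: vector_derivative_works o_def dX_def)
qed

lemma has_dY:
  assumes "f differentiable (at (x, y))"
  shows "((\<lambda>s. f (x, s)) has_vector_derivative dY f (x, y)) (at y)"
proof -
  have "(f \<circ> (\<lambda>s. (x, s))) differentiable (at y)"
    by (rule differentiable_chain_at) (use assms in \<open>auto intro!: derivative_intros\<close>)
  then show ?thesis
    by (simp add: vector_derivative_works o_def dY_def)
qed

lemma dX_add:
  assumes "\<And>z. f differentiable (at z)" "\<And>z. g differentiable (at z)"
  shows "dX (\<lambda>z. f z + g z) = (\<lambda>z. dX f z + dX g z)"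
  by (rule ext, clarify, subst dX_def)
    (simp add: vector_derivative_at has_vector_derivative_add has_dX assms)

lemma dY_add:
  assumes "\<And>z. f differentiable (at z)" "\<And>z. g differentiable (at z)"
  shows "dY (\<lambda>z. f z + g z) = (\<lambda>z. dY f z + dY g z)"
  by (rule ext, clarify, subst dY_def)
    (simp add: vector_derivative_at has_vector_derivative_add has_dY assms)

lemma dX_cmult:
  assumes "\<And>z. f differentiable (at z)"
  shows "dX (\<lambda>z. c * f z) = (\<lambda>z. c * dX f z)"
  by (rule ext, clarify, subst dX_def)
    (simp add: vector_derivative_at has_vector_derivative_mult_right has_dX assms)

lemma dY_cmult:
  assumes "\<And>z. f differentiable (at z)"
  shows "dY (\<lambda>z. c * f z) = (\<lambda>z. c * dY f z)"
  by (rule ext, clarify, subst dY_def)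
    (simp add: vector_derivative_at has_vector_derivative_mult_right has_dY assms)

lemma Ck_add: "Ck k f \<Longrightarrow> Ck k g \<Longrightarrow> Ck k (\<lambda>z. f z + g z)"
  by (induction k arbitrary: f g) (auto simp: dX_add dY_add simp del: split_paired_All intro!: continuous_intros)

lemma Ck_cmult: "Ck k f \<Longrightarrow> Ck k (\<lambda>z. c * f z)"
  by (induction k arbitrary: f) (auto simp: dX_cmult dY_cmult simp del: split_paired_All intro!: continuous_intros)

lemma Ck_imp_continuous: "Ck k f \<Longrightarrow> continuous_on UNIV f"
  by (cases k) (auto intro: differentiable_imp_continuous_on simp: differentiable_on_def
      differentiable_at_withinI)

lemma dX_outside:
  assumes "closed K" "\<And>z. z \<notin> K \<Longrightarrow> f z = 0" "z \<notin> K"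
  shows "dX f z = 0"
proof (cases z)
  case (Pair x y)
  have op: "open ((\<lambda>s. (s, y)) -` (- K))"
    using assms(1) by (intro open_vimage) (auto intro!: continuous_intros)
  have "((\<lambda>s. f (s, y)) has_vector_derivative 0) (at x)"
    by (rule has_vector_derivative_transform_within_open[OF has_vector_derivative_const[of 0] op])
      (use assms Pair in auto)
  then show ?thesis
    by (simp add: Pair dX_def vector_derivative_at)
qed

lemma dY_outside:
  assumes "closed K" "\<And>z. z \<notin> K \<Longrightarrow> f z = 0" "z \<notin> K"
  shows "dY f z = 0"
proof (cases z)
  case (Pair x y)
  have op: "open ((\<lambda>s. (x, s)) -` (- K))"
    using assms(1) by (intro open_vimage) (auto intro!: continuous_intros)
  have "((\<lambda>s. f (x, s)) has_vector_derivative 0) (at y)"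
    by (rule has_vector_derivative_transform_within_open[OF has_vector_derivative_const[of 0] op])
      (use assms Pair in auto)
  then show ?thesis
    by (simp add: Pair dY_def vector_derivative_at)
qed

lemma square_integrable_compact_support:
  assumes "continuous_on UNIV f" "compact K" "\<And>z. z \<notin> K \<Longrightarrow> f z = 0"
  shows "square_integrable f"
  unfolding square_integrable_def
proof
  show "f \<in> borel_measurable lborel"
    using borel_measurable_continuous_onI[OF assms(1)] by simp
  have "integrable lborel (\<lambda>z. indicator K z *\<^sub>R (cmod (f z))\<^sup>2)"
    by (rule borel_integrable_compact)
      (use assms in \<open>auto intro!: continuous_intros intro: continuous_on_subset\<close>)
  also have "(\<lambda>z. indicator K z *\<^sub>R (cmod (f z))\<^sup>2) = (\<lambda>z. (cmod (f z))\<^sup>2)"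
    using assms(3) by (auto simp: indicator_def fun_eq_iff)
  finally show "integrable lborel (\<lambda>z. (cmod (f z))\<^sup>2)" .
qed

lemma test_functions_square_integrable:
  assumes "f \<in> test_functions"
  shows "square_integrable f" "square_integrable (dX f)" "square_integrable (dY (dY f))"
proof -
  define K where "K = closure {z. f z \<noteq> 0}"
  have K: "compact K" "closed K"
    using assms by (auto simp: test_functions_def K_def)
  have 0: "f z = 0" if "z \<notin> K" for z
    using that closure_subset[of "{z. f z \<noteq> 0}"] by (auto simp: K_def)
  have C: "Ck (Suc (Suc 0)) f"
    using assms by (simp only: test_functions_def mem_Collect_eq)
  show "square_integrable f"
    by (rule square_integrable_compact_support[OF Ck_imp_continuous[OF C] K(1)]) (rule 0)
  show "square_integrable (dX f)"
    by (rule square_integrable_compact_support[OF Ck_imp_continuous[of "Suc 0"] K(1)])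
      (use C dX_outside[OF K(2) 0] in auto)
  have 1: "dY f z = 0" if "z \<notin> K" for z
    by (rule dY_outside[OF K(2) 0 that])
  show "square_integrable (dY (dY f))"
    by (rule square_integrable_compact_support[OF Ck_imp_continuous[of 0] K(1)])
      (use C dY_outside[OF K(2) 1] in auto)
qed

lemma test_functions_zero: "(\<lambda>z. 0) \<in> test_functions"
proof -
  have "dX (\<lambda>z. 0) = (\<lambda>z. 0)" "dY (\<lambda>z. 0) = (\<lambda>z. 0)"
    by (auto simp: dX_def dY_def)
  then have "Ck k (\<lambda>z. 0)" for k
    by (induction k) auto
  then show ?thesis
    by (simp add: test_functions_def)
qed

lemma test_functions_add:
  assumes "f \<in> test_functions" "g \<in> test_functions"
  shows "(\<lambda>z. f z + g z) \<in> test_functions"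
proof -
  have "closure {z. f z + g z \<noteq> 0} \<subseteq> closure ({z. f z \<noteq> 0} \<union> {z. g z \<noteq> 0})"
    by (rule closure_mono) auto
  then have "compact (closure {z. f z + g z \<noteq> 0})"
    using assms unfolding test_functions_def closure_Un
    by (metis (mono_tags, lifting) closed_closure compact_Int_closed compact_Un inf.absorb_iff2
        mem_Collect_eq)
  then show ?thesis
    using assms by (auto simp: test_functions_def intro: Ck_add)
qed

lemma test_functions_cmult:
  assumes "f \<in> test_functions"
  shows "(\<lambda>z. c * f z) \<in> test_functions"
proof -
  have "closure {z. c * f z \<noteq> 0} \<subseteq> closure {z. f z \<noteq> 0}"
    by (rule closure_mono) auto
  then have "compact (closure {z. c * f z \<noteq> 0})"
    using assms unfolding test_functions_def
    by (metis (mono_tags, lifting) closed_closure compact_Int_closed inf.absorb_iff2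
        mem_Collect_eq)
  then show ?thesis
    using assms by (auto simp: test_functions_def intro: Ck_cmult)
qed


section \<open>The space \<open>H\<^sup>1\<^sup>,\<^sup>2(\<real>\<^sup>2)\<close>\<close>

text \<open>The map \<open>f \<mapsto> (f, \<partial>\<^sub>x f, \<partial>\<^sub>y\<^sub>y f)\<close> embeds the test functions, with the norm of \<open>H\<^sup>1\<^sup>,\<^sup>2\<close>,
  into the complete space \<open>L\<^sup>2 \<times> L\<^sup>2 \<times> L\<^sup>2\<close>. Their completion is the closure of the image,
  and the three components of an element are \<open>u\<close>, \<open>\<partial>\<^sub>x u\<close> and \<open>\<partial>\<^sub>y\<^sub>y u\<close>.
  (The second and third are the weak derivatives of the first, so they are determined by it.)\<close>

lifting_forget L2.lifting

definition test_graph :: "(L2 \<times> L2 \<times> L2) set" where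
  "test_graph = (\<lambda>f. (abs_L2 f, abs_L2 (dX f), abs_L2 (dY (dY f)))) ` test_functions"

typedef H12 = "closure test_graph"
  morphisms H12_triple Abs_H12
  using test_functions_zero closure_subset by (fastforce simp: test_graph_def)

setup_lifting type_definition_H12

lemma test_functions_Ck: "f \<in> test_functions \<Longrightarrow> Ck k f"
  by (simp add: test_functions_def)

lemma test_functions_differentiable:
  assumes "f \<in> test_functions"
  shows "f differentiable (at z)" "dY f differentiable (at z)"
  using test_functions_Ck[OF assms, of "Suc (Suc 0)"] by (auto simp del: split_paired_All)

lemma test_graph_add:
  assumes "u \<in> test_graph" "v \<in> test_graph"
  shows "u + v \<in> test_graph"
proof -
  obtain f g where f: "f \<in> test_functions" and g: "g \<in> test_functions"
    and u: "u = (abs_L2 f, abs_L2 (dX f), abs_L2 (dY (dY f)))"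
    and v: "v = (abs_L2 g, abs_L2 (dX g), abs_L2 (dY (dY g)))"
    using assms by (auto simp: test_graph_def)
  note d = test_functions_differentiable[OF f] test_functions_differentiable[OF g]
  note s = test_functions_square_integrable[OF f] test_functions_square_integrable[OF g]
  have "u + v = (abs_L2 (\<lambda>z. f z + g z), abs_L2 (dX (\<lambda>z. f z + g z)),
      abs_L2 (dY (dY (\<lambda>z. f z + g z))))"
    by (simp add: u v dX_add dY_add d s plus_L2.abs_eq L2_rel_def)
  then show ?thesis
    using test_functions_add[OF f g] by (auto simp: test_graph_def)
qed

lemma test_graph_cscale:
  assumes "(u, v, w) \<in> test_graph"
  shows "(cscale_L2 c u, cscale_L2 c v, cscale_L2 c w) \<in> test_graph"
proof -
  obtain f where f: "f \<in> test_functions"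
    and u: "u = abs_L2 f" "v = abs_L2 (dX f)" "w = abs_L2 (dY (dY f))"
    using assms by (auto simp: test_graph_def)
  note d = test_functions_differentiable[OF f]
  note s = test_functions_square_integrable[OF f]
  have "(cscale_L2 c u, cscale_L2 c v, cscale_L2 c w) =
      (abs_L2 (\<lambda>z. c * f z), abs_L2 (dX (\<lambda>z. c * f z)), abs_L2 (dY (dY (\<lambda>z. c * f z))))"
    by (simp add: u dX_cmult dY_cmult d s cscale_L2.abs_eq L2_rel_def)
  then show ?thesis
    using test_functions_cmult[OF f] by (auto simp: test_graph_def)
qed

lemma closure_test_graph_add:
  assumes "u \<in> closure test_graph" "v \<in> closure test_graph"
  shows "u + v \<in> closure test_graph"
proof -
  obtain U V where "\<And>n. U n \<in> test_graph" "U \<longlonglongrightarrow> u" "\<And>n. V n \<in> test_graph" "V \<longlonglongrightarrow> v"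
    using assms by (auto simp: closure_sequential)
  then show ?thesis
    unfolding closure_sequential
    by (intro exI[of _ "\<lambda>n. U n + V n"]) (auto intro: test_graph_add tendsto_intros)
qed

definition cscale_triple :: "complex \<Rightarrow> L2 \<times> L2 \<times> L2 \<Rightarrow> L2 \<times> L2 \<times> L2" where
  "cscale_triple c = (\<lambda>(u, v, w). (cscale_L2 c u, cscale_L2 c v, cscale_L2 c w))"

lemma closure_test_graph_cscale:
  assumes "u \<in> closure test_graph"
  shows "cscale_triple c u \<in> closure test_graph"
proof -
  obtain U where U: "\<And>n. U n \<in> test_graph" "U \<longlonglongrightarrow> u"
    using assms by (auto simp: closure_sequential)
  have "(\<lambda>n. cscale_triple c (U n)) \<longlonglongrightarrow> cscale_triple c u"
    unfolding cscale_triple_def case_prod_beta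
    by (intro tendsto_intros bounded_linear.tendsto[OF bounded_linear_cscale_L2] U)
  moreover have "cscale_triple c (U n) \<in> test_graph" for n
    using test_graph_cscale U(1)[of n] by (auto simp: cscale_triple_def split: prod.split)
  ultimately show ?thesis
    unfolding closure_sequential by (intro exI[of _ "\<lambda>n. cscale_triple c (U n)"]) simp
qed

lemma cscale_triple_of_real: "cscale_triple (of_real r) u = r *\<^sub>R u"
  by (cases u) (simp add: cscale_triple_def cscale_L2_of_real)

lemma closure_test_graph_scaleR:
  "u \<in> closure test_graph \<Longrightarrow> r *\<^sub>R u \<in> closure test_graph"
  using closure_test_graph_cscale[of u "of_real r"] by (simp add: cscale_triple_of_real)

lift_definition H12_L2 :: "H12 \<Rightarrow> L2" is fst .
lift_definition H12_dx :: "H12 \<Rightarrow> L2" is "\<lambda>u. fst (snd u)" .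
lift_definition H12_dyy :: "H12 \<Rightarrow> L2" is "\<lambda>u. snd (snd u)" .

lift_definition cscale_H12 :: "complex \<Rightarrow> H12 \<Rightarrow> H12" is cscale_triple
  by (rule closure_test_graph_cscale)

instantiation H12 :: real_normed_vector
begin

lift_definition zero_H12 :: H12 is 0
  using closure_test_graph_scaleR[of _ 0] H12_triple by fastforce

lift_definition plus_H12 :: "H12 \<Rightarrow> H12 \<Rightarrow> H12" is "(+)"
  by (rule closure_test_graph_add)

lift_definition scaleR_H12 :: "real \<Rightarrow> H12 \<Rightarrow> H12" is "scaleR"
  by (rule closure_test_graph_scaleR)

lift_definition uminus_H12 :: "H12 \<Rightarrow> H12" is uminus
  using closure_test_graph_scaleR[of _ "-1"] by simp

lift_definition minus_H12 :: "H12 \<Rightarrow> H12 \<Rightarrow> H12" is "(-)"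
  using closure_test_graph_scaleR[of _ "-1"] closure_test_graph_add by fastforce

definition norm_H12 :: "H12 \<Rightarrow> real" where
  "norm_H12 u = norm (H12_dx u) + norm (H12_dyy u) + norm (H12_L2 u)"

definition sgn_H12 :: "H12 \<Rightarrow> H12" where
  "sgn_H12 u = scaleR (inverse (norm u)) u"

definition dist_H12 :: "H12 \<Rightarrow> H12 \<Rightarrow> real" where
  "dist_H12 u v = norm (u - v)"

definition uniformity_H12 :: "(H12 \<times> H12) filter" where
  "uniformity_H12 = (INF e\<in>{0 <..}. principal {(u, v). dist u v < e})"

definition open_H12 :: "H12 set \<Rightarrow> bool" where
  "open_H12 U = (\<forall>x\<in>U. eventually (\<lambda>(x', y). x' = x \<longrightarrow> y \<in> U) uniformity)"

instance
proof
  fix u v w :: H12 and r s :: real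
  show "u + v + w = u + (v + w)" by transfer (rule add.assoc)
  show "u + v = v + u" by transfer (rule add.commute)
  show "0 + u = u" by transfer simp
  show "- u + u = 0" by transfer simp
  show "u - v = u + - v" by transfer simp
  show "r *\<^sub>R (u + v) = r *\<^sub>R u + r *\<^sub>R v" by transfer (rule scaleR_add_right)
  show "(r + s) *\<^sub>R u = r *\<^sub>R u + s *\<^sub>R u" by transfer (rule scaleR_add_left)
  show "r *\<^sub>R s *\<^sub>R u = (r * s) *\<^sub>R u" by transfer simp
  show "1 *\<^sub>R u = u" by transfer simp
  show "sgn u = scaleR (inverse (norm u)) u" by (rule sgn_H12_def)
  show "dist u v = norm (u - v)" by (rule dist_H12_def)
  show "(uniformity :: (H12 \<times> H12) filter) = (INF e\<in>{0 <..}. principal {(u, v). dist u v < e})"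
    by (rule uniformity_H12_def)
  show "open U = (\<forall>x\<in>U. eventually (\<lambda>(x', y). x' = x \<longrightarrow> y \<in> U) uniformity)" for U :: "H12 set"
    by (rule open_H12_def)
  have "norm u = 0 \<longleftrightarrow> H12_dx u = 0 \<and> H12_dyy u = 0 \<and> H12_L2 u = 0"
    unfolding norm_H12_def using norm_ge_zero[of "H12_dx u"] norm_ge_zero[of "H12_dyy u"]
      norm_ge_zero[of "H12_L2 u"] by (auto simp: add_nonneg_eq_0_iff)
  also have "\<dots> \<longleftrightarrow> u = 0"
    by transfer (auto simp: prod_eq_iff)
  finally show "norm u = 0 \<longleftrightarrow> u = 0" .
  have add: "H12_dx (u + v) = H12_dx u + H12_dx v" "H12_dyy (u + v) = H12_dyy u + H12_dyy v"
    "H12_L2 (u + v) = H12_L2 u + H12_L2 v"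
    by (transfer, simp)+
  show "norm (u + v) \<le> norm u + norm v"
    unfolding norm_H12_def add
    using norm_triangle_ineq[of "H12_dx u" "H12_dx v"]
      norm_triangle_ineq[of "H12_dyy u" "H12_dyy v"] norm_triangle_ineq[of "H12_L2 u" "H12_L2 v"]
    by linarith
  have "H12_dx (r *\<^sub>R u) = r *\<^sub>R H12_dx u" "H12_dyy (r *\<^sub>R u) = r *\<^sub>R H12_dyy u"
    "H12_L2 (r *\<^sub>R u) = r *\<^sub>R H12_L2 u"
    by (transfer, simp)+
  then show "norm (r *\<^sub>R u) = \<bar>r\<bar> * norm u"
    unfolding norm_H12_def by (simp add: algebra_simps)
qed

end

lemma bounded_linear_H12_L2 [bounded_linear_intros]: "bounded_linear H12_L2"
  by (rule bounded_linear_intro[where K = 1]; (transfer, simp)?) (simp add: norm_H12_def)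

lemma bounded_linear_H12_dx [bounded_linear_intros]: "bounded_linear H12_dx"
  by (rule bounded_linear_intro[where K = 1]; (transfer, simp)?) (simp add: norm_H12_def)

lemma bounded_linear_H12_dyy [bounded_linear_intros]: "bounded_linear H12_dyy"
  by (rule bounded_linear_intro[where K = 1]; (transfer, simp)?) (simp add: norm_H12_def)

text \<open>Representatives; every integral below is independent of the choice of the representative.\<close>

definition val :: "H12 \<Rightarrow> real \<times> real \<Rightarrow> complex" where
  "val u = rep_L2 (H12_L2 u)"

definition val_dx :: "H12 \<Rightarrow> real \<times> real \<Rightarrow> complex" where
  "val_dx u = rep_L2 (H12_dx u)"

definition val_dyy :: "H12 \<Rightarrow> real \<times> real \<Rightarrow> complex" where
  "val_dyy u = rep_L2 (H12_dyy u)"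

definition mass :: "H12 \<Rightarrow> real" where
  "mass u = (LINT z|lborel. (cmod (val u z))\<^sup>2)"

definition energy :: "real \<Rightarrow> H12 \<Rightarrow> real" where
  "energy p u = 1/2 * (LINT z|lborel. (cmod (val_dx u z))\<^sup>2)
     + 1/2 * (LINT z|lborel. (cmod (val_dyy u z))\<^sup>2)
     - 1/p * (LINT z|lborel. cmod (val u z) powr p)"


section \<open>The dual space \<open>H\<^sup>-\<^sup>1\<^sup>,\<^sup>-\<^sup>2(\<real>\<^sup>2)\<close> and the equation\<close>

lifting_forget H12.lifting

text \<open>The dual consists of the complex-linear elements of the real Banach space
  \<^typ>\<open>H12 \<Rightarrow>\<^sub>L complex\<close>, with the operator norm.\<close>

definition H12_dual :: "(H12 \<Rightarrow>\<^sub>L complex) set" where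
  "H12_dual = {F. \<forall>c v. blinfun_apply F (cscale_H12 c v) = c * blinfun_apply F v}"

lift_definition cscale_dual :: "complex \<Rightarrow> (H12 \<Rightarrow>\<^sub>L complex) \<Rightarrow> (H12 \<Rightarrow>\<^sub>L complex)"
  is "\<lambda>c F v. c * F v"
  by (rule bounded_linear_const_mult)

lift_definition embed_dual :: "H12 \<Rightarrow> (H12 \<Rightarrow>\<^sub>L complex)"
  is "\<lambda>u v. L2_pair (H12_L2 u) (H12_L2 v)"
  by (rule bounded_linear_compose[OF bounded_bilinear.bounded_linear_right[OF
        bounded_bilinear_L2_pair] bounded_linear_H12_L2])

text \<open>Distributional derivatives: \<open>\<langle>\<partial>\<^sub>x\<^sub>x u, v\<rangle> = - \<integral> \<partial>\<^sub>x u \<partial>\<^sub>x v\<close> and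
  \<open>\<langle>\<partial>\<^sub>y\<^sub>y\<^sub>y\<^sub>y u, v\<rangle> = \<integral> \<partial>\<^sub>y\<^sub>y u \<partial>\<^sub>y\<^sub>y v\<close>.\<close>

lift_definition dxx_dual :: "H12 \<Rightarrow> (H12 \<Rightarrow>\<^sub>L complex)"
  is "\<lambda>u v. - L2_pair (H12_dx u) (H12_dx v)"
  by (rule bounded_linear_minus, rule bounded_linear_compose[OF
        bounded_bilinear.bounded_linear_right[OF bounded_bilinear_L2_pair] bounded_linear_H12_dx])

lift_definition dyyyy_dual :: "H12 \<Rightarrow> (H12 \<Rightarrow>\<^sub>L complex)"
  is "\<lambda>u v. L2_pair (H12_dyy u) (H12_dyy v)"
  by (rule bounded_linear_compose[OF bounded_bilinear.bounded_linear_right[OF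
        bounded_bilinear_L2_pair] bounded_linear_H12_dyy])

text \<open>\<open>H\<^sup>1\<^sup>,\<^sup>2(\<real>\<^sup>2)\<close> embeds into \<open>L\<^sup>\<infinity>(\<real>\<^sup>2)\<close>, so for \<open>p > 2\<close> the function below is
  square-integrable and the functional is bounded.\<close>

definition nonlinearity_dual :: "real \<Rightarrow> H12 \<Rightarrow> (H12 \<Rightarrow>\<^sub>L complex)" where
  "nonlinearity_dual p u =
     Blinfun (\<lambda>v. LINT z|lborel. (cmod (val u z) powr (p - 2) * val u z) * val v z)"

definition time_interval :: "ereal \<Rightarrow> real set" where
  "time_interval T = {t. 0 \<le> t \<and> ereal t < T}"

text \<open>\<open>\<psi> \<in> C([0,T); H\<^sup>1\<^sup>,\<^sup>2) \<inter> C\<^sup>1([0,T); H\<^sup>-\<^sup>1\<^sup>,\<^sup>-\<^sup>2)\<close> solves the Cauchy problem; the values of \<open>\<psi>\<close>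
  outside \<open>[0,T)\<close> are irrelevant, and the time derivative at 0 is one-sided.\<close>

definition solves_cauchy :: "real \<Rightarrow> H12 \<Rightarrow> ereal \<Rightarrow> (real \<Rightarrow> H12) \<Rightarrow> bool" where
  "solves_cauchy p \<psi>\<^sub>0 T \<psi> \<longleftrightarrow>
     continuous_on (time_interval T) \<psi> \<and> \<psi> 0 = \<psi>\<^sub>0 \<and>
     (\<exists>\<psi>' :: real \<Rightarrow> (H12 \<Rightarrow>\<^sub>L complex).
        continuous_on (time_interval T) \<psi>' \<and>
        (\<forall>t\<in>time_interval T.
           \<psi>' t \<in> H12_dual \<and>
           ((\<lambda>s. embed_dual (\<psi> s)) has_vector_derivative \<psi>' t) (at t within time_interval T) \<and>
           cscale_dual \<i> (\<psi>' t) + dxx_dual (\<psi> t) - dyyyy_dual (\<psi> t)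
             + nonlinearity_dual p (\<psi> t) = 0))"

definition max_existence_time :: "real \<Rightarrow> H12 \<Rightarrow> ereal" where
  "max_existence_time p \<psi>\<^sub>0 = Sup {T. T > 0 \<and> (\<exists>\<psi>. solves_cauchy p \<psi>\<^sub>0 T \<psi>)}"

end

theory Submission
  imports Defs
begin

text \<open>Since \<open>H\<^sup>1\<^sup>,\<^sup>2\<close> embeds into \<open>L\<^sup>\<infinity>\<close>, the power may be truncated outside a large disc, after which the
  nonlinearity is globally Lipschitz on \<open>L\<^sup>2\<close>. In the truncated equation the operator
  \<open>A = - \<partial>\<^sub>x\<^sub>x + \<partial>\<^sub>y\<^sub>y\<^sub>y\<^sub>y\<close> is replaced by its Yosida approximations. The resulting ordinary differential
  equations in \<open>L\<^sup>2\<close> conserve the mass and a regularised energy, and for data in the domain of \<open>A\<close>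
  their solutions are Cauchy, because the time derivatives stay bounded. In the limit the energy
  cannot increase; running the equation backwards shows that it cannot decrease either. Energy
  conservation upgrades the weak continuity of the limit to strong continuity in \<open>H\<^sup>1\<^sup>,\<^sup>2\<close>.
  The \<open>L\<^sup>2\<close> distance to the data is \<open>O(\<surd>t)\<close>, so the energy identity bounds the \<open>H\<^sup>1\<^sup>,\<^sup>2\<close> norm for
  a time that depends only on the size of the data, and during this time the truncation is not
  felt. Uniqueness is a Gronwall estimate in \<open>L\<^sup>2\<close>, and since the local existence time depends only
  on the norm, a solution of bounded norm can always be continued.\<close>

section \<open>Calculus in Banach spaces\<close>

text \<open>The norm of \<open>H12\<close> is a sum of three L2 norms and does not come from an
  inner product. The abstract part therefore uses two spaces: a Banach space \<open>'x\<close>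
  carrying a symmetric form \<open>a\<close>, and an inner product space \<open>'h\<close> into
  which it embeds. The operator A is never defined; it enters only through the form and its
  resolvents. All abstract spaces are real, and the imaginary unit becomes an isometry
  \<open>I\<close> that commutes with the resolvents. The resulting skewness removes A from every
  stability estimate, which makes the constants independent of the Yosida parameter. The truncated
  power is not differentiable on the circle where the cut-off sets in, so time derivatives are
  bounded through difference quotients instead of by differentiating the equation. The cut-off level
  is \<open>7 * M + 1\<close>, where \<open>7\<close> is the constant of the embedding into the
  bounded functions and \<open>M\<close> an a priori bound of the \<open>H12\<close> norm.
  Functionals act by a bilinear pairing. Its real part becomes the inner product after conjugating
  the test element, and complex linearity recovers the imaginary part; this links the real weak
  equation to the equation in the dual.\<close>

lemma gronwall_linear:
  fixes y y' :: "real \<Rightarrow> real"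
  assumes "0 \<le> t" "0 \<le> b" "0 \<le> c"
    and der: "\<And>s. 0 \<le> s \<Longrightarrow> s \<le> t \<Longrightarrow> (y has_vector_derivative y' s) (at s within {0..t})"
    and bd: "\<And>s. 0 \<le> s \<Longrightarrow> s \<le> t \<Longrightarrow> y' s \<le> c * y s + b"
  shows "y t \<le> (y 0 + b * t) * exp (c * t)"
proof -
  \<comment> \<open>The integrating factor makes \<open>f\<close> nonincreasing: its derivative is
    at most \<open>exp (- c * s) * b - b\<close>, which is nonpositive because
    \<open>0 \<le> b\<close> and \<open>0 \<le> c\<close>.\<close>
  define f where "f = (\<lambda>s. exp (- c * s) * y s - b * s)"
  have der_f: "(f has_derivative (\<lambda>h. h * (exp (- c * s) * (y' s - c * y s) - b))) (at s within {0..t})"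
    if "0 \<le> s" "s \<le> t" for s
  proof -
    have "(y has_derivative (\<lambda>h. h * y' s)) (at s within {0..t})"
      using der[OF that] by (simp add: has_vector_derivative_def)
    then show ?thesis
      unfolding f_def by (auto intro!: derivative_eq_intros simp: algebra_simps)
  qed
  then obtain s where s: "s \<in> {0..t}" "f t - f 0 = (t - 0) * (exp (- c * s) * (y' s - c * y s) - b)"
    using mvt_very_simple[OF \<open>0 \<le> t\<close> der_f] by auto
  have "exp (- c * s) * (y' s - c * y s) \<le> exp (- c * s) * b"
    using bd[of s] s by (intro mult_left_mono) auto
  also have "\<dots> \<le> 1 * b"
    using assms s by (intro mult_right_mono) auto
  finally have "f t \<le> f 0"
    using s(2) \<open>0 \<le> t\<close> mult_nonneg_nonpos[of t "exp (- c * s) * (y' s - c * y s) - b"] by simp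
  then have "exp (- c * t) * y t \<le> y 0 + b * t"
    by (simp add: f_def)
  then have "exp (c * t) * (exp (- c * t) * y t) \<le> exp (c * t) * (y 0 + b * t)"
    by (intro mult_left_mono) auto
  then show ?thesis
    by (simp add: mult.assoc[symmetric] exp_add[symmetric]) (simp add: mult.commute)
qed

lemma at_within_atLeast_eq_Icc:
  fixes t T :: real
  assumes "t < T"
  shows "at t within {a..} = at t within {a..T}"
  by (rule at_within_nhd[of _ "{..<T}"]) (use assms in auto)

lemma has_vector_derivative_integral_atLeast:
  fixes f :: "real \<Rightarrow> 'a::banach"
  assumes "continuous_on {0..} f" "0 \<le> t"
  shows "((\<lambda>t. w + integral {0..t} f) has_vector_derivative f t) (at t within {0..})"
proof -
  have "((\<lambda>t. integral {0..t} f) has_vector_derivative f t) (at t within {0..t + 1})"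
    using assms
    by (intro integral_has_vector_derivative continuous_on_subset[OF assms(1)]) auto
  from has_vector_derivative_add[OF has_vector_derivative_const[of w] this] show ?thesis
    by (simp add: at_within_atLeast_eq_Icc[of t "t + 1"])
qed

lemma continuous_on_atLeast_uniform_limit:
  fixes u :: "real \<Rightarrow> 'a::metric_space"
  assumes cont: "\<And>n. continuous_on {a..} (U n)"
    and unif: "\<And>T. a \<le> T \<Longrightarrow> uniform_limit {a..T} U u sequentially"
  shows "continuous_on {a..} u"
proof -
  have "continuous (at t within {a..}) u" if "a \<le> t" for t
  proof -
    have "continuous_on {a..t + 1} u"
      by (rule uniform_limit_theorem[OF _ unif])
        (use that in \<open>auto intro!: always_eventually continuous_on_subset[OF cont]\<close>)
    then show ?thesis
      using that at_within_atLeast_eq_Icc[of t "t + 1"]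
      by (auto simp: continuous_on_eq_continuous_within)
  qed
  then show ?thesis by (auto simp: continuous_on_eq_continuous_within)
qed

text \<open>Used for the potential on the ambient space and for its pointwise density on
  \<open>complex\<close>; both are given only through a first-order expansion with quadratic
  remainder.\<close>

lemma isCont_if_quadratic_remainder:
  fixes G :: "'a::real_inner \<Rightarrow> real"
  assumes "\<And>v. \<bar>G v - G u - g \<bullet> (v - u)\<bar> \<le> L * (norm (v - u))\<^sup>2"
  shows "isCont G u"
proof -
  have "((\<lambda>v. \<bar>g \<bullet> (v - u)\<bar> + L * (norm (v - u))\<^sup>2) \<longlongrightarrow> \<bar>g \<bullet> (u - u)\<bar> + L * (norm (u - u))\<^sup>2) (at u)"
    by (intro tendsto_intros)
  then have lim: "((\<lambda>v. \<bar>g \<bullet> (v - u)\<bar> + L * (norm (v - u))\<^sup>2) \<longlongrightarrow> 0) (at u)"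
    by simp
  have "norm (G v - G u) \<le> \<bar>g \<bullet> (v - u)\<bar> + L * (norm (v - u))\<^sup>2" for v
    using assms[of v] unfolding real_norm_def by linarith
  from Lim_null_comparison[OF always_eventually[OF allI[OF this]] lim] show ?thesis
    by (simp add: continuous_at LIM_zero_iff)
qed

lemma has_vector_derivative_zero_imp_eq:
  fixes f :: "real \<Rightarrow> real"
  assumes "0 \<le> T" "\<And>t. t \<in> {0..T} \<Longrightarrow> (f has_vector_derivative 0) (at t within {0..T})"
  shows "f T = f 0"
  using has_derivative_zero_unique[of "{0..T}" f T 0] assms by (simp add: has_vector_derivative_def)

text \<open>Integration gains a factor \<open>1 / c\<close> against the weight
  \<open>exp (c * t)\<close>. With \<open>c\<close> twice the Lipschitz constant the Picard map
  contracts by one half on the whole half-line.\<close>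

lemma integral_norm_le_exp:
  fixes f :: "real \<Rightarrow> 'a::banach"
  assumes "continuous_on {0..t} f" "0 \<le> t" "0 < c" "0 \<le> B"
    and "\<And>s. 0 \<le> s \<Longrightarrow> s \<le> t \<Longrightarrow> norm (f s) \<le> B * exp (c * s)"
  shows "norm (integral {0..t} f) \<le> B / c * exp (c * t)"
proof -
  have I: "((\<lambda>s. B * exp (c * s)) has_integral (B / c * exp (c * t) - B / c * exp (c * 0))) {0..t}"
    using assms by (intro fundamental_theorem_of_calculus)
      (auto intro!: derivative_eq_intros simp: has_real_derivative_iff_has_vector_derivative[symmetric])
  have "norm (integral {0..t} f) \<le> integral {0..t} (\<lambda>s. B * exp (c * s))"
    using assms I by (intro Henstock_Kurzweil_Integration.integral_norm_bound_integral integrable_continuous_real)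
      (auto intro!: continuous_intros)
  also have "\<dots> = B / c * exp (c * t) - B / c"
    using integral_unique[OF I] by simp
  finally show ?thesis
    using assms by (smt (verit) divide_nonneg_pos)
qed

text \<open>With the weight \<open>exp (2 * L * t)\<close> the increments of the Picard iterates
  halve for all times at once, so the solution is global without pasting local ones. Convergence is
  uniform only on bounded intervals, which suffices for the integral equation.\<close>

lemma picard_lindelof_global:
  fixes F :: "'a::banach \<Rightarrow> 'a"
  assumes L: "0 < L" and lip: "\<And>x y. norm (F x - F y) \<le> L * norm (x - y)"
  shows "\<exists>u. u 0 = w \<and> (\<forall>t\<ge>0. (u has_vector_derivative F (u t)) (at t within {0..}))"
proof -
  have "L-lipschitz_on UNIV F"
    using lip L by (intro lipschitz_onI) (auto simp: dist_norm)
  then have contF: "continuous_on UNIV F"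
    by (rule lipschitz_on_continuous_on)
  define U where "U = rec_nat (\<lambda>t::real. w) (\<lambda>n f t. w + integral {0..t} (\<lambda>s. F (f s)))"
  have U0: "U 0 = (\<lambda>t. w)" and US: "U (Suc n) = (\<lambda>t. w + integral {0..t} (\<lambda>s. F (U n s)))" for n
    by (simp_all add: U_def)
  have contFU: "continuous_on {0..} (\<lambda>s. F (U n s))" if "continuous_on {0..} (U n)" for n
    by (rule continuous_on_compose2[OF contF that]) auto
  have contU: "continuous_on {0..} (U n)" for n
  proof (induction n)
    case (Suc n)
    show ?case
      unfolding US continuous_on_eq_continuous_within
      using has_vector_derivative_integral_atLeast[OF contFU[OF Suc]]
        has_vector_derivative_continuous by blast
  qed (simp add: U0)
  note contFU = contFU[OF contU]
  \<comment> \<open>Chosen so that the first increment, of norm \<open>t * norm (F w)\<close>,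
    equals \<open>C * (2 * L * t)\<close>, which is below
    \<open>C * exp (2 * L * t)\<close>.\<close>
  define C where "C = norm (F w) / (2 * L)"
  have C: "0 \<le> C" using L by (simp add: C_def)
  have diff: "norm (U (Suc n) t - U n t) \<le> C * exp (2 * L * t) * (1/2)^n" if "0 \<le> t" for n t
    using that
  proof (induction n arbitrary: t)
    case 0
    have "norm (U (Suc 0) t - U 0 t) = t * norm (F w)"
      using 0 by (simp add: US U0)
    also have "\<dots> = C * (2 * L * t)"
      using L by (simp add: C_def)
    also have "\<dots> \<le> C * exp (2 * L * t)"
      using C exp_ge_add_one_self[of "2 * L * t"] by (intro mult_left_mono) linarith+
    finally show ?case by simp
  next
    case (Suc n)
    have sub: "{0..t} \<subseteq> {0..}" by auto
    have "U (Suc (Suc n)) t - U (Suc n) t = integral {0..t} (\<lambda>s. F (U (Suc n) s)) - integral {0..t} (\<lambda>s. F (U n s))"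
      unfolding US[of "Suc n"] by (simp add: US[of n])
    also have "\<dots> = integral {0..t} (\<lambda>s. F (U (Suc n) s) - F (U n s))"
      by (intro Henstock_Kurzweil_Integration.integral_diff[symmetric] integrable_continuous_real
          continuous_on_subset[OF contFU sub])
    also have "norm \<dots> \<le> (L * (C * (1/2)^n)) / (2 * L) * exp (2 * L * t)"
    proof (rule integral_norm_le_exp)
      show "continuous_on {0..t} (\<lambda>s. F (U (Suc n) s) - F (U n s))"
        by (intro continuous_on_diff continuous_on_subset[OF contFU sub])
      fix s assume s: "0 \<le> s" "s \<le> t"
      have "norm (F (U (Suc n) s) - F (U n s)) \<le> L * norm (U (Suc n) s - U n s)"
        by (rule lip)
      also have "\<dots> \<le> L * (C * exp (2 * L * s) * (1/2)^n)"
        using Suc.IH[OF s(1)] L by (intro mult_left_mono) auto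
      finally show "norm (F (U (Suc n) s) - F (U n s)) \<le> L * (C * (1/2)^n) * exp (2 * L * s)"
        by (simp add: mult_ac)
    qed (use Suc L C in auto)
    also have "\<dots> = C * exp (2 * L * t) * (1/2)^(Suc n)"
      using L by simp
    finally show ?case .
  qed
  define u where "u = (\<lambda>t. w + (\<Sum>n. U (Suc n) t - U n t))"
  have telescope: "w + (\<Sum>i<n. U (Suc i) t - U i t) = U n t" for n t
    using sum_lessThan_telescope[of "\<lambda>n. U n t" n] by (simp add: U0)
  have unif: "uniform_limit {0..T} U u sequentially" for T
  proof -
    have "uniform_limit {0..T} (\<lambda>n t. \<Sum>i<n. U (Suc i) t - U i t) (\<lambda>t. \<Sum>i. U (Suc i) t - U i t) sequentially"
    proof (rule Weierstrass_m_test)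
      fix n t assume t: "t \<in> {0..T}"
      have "norm (U (Suc n) t - U n t) \<le> C * exp (2 * L * t) * (1/2)^n"
        using diff t by simp
      also have "\<dots> \<le> C * exp (2 * L * T) * (1/2)^n"
        using t C L by (intro mult_right_mono mult_left_mono) auto
      finally show "norm (U (Suc n) t - U n t) \<le> C * exp (2 * L * T) * (1/2)^n" .
    qed (intro summable_mult summable_geometric, simp)
    from uniform_limit_add[OF uniform_limit_const[where c = "\<lambda>_. w"] this] show ?thesis
      by (simp add: telescope u_def)
  qed
  have cont_u: "continuous_on {0..} u"
    by (rule continuous_on_atLeast_uniform_limit[OF contU unif])
  have cont_Fu: "continuous_on {0..} (\<lambda>s. F (u s))"
    by (rule continuous_on_compose2[OF contF cont_u]) auto
  have eq: "u t = w + integral {0..t} (\<lambda>s. F (u s))" if t: "0 \<le> t" for t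
  proof -
    have "uniform_limit {0..t} (\<lambda>n s. F (U n s)) (\<lambda>s. F (u s)) sequentially"
    proof (rule uniform_limitI)
      fix e :: real assume "0 < e"
      then have "\<forall>\<^sub>F n in sequentially. \<forall>s\<in>{0..t}. dist (U n s) (u s) < e / L"
        using L by (intro uniform_limitD[OF unif]) auto
      then show "\<forall>\<^sub>F n in sequentially. \<forall>s\<in>{0..t}. dist (F (U n s)) (F (u s)) < e"
      proof eventually_elim
        case (elim n)
        show ?case
        proof
          fix s assume "s \<in> {0..t}"
          then have "L * norm (U n s - u s) < L * (e / L)"
            using elim L by (intro mult_strict_left_mono) (auto simp: dist_norm)
          then show "dist (F (U n s)) (F (u s)) < e"
            using lip[of "U n s" "u s"] L by (simp add: dist_norm)
        qed
      qed
    qed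
    then obtain I J where IJ: "\<And>n. ((\<lambda>s. F (U n s)) has_integral I n) {0..t}"
      "((\<lambda>s. F (u s)) has_integral J) {0..t}" "I \<longlonglongrightarrow> J"
      by (rule uniform_limit_integral) (auto intro!: continuous_on_subset[OF contFU])
    have "(\<lambda>n. U (Suc n) t) \<longlonglongrightarrow> w + J"
      using IJ(3) by (auto simp: US integral_unique[OF IJ(1)] intro!: tendsto_intros)
    moreover have "(\<lambda>n. U (Suc n) t) \<longlonglongrightarrow> u t"
      using tendsto_uniform_limitI[OF unif[of t], of t] t by (intro LIMSEQ_Suc) auto
    ultimately show ?thesis
      using IJ(2) LIMSEQ_unique integral_unique by metis
  qed
  have "u 0 = w"
    using eq[of 0] by simp
  moreover have "(u has_vector_derivative F (u t)) (at t within {0..})" if "0 \<le> t" for t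
    by (rule has_vector_derivative_transform[OF _ _ has_vector_derivative_integral_atLeast[OF cont_Fu that]])
      (use eq that in auto)
  ultimately show ?thesis by blast
qed

text \<open>Minimise the quadratic functional \<open>Q\<close>: the parallelogram identity turns a
  minimising sequence into a Cauchy sequence, and the first variation at the minimiser is the
  claimed equation. Coercivity and completeness stand in for a Hilbert norm on
  \<open>'a\<close>.\<close>

lemma riesz_symmetric_form:
  fixes B :: "'a::banach \<Rightarrow> 'a \<Rightarrow> real"
  assumes B: "bounded_bilinear B" and sym: "\<And>x y. B x y = B y x"
    and c: "0 < c" and coer: "\<And>x. c * (norm x)\<^sup>2 \<le> B x x"
    and l: "bounded_linear l"
  shows "\<exists>x. \<forall>y. B x y = l y"
proof -
  interpret B: bounded_bilinear B by (rule B)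
  interpret l: bounded_linear l by (rule l)
  define Q where "Q x = B x x - 2 * l x" for x
  have Q_cont: "continuous_on UNIV Q"
    unfolding Q_def by (intro continuous_intros B.continuous_on l.continuous_on)
  obtain N where N: "\<And>x. norm (l x) \<le> norm x * N"
    using l.nonneg_bounded by blast
  have "- N\<^sup>2 / c \<le> Q x" for x
  proof -
    have "0 \<le> (c * norm x - N)\<^sup>2 / c" using c by simp
    also have "\<dots> = c * (norm x)\<^sup>2 - 2 * (norm x * N) + N\<^sup>2 / c"
      using c by (simp add: power2_diff field_simps power2_eq_square)
    also have "\<dots> \<le> Q x + N\<^sup>2 / c"
      using coer[of x] N[of x] by (auto simp: Q_def)
    finally show ?thesis by simp
  qed
  then have bdd: "bdd_below (range Q)"
    by (intro bdd_belowI[of _ "- N\<^sup>2 / c"]) auto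
  define m where "m = Inf (range Q)"
  have m_le: "m \<le> Q x" for x
    unfolding m_def by (rule cINF_lower[OF bdd]) simp
  have "\<exists>x. Q x < m + 1 / real (Suc n)" for n
    using cInf_lessD[of "range Q" "m + 1 / real (Suc n)"] by (force simp: m_def)
  then obtain v where v: "\<And>n. Q (v n) < m + 1 / real (Suc n)"
    by metis
  \<comment> \<open>The midpoint of \<open>x\<close> and \<open>y\<close> has value at least
    \<open>m\<close>, so the distance is controlled by the excess of both values over
    \<open>m\<close>.\<close>
  have par: "c / 2 * (norm (x - y))\<^sup>2 \<le> Q x + Q y - 2 * m" for x y
  proof -
    have "Q x + Q y = 2 * Q ((1/2) *\<^sub>R (x + y)) + B (x - y) (x - y) / 2"
      unfolding Q_def
      by (simp add: B.add_left B.add_right B.diff_left B.diff_right B.scaleR_left B.scaleR_right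
          l.add l.scaleR sym[of y x] field_simps)
    then show ?thesis
      using coer[of "x - y"] m_le[of "(1/2) *\<^sub>R (x + y)"] by linarith
  qed
  have "Cauchy v"
  proof (rule CauchyI)
    fix e :: real assume e: "0 < e"
    then obtain M where M: "1 / real (Suc M) < c * e\<^sup>2 / 4"
      using c nat_approx_posE[of "c * e\<^sup>2 / 4"] by auto
    show "\<exists>M. \<forall>i\<ge>M. \<forall>j\<ge>M. norm (v i - v j) < e"
    proof (intro exI[of _ M] allI impI)
      fix i j assume ij: "M \<le> i" "M \<le> j"
      have "1 / real (Suc i) \<le> 1 / real (Suc M)" "1 / real (Suc j) \<le> 1 / real (Suc M)"
        using ij by (auto simp: field_simps)
      then have "c / 2 * (norm (v i - v j))\<^sup>2 < c / 2 * e\<^sup>2"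
        using par[of "v i" "v j"] v[of i] v[of j] M by linarith
      then have "(norm (v i - v j))\<^sup>2 < e\<^sup>2"
        using c by simp
      then show "norm (v i - v j) < e"
        using e by (simp add: power_less_imp_less_base)
    qed
  qed
  then obtain x where x: "v \<longlonglongrightarrow> x"
    using Cauchy_convergent convergent_def by blast
  have "(\<lambda>n. Q (v n)) \<longlonglongrightarrow> Q x"
    using continuous_on_tendsto_compose[OF Q_cont x] by simp
  moreover have "(\<lambda>n. m + 1 / real (Suc n)) \<longlonglongrightarrow> m + 0"
    by (intro tendsto_intros LIMSEQ_Suc[OF lim_1_over_n])
  ultimately have Qx: "Q x \<le> m"
    using LIMSEQ_le[of "\<lambda>n. Q (v n)" "Q x" "\<lambda>n. m + 1 / real (Suc n)" "m + 0"] v less_imp_le by auto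
  show ?thesis
  proof (intro exI allI)
    fix y
    define r where "r = B x y - l y"
    have *: "0 \<le> 2 * t * r + t\<^sup>2 * B y y" for t
    proof -
      have "Q x \<le> Q (x + t *\<^sub>R y)"
        using Qx m_le order_trans by blast
      also have "\<dots> = Q x + 2 * t * r + t\<^sup>2 * B y y"
        unfolding Q_def r_def
        by (simp add: B.add_left B.add_right B.scaleR_left B.scaleR_right l.add l.scaleR
            sym[of y x] field_simps power2_eq_square)
      finally show ?thesis by simp
    qed
    have "r = 0"
    proof (rule ccontr)
      assume "r \<noteq> 0"
      have By: "0 \<le> B y y"
        using coer[of y] c by (meson mult_nonneg_nonneg order_trans zero_le_power2 less_imp_le)
      \<comment> \<open>Nearly the minimiser of the quadratic in \<open>t\<close>; the
        \<open>+ 1\<close> keeps the denominator positive when \<open>B y y = 0\<close>.\<close>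
      define t where "t = - r / (B y y + 1)"
      have "2 * t * r + t\<^sup>2 * B y y = r\<^sup>2 / (B y y + 1) * (- 2 + B y y / (B y y + 1))"
        using By by (simp add: t_def power2_eq_square field_simps add_nonneg_eq_0_iff)
      moreover have "\<dots> < 0"
        using By \<open>r \<noteq> 0\<close> by (intro mult_pos_neg) (auto simp: field_simps)
      ultimately show False using *[of t] by linarith
    qed
    then show "B x y = l y" by (simp add: r_def)
  qed
qed

lemma has_vector_derivative_norm_sq:
  fixes u :: "real \<Rightarrow> 'a::real_inner"
  assumes "(u has_vector_derivative u') (at t within S)"
  shows "((\<lambda>t. (norm (u t))\<^sup>2) has_vector_derivative 2 * (u' \<bullet> u t)) (at t within S)"
  unfolding power2_norm_eq_inner
  using bounded_bilinear.has_vector_derivative[OF bounded_bilinear_inner assms assms]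
  by (simp add: inner_commute)

lemma tendsto_difference_quotient:
  fixes u :: "real \<Rightarrow> 'a::real_normed_vector"
  assumes "(u has_vector_derivative D) (at t within {0..})" "0 \<le> t"
    and h: "h \<longlonglongrightarrow> 0" "\<And>n. 0 < h n"
  shows "(\<lambda>n. (1 / h n) *\<^sub>R (u (t + h n) - u t)) \<longlonglongrightarrow> D"
proof -
  have "(\<lambda>n. t + h n) \<longlonglongrightarrow> t"
    using tendsto_add[OF tendsto_const[of t] h(1)] by simp
  moreover have "t + h n \<noteq> t \<and> t + h n \<in> {0..}" for n
    using h(2)[of n] assms(2) by simp
  ultimately have "filterlim (\<lambda>n. t + h n) (at t within {0..}) sequentially"
    unfolding filterlim_at by simp
  moreover have "((\<lambda>y. (1 / norm (y - t)) *\<^sub>R (u y - (u t + (y - t) *\<^sub>R D))) \<longlongrightarrow> 0) (at t within {0..})"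
    using assms(1) unfolding has_vector_derivative_def has_derivative_within by blast
  ultimately have "(\<lambda>n. (1 / norm (t + h n - t)) *\<^sub>R (u (t + h n) - (u t + (t + h n - t) *\<^sub>R D))) \<longlonglongrightarrow> 0"
    by (rule filterlim_compose[rotated])
  moreover have "(1 / norm (t + h n - t)) *\<^sub>R (u (t + h n) - (u t + (t + h n - t) *\<^sub>R D))
      = (1 / h n) *\<^sub>R (u (t + h n) - u t) - D" for n
    using h(2)[of n] by (simp add: algebra_simps)
  ultimately have "(\<lambda>n. (1 / h n) *\<^sub>R (u (t + h n) - u t) - D) \<longlonglongrightarrow> 0"
    by simp
  then show ?thesis by (simp add: LIM_zero_iff)
qed

section \<open>Resolvents and Yosida approximations of a symmetric form\<close>

text \<open>\<open>'x\<close> plays the domain of a closed nonnegative form on \<open>'h\<close>: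
  completeness of \<open>'x\<close> together with \<open>norm_le_form\<close> expresses closedness,
  and \<open>emb_eq_0D\<close> says that the domain consists of elements of
  \<open>'h\<close>.\<close>

locale hilbert_form =
  fixes emb :: "'x::banach \<Rightarrow> 'h::{real_inner,banach}"
    and a :: "'x \<Rightarrow> 'x \<Rightarrow> real"
    and M :: real
  assumes bounded_linear_emb: "bounded_linear emb"
    and emb_eq_0D: "emb x = 0 \<Longrightarrow> x = 0"
    and bounded_bilinear_form: "bounded_bilinear a"
    and form_sym: "a x y = a y x"
    and form_nonneg: "0 \<le> a x x"
    and M_pos: "0 < M"
    and norm_le_form: "(norm x)\<^sup>2 \<le> M * ((norm (emb x))\<^sup>2 + a x x)"
begin

sublocale emb: bounded_linear emb by (rule bounded_linear_emb)
sublocale a: bounded_bilinear a by (rule bounded_bilinear_form)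

lemma emb_inject: "emb x = emb y \<Longrightarrow> x = y"
  using emb_eq_0D[of "x - y"] by (simp add: emb.diff)

lemma form_le_avg: "a x y \<le> (a x x + a y y) / 2"
  using form_nonneg[of "x - y"] by (simp add: a.diff_left a.diff_right form_sym[of y x])

text \<open>With A the operator of the form, \<open>res e\<close> is (1 + e A)^(-1) in weak form and
  \<open>yosida e\<close> is A (1 + e A)^(-1). The resolvent takes values in \<open>'x\<close>, so
  the form can be evaluated on it directly.\<close>

definition res :: "real \<Rightarrow> 'h \<Rightarrow> 'x" where
  "res e f = (SOME x. \<forall>y. emb x \<bullet> emb y + e * a x y = f \<bullet> emb y)"

definition yosida :: "real \<Rightarrow> 'h \<Rightarrow> 'h" where
  "yosida e f = (1 / e) *\<^sub>R (f - emb (res e f))"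

lemma res_eq:
  assumes "0 < e"
  shows "emb (res e f) \<bullet> emb y + e * a (res e f) y = f \<bullet> emb y"
proof -
  have "\<exists>x. \<forall>y. emb x \<bullet> emb y + e * a x y = f \<bullet> emb y"
  proof (rule riesz_symmetric_form)
    show "bounded_bilinear (\<lambda>x y. emb x \<bullet> emb y + e * a x y)"
    proof
      obtain K where K: "\<And>x y. norm (a x y) \<le> norm x * norm y * K" "0 \<le> K"
        using a.nonneg_bounded by blast
      obtain K' where K': "\<And>x. norm (emb x) \<le> norm x * K'" "0 \<le> K'"
        using emb.nonneg_bounded by blast
      have "norm (emb x \<bullet> emb y + e * a x y) \<le> norm x * norm y * (K' * K' + e * K)" for x y
      proof -
        have "norm (emb x \<bullet> emb y) \<le> norm (emb x) * norm (emb y)"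
          by (simp add: Cauchy_Schwarz_ineq2)
        also have "\<dots> \<le> (norm x * K') * (norm y * K')"
          by (intro mult_mono K') (auto simp: K')
        finally have 1: "norm (emb x \<bullet> emb y) \<le> norm x * norm y * (K' * K')"
          by (simp add: mult_ac)
        have "norm (e * a x y) \<le> e * (norm x * norm y * K)"
          using K(1)[of x y] assms by (simp add: abs_mult)
        with 1 show ?thesis
          using norm_triangle_ineq[of "emb x \<bullet> emb y" "e * a x y"] by (simp add: algebra_simps)
      qed
      then show "\<exists>K. \<forall>x y. norm (emb x \<bullet> emb y + e * a x y) \<le> norm x * norm y * K"
        by blast
    qed (simp_all add: emb.add emb.scaleR inner_add_left inner_add_right a.add_left a.add_right
        a.scaleR_left a.scaleR_right algebra_simps)
    show "emb x \<bullet> emb y + e * a x y = emb y \<bullet> emb x + e * a y x" for x y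
      by (simp add: inner_commute form_sym[of x y])
    \<comment> \<open>Multiplying \<open>norm_le_form\<close> by \<open>min 1 e / M\<close> leaves
      the coefficient \<open>min 1 e\<close> in front of both terms, which is at most
      \<open>1\<close> and at most \<open>e\<close>.\<close>
    show "0 < min 1 e / M"
      using assms M_pos by simp
    show "min 1 e / M * (norm x)\<^sup>2 \<le> emb x \<bullet> emb x + e * a x x" for x
    proof -
      have "min 1 e / M * (norm x)\<^sup>2 \<le> min 1 e / M * (M * ((norm (emb x))\<^sup>2 + a x x))"
        using norm_le_form assms M_pos by (intro mult_left_mono) auto
      also have "\<dots> = min 1 e * (norm (emb x))\<^sup>2 + min 1 e * a x x"
        using M_pos by (simp add: algebra_simps)
      also have "\<dots> \<le> 1 * (norm (emb x))\<^sup>2 + e * a x x"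
        using form_nonneg by (intro add_mono mult_right_mono) auto
      finally show ?thesis
        by (simp add: power2_norm_eq_inner)
    qed
    show "bounded_linear (\<lambda>y. f \<bullet> emb y)"
      by (intro bounded_linear_compose[OF bounded_linear_inner_right bounded_linear_emb])
  qed
  from someI_ex[OF this] show ?thesis
    unfolding res_def by blast
qed

lemma res_unique:
  assumes "0 < e" and "\<And>y. emb x \<bullet> emb y + e * a x y = f \<bullet> emb y"
  shows "res e f = x"
proof -
  define d where "d = res e f - x"
  have "emb d \<bullet> emb d + e * a d d = 0"
    using res_eq[OF assms(1), of f d] assms(2)[of d]
    by (simp add: d_def emb.diff a.diff_left inner_diff_left algebra_simps)
  then have "emb d \<bullet> emb d = 0"
    using assms(1) form_nonneg[of d] by (smt (verit) inner_ge_zero mult_nonneg_nonneg)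
  then show ?thesis
    using emb_eq_0D[of d] by (simp add: d_def)
qed

lemma res_add: "0 < e \<Longrightarrow> res e (f + h) = res e f + res e h"
  using res_eq[of e f] res_eq[of e h]
  by (intro res_unique) (simp_all add: emb.add a.add_left inner_add_left algebra_simps)

lemma res_scaleR: "0 < e \<Longrightarrow> res e (c *\<^sub>R f) = c *\<^sub>R res e f"
proof (rule res_unique)
  fix y assume e: "0 < e"
  have "c * (emb (res e f) \<bullet> emb y + e * a (res e f) y) = c * (f \<bullet> emb y)"
    by (simp only: res_eq[OF e])
  then show "emb (c *\<^sub>R res e f) \<bullet> emb y + e * a (c *\<^sub>R res e f) y = (c *\<^sub>R f) \<bullet> emb y"
    by (simp add: emb.scaleR a.scaleR_left algebra_simps)
qed

lemma res_diff: "0 < e \<Longrightarrow> res e (f - h) = res e f - res e h"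
  using res_add[of e f "(- 1) *\<^sub>R h"] res_scaleR[of e "- 1" h] by simp

lemma yosida_decomp: "0 < e \<Longrightarrow> f = emb (res e f) + e *\<^sub>R yosida e f"
  by (simp add: yosida_def)

lemma yosida_diff: "0 < e \<Longrightarrow> yosida e (f - h) = yosida e f - yosida e h"
  by (simp add: yosida_def res_diff emb.diff algebra_simps)

lemma yosida_inner_emb: "0 < e \<Longrightarrow> yosida e f \<bullet> emb y = a (res e f) y"
  using res_eq[of e f y] by (simp add: yosida_def inner_diff_left field_simps)

lemma norm_emb_res_le:
  assumes "0 < e"
  shows "norm (emb (res e f)) \<le> norm f"
proof -
  have "norm (emb (res e f)) * norm (emb (res e f)) \<le> norm f * norm (emb (res e f))"
    using res_eq[OF assms, of f "res e f"] norm_cauchy_schwarz[of f "emb (res e f)"]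
      form_nonneg[of "res e f"] assms
    by (smt (verit) mult_nonneg_nonneg norm_eq_square dot_square_norm power2_eq_square)
  then show ?thesis
    by (cases "norm (emb (res e f)) = 0") auto
qed

lemma norm_yosida_le:
  assumes "0 < e"
  shows "norm (yosida e f) \<le> 2 / e * norm f"
proof -
  have "norm (f - emb (res e f)) \<le> 2 * norm f"
    using norm_triangle_ineq4[of f "emb (res e f)"] norm_emb_res_le[OF assms, of f] by linarith
  then show ?thesis
    using assms by (simp add: yosida_def divide_right_mono)
qed

lemma yosida_sym:
  assumes "0 < e"
  shows "yosida e f \<bullet> h = f \<bullet> yosida e h"
proof -
  have "emb (res e f) \<bullet> h = f \<bullet> emb (res e h)"
    using res_eq[OF assms, of f "res e h"] res_eq[OF assms, of h "res e f"]
    by (simp add: inner_commute form_sym)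
  then show ?thesis
    by (simp add: yosida_def inner_diff_left inner_diff_right)
qed

text \<open>The regularised form splits into the form of the resolvent and a defect. A bound on the
  first controls \<open>res e f\<close> in \<open>'x\<close>; a bound on the second forces
  \<open>f - emb (res e f)\<close> to be of order sqrt(e).\<close>

lemma yosida_inner_self:
  assumes "0 < e"
  shows "yosida e f \<bullet> f = a (res e f) (res e f) + e * (norm (yosida e f))\<^sup>2"
proof -
  have "yosida e f \<bullet> f = yosida e f \<bullet> (emb (res e f) + e *\<^sub>R yosida e f)"
    using yosida_decomp[OF assms, of f] by simp
  then show ?thesis
    using assms by (simp add: inner_add_right yosida_inner_emb dot_square_norm)
qed

lemma bounded_linear_res:
  assumes "0 < e"
  shows "bounded_linear (res e)"
proof (rule bounded_linear_intro[where K = "sqrt (M * (1 + 2 / e))"])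
  fix f
  have "a (res e f) (res e f) \<le> yosida e f \<bullet> f"
    using yosida_inner_self[OF assms, of f] assms by simp
  also have "\<dots> \<le> norm (yosida e f) * norm f"
    by (rule norm_cauchy_schwarz)
  also have "\<dots> \<le> 2 / e * norm f * norm f"
    using norm_yosida_le[OF assms] by (intro mult_right_mono) auto
  finally have "a (res e f) (res e f) \<le> 2 / e * (norm f)\<^sup>2"
    by (simp add: power2_eq_square)
  moreover have "(norm (emb (res e f)))\<^sup>2 \<le> (norm f)\<^sup>2"
    using norm_emb_res_le[OF assms] by (intro power_mono) auto
  ultimately have "M * ((norm (emb (res e f)))\<^sup>2 + a (res e f) (res e f)) \<le> M * ((norm f)\<^sup>2 + 2 / e * (norm f)\<^sup>2)"
    using M_pos by (intro mult_left_mono add_mono) auto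
  then have "(norm (res e f))\<^sup>2 \<le> (norm f)\<^sup>2 * (M * (1 + 2 / e))"
    using norm_le_form[of "res e f"] by (simp add: algebra_simps)
  then have "norm (res e f) \<le> sqrt ((norm f)\<^sup>2 * (M * (1 + 2 / e)))"
    using real_le_rsqrt by blast
  then show "norm (res e f) \<le> norm f * sqrt (M * (1 + 2 / e))"
    by (simp add: real_sqrt_mult)
qed (use assms in \<open>simp_all add: res_add res_scaleR\<close>)

lemma bounded_linear_yosida: "0 < e \<Longrightarrow> bounded_linear (yosida e)"
  unfolding yosida_def
  by (intro bounded_linear_compose[OF bounded_linear_scaleR_right] bounded_linear_sub bounded_linear_ident
      bounded_linear_compose[OF bounded_linear_emb] bounded_linear_res)

text \<open>Both bounds come from testing the resolvent equation with the displacement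
  \<open>w - x\<close>.\<close>

lemma res_emb_bounds:
  assumes "0 < e"
  shows "a (res e (emb x)) (res e (emb x)) \<le> a x x"
    and "(norm (emb (res e (emb x)) - emb x))\<^sup>2 \<le> e * a x x"
proof -
  define w where "w = res e (emb x)"
  have "(norm (emb w - emb x))\<^sup>2 + e * (a w w - a w x) = 0"
    using res_eq[OF assms, of "emb x" "w - x"]
    by (simp add: w_def[symmetric] emb.diff a.diff_right power2_norm_eq_inner inner_diff_left
        inner_diff_right algebra_simps)
  then have eq: "(norm (emb w - emb x))\<^sup>2 = e * (a w x - a w w)"
    by (simp add: algebra_simps)
  then have "0 \<le> e * (a w x - a w w)"
    by (metis zero_le_power2)
  then have "a w w \<le> a w x"
    using assms by (simp add: zero_le_mult_iff)
  then show "a (res e (emb x)) (res e (emb x)) \<le> a x x"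
    using form_le_avg[of w x] by (simp add: w_def)
  have "a w x - a w w \<le> a x x"
    using form_le_avg[of w x] form_nonneg[of w] form_nonneg[of x] by (simp add: field_simps)
  then show "(norm (emb (res e (emb x)) - emb x))\<^sup>2 \<le> e * a x x"
    using eq assms by (simp add: w_def mult_left_mono)
qed

text \<open>This is the direction needed at time 0: the true energy of the data dominates all
  regularised energies.\<close>

lemma yosida_form_le:
  assumes "0 < e"
  shows "yosida e (emb x) \<bullet> emb x \<le> a x x"
  using res_emb_bounds(1)[OF assms, of x] form_le_avg[of "res e (emb x)" x] assms
  by (simp add: yosida_inner_emb)

text \<open>The hypothesis \<open>h\<close> places \<open>x\<close> in the domain of A, with A x =
  \<open>h\<close>. Since A commutes with its resolvents, the Yosida terms of such data are bounded
  by \<open>norm h\<close>, uniformly in \<open>e\<close>.\<close>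

lemma yosida_emb_domain:
  assumes "0 < e" and h: "\<And>y. a x y = h \<bullet> emb y"
  shows "yosida e (emb x) = emb (res e h)"
proof -
  have "res e (emb x) = x - e *\<^sub>R res e h"
  proof (rule res_unique[OF assms(1)])
    fix y
    have "e * (emb (res e h) \<bullet> emb y + e * a (res e h) y) = e * (h \<bullet> emb y)"
      by (simp add: res_eq[OF assms(1)])
    then show "emb (x - e *\<^sub>R res e h) \<bullet> emb y + e * a (x - e *\<^sub>R res e h) y = emb x \<bullet> emb y"
      by (simp add: emb.diff emb.scaleR a.diff_left a.scaleR_left inner_diff_left h algebra_simps)
  qed
  then show ?thesis
    using assms(1) by (simp add: yosida_def emb.diff emb.scaleR)
qed

text \<open>Testing the difference of the two resolvent equations with the difference of the
  resolvents gives \<open>a w w \<le> a w u\<close>; expanding the square then bounds the form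
  distance by the increment of the form. A bounded form along decreasing parameters is therefore a
  Cauchy criterion.\<close>

lemma form_res_diff_le:
  assumes "0 < d" "d \<le> e"
  shows "a (res d f - res e f) (res d f - res e f) \<le> a (res d f) (res d f) - a (res e f) (res e f)"
proof (cases "d = e")
  case False
  define u w where "u = res d f" and "w = res e f"
  have "(emb w - emb u) \<bullet> emb y = d * a u y - e * a w y" for y
    using res_eq[of d f y] res_eq[of e f y] assms by (simp add: u_def w_def inner_diff_left)
  from this[of "w - u"] have "0 \<le> d * a u (w - u) - e * a w (w - u)"
    by (metis emb.diff inner_ge_zero)
  then have 1: "e * (a w w - a w u) + d * (a u u - a w u) \<le> 0"
    by (simp add: a.diff_right form_sym[of u w] algebra_simps)
  have 2: "0 \<le> (a w w - a w u) + (a u u - a w u)"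
    using form_le_avg[of w u] by simp
  have "(e - d) * (a w w - a w u) \<le> - d * ((a w w - a w u) + (a u u - a w u))"
    using 1 by (simp add: algebra_simps)
  also have "\<dots> \<le> 0"
    using 2 assms by (simp add: mult_nonneg_nonneg)
  finally have "a w w \<le> a w u"
    using assms False by (simp add: mult_le_0_iff)
  then show ?thesis
    by (simp add: u_def[symmetric] w_def[symmetric] a.diff_left a.diff_right form_sym[of u w])
qed (simp add: a.zero_left)

section \<open>Limits in the form domain along vanishing resolvent parameters\<close>

definition \<delta> :: "nat \<Rightarrow> real" where "\<delta> n = 1 / real (Suc n)"

lemma \<delta>_pos [simp]: "0 < \<delta> n" and \<delta>_antimono: "m \<le> n \<Longrightarrow> \<delta> n \<le> \<delta> m" and \<delta>_tendsto: "\<delta> \<longlonglongrightarrow> 0"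
  using LIMSEQ_Suc[OF lim_1_over_n] by (auto simp: \<delta>_def[abs_def] field_simps)

text \<open>The limit is found by letting the resolvent parameter tend to 0, along which the form is
  monotone, so no weak compactness is needed.\<close>

lemma form_fatou_aux:
  assumes lim: "(\<lambda>n. emb (X n)) \<longlonglongrightarrow> u" and bd: "\<And>n. a (X n) (X n) \<le> c n" and c: "c \<longlonglongrightarrow> C"
  shows "\<exists>x. emb x = u \<and> a x x \<le> C \<and> (\<lambda>n. res (\<delta> n) u) \<longlonglongrightarrow> x"
proof -
  define r where "r k = res (\<delta> k) u" for k
  \<comment> \<open>For fixed \<open>k\<close> the resolvent is bounded from \<open>'h\<close> to
    \<open>'x\<close>, so convergence in \<open>'h\<close> suffices; the parameter is sent to 0 only
    afterwards.\<close>
  have rlim: "(\<lambda>n. res (\<delta> k) (emb (X n))) \<longlonglongrightarrow> r k" for k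
    unfolding r_def by (rule bounded_linear.tendsto[OF bounded_linear_res lim]) simp
  have 1: "a (r k) (r k) \<le> C" for k
    by (rule LIMSEQ_le[OF a.tendsto[OF rlim rlim] c])
      (use res_emb_bounds(1)[OF \<delta>_pos] bd order_trans in blast)
  have 2: "(norm (emb (r k) - u))\<^sup>2 \<le> \<delta> k * C" for k
  proof (rule LIMSEQ_le)
    show "(\<lambda>n. (norm (emb (res (\<delta> k) (emb (X n))) - emb (X n)))\<^sup>2) \<longlonglongrightarrow> (norm (emb (r k) - u))\<^sup>2"
      by (intro tendsto_intros emb.tendsto rlim lim)
    show "(\<lambda>n. \<delta> k * c n) \<longlonglongrightarrow> \<delta> k * C"
      by (intro tendsto_intros c)
    have "(norm (emb (res (\<delta> k) (emb (X n))) - emb (X n)))\<^sup>2 \<le> \<delta> k * c n" for n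
      using res_emb_bounds(2)[OF \<delta>_pos] bd[of n] \<delta>_pos[of k]
      by (meson less_imp_le mult_left_mono order_trans)
    then show "\<exists>N. \<forall>n\<ge>N. (norm (emb (res (\<delta> k) (emb (X n))) - emb (X n)))\<^sup>2 \<le> \<delta> k * c n"
      by blast
  qed
  have "(\<lambda>k. (norm (emb (r k) - u))\<^sup>2) \<longlonglongrightarrow> 0"
    by (rule tendsto_sandwich[OF _ _ tendsto_const, where h = "\<lambda>k. \<delta> k * C"])
      (use 2 tendsto_mult_left_zero[OF \<delta>_tendsto] in auto)
  then have "(\<lambda>k. sqrt ((norm (emb (r k) - u))\<^sup>2)) \<longlonglongrightarrow> sqrt 0"
    by (intro tendsto_intros)
  then have emb_r: "(\<lambda>k. emb (r k)) \<longlonglongrightarrow> u"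
    by (simp add: tendsto_norm_zero_iff flip: LIM_zero_iff[of _ u])
  have mono: "a (r j - r k) (r j - r k) \<le> a (r j) (r j) - a (r k) (r k)" if "k \<le> j" for j k
    unfolding r_def by (rule form_res_diff_le) (use that \<delta>_antimono in auto)
  \<comment> \<open>Monotone and bounded by \<open>C\<close>, hence convergent; \<open>mono\<close>
    then transfers the Cauchy property from these numbers to the form distances of
    \<open>r\<close>.\<close>
  have "incseq (\<lambda>k. a (r k) (r k))"
    unfolding incseq_def using mono form_nonneg by (smt (verit))
  then obtain \<alpha> where \<alpha>: "(\<lambda>k. a (r k) (r k)) \<longlonglongrightarrow> \<alpha>"
    using incseq_convergent[of "\<lambda>k. a (r k) (r k)" C] 1 by blast
  have "Cauchy r"
  proof (rule CauchyI)
    fix e :: real assume e: "0 < e"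
    define e' where "e' = e\<^sup>2 / (2 * M)"
    have e': "0 < e'" using e M_pos by (simp add: e'_def)
    have "Cauchy (\<lambda>k. a (r k) (r k))" "Cauchy (\<lambda>k. emb (r k))"
      using \<alpha> emb_r LIMSEQ_imp_Cauchy by blast+
    then obtain N1 N2 where N1: "\<And>j k. j \<ge> N1 \<Longrightarrow> k \<ge> N1 \<Longrightarrow> norm (a (r j) (r j) - a (r k) (r k)) < e'"
      and N2: "\<And>j k. j \<ge> N2 \<Longrightarrow> k \<ge> N2 \<Longrightarrow> norm (emb (r j) - emb (r k)) < sqrt e'"
      using e' unfolding Cauchy_iff by (metis real_sqrt_gt_zero)
    have *: "norm (r j - r k) < e" if "max N1 N2 \<le> k" "k \<le> j" for j k
    proof -
      have "(norm (emb (r j) - emb (r k)))\<^sup>2 < (sqrt e')\<^sup>2"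
        using N2[of j k] that by (intro power_strict_mono) auto
      moreover have "a (r j - r k) (r j - r k) < e'"
        using mono[of k j] N1[of j k] that by auto
      ultimately have "M * ((norm (emb (r j - r k)))\<^sup>2 + a (r j - r k) (r j - r k)) < M * (e' + e')"
        using M_pos e' by (intro mult_strict_left_mono add_strict_mono) (auto simp: emb.diff)
      then have "(norm (r j - r k))\<^sup>2 < e\<^sup>2"
        using norm_le_form[of "r j - r k"] M_pos by (simp add: e'_def)
      then show ?thesis
        using e by (simp add: power_less_imp_less_base)
    qed
    show "\<exists>N. \<forall>m\<ge>N. \<forall>n\<ge>N. norm (r m - r n) < e"
      using * by (intro exI[of _ "max N1 N2"]) (metis linear norm_minus_commute)
  qed
  then obtain x where x: "r \<longlonglongrightarrow> x"
    using Cauchy_convergent convergent_def by blast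
  have "emb x = u"
    using LIMSEQ_unique[OF emb.tendsto[OF x] emb_r] .
  moreover have "a x x \<le> C"
    by (rule LIMSEQ_le_const2[OF a.tendsto[OF x x]]) (use 1 in auto)
  ultimately show ?thesis
    using x by (auto simp: r_def[abs_def])
qed

text \<open>Density of the operator domain in the norm of \<open>'x\<close>: by
  \<open>yosida_inner_emb\<close> every \<open>res e f\<close> with \<open>0 < e\<close> lies in
  that domain.\<close>

lemma res_tendsto: "(\<lambda>n. res (\<delta> n) (emb x)) \<longlonglongrightarrow> x"
proof -
  have "\<exists>z. emb z = emb x \<and> a z z \<le> a x x \<and> (\<lambda>n. res (\<delta> n) (emb x)) \<longlonglongrightarrow> z"
    by (rule form_fatou_aux[where X = "\<lambda>n. x" and c = "\<lambda>n. a x x"]) auto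
  then show ?thesis
    using emb_inject by metis
qed

lemma form_fatou:
  assumes "(\<lambda>n. emb (X n)) \<longlonglongrightarrow> u" "\<And>n. a (X n) (X n) \<le> c n" "c \<longlonglongrightarrow> C"
  shows "\<exists>x. emb x = u \<and> a x x \<le> C"
  using form_fatou_aux[OF assms] by blast

text \<open>If the test element is a resolvent, the form against it is an inner product in
  \<open>'h\<close> and converges by hypothesis. The uniform bound on \<open>X n\<close> and
  \<open>res_tendsto\<close> extend this to every test element.\<close>

lemma form_weak_tendsto:
  assumes lim: "(\<lambda>n. emb (X n)) \<longlonglongrightarrow> emb x" and bd: "\<And>n. a (X n) (X n) \<le> C"
  shows "(\<lambda>n. a (X n) y) \<longlonglongrightarrow> a x y"
proof -
  obtain B0 where B0: "\<And>n. norm (emb (X n)) \<le> B0"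
    using convergent_imp_Bseq[OF convergentI[OF lim]] by (auto elim!: BseqE)
  obtain K where K: "\<And>x y. norm (a x y) \<le> norm x * norm y * K" "0 \<le> K"
    using a.nonneg_bounded by blast
  define B where "B = max (norm x) (sqrt (M * (B0\<^sup>2 + C)))"
  have X: "norm (X n) \<le> B" for n
  proof -
    have "(norm (emb (X n)))\<^sup>2 \<le> B0\<^sup>2"
      using B0 by (intro power_mono) auto
    then have "M * ((norm (emb (X n)))\<^sup>2 + a (X n) (X n)) \<le> M * (B0\<^sup>2 + C)"
      using M_pos bd by (intro mult_left_mono add_mono) auto
    then have "(norm (X n))\<^sup>2 \<le> M * (B0\<^sup>2 + C)"
      using norm_le_form[of "X n"] by linarith
    then show ?thesis
      unfolding B_def using real_le_rsqrt by fastforce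
  qed
  have "0 \<le> B" by (simp add: B_def le_max_iff_disj)
  show ?thesis
  proof (rule LIMSEQ_I)
    fix e :: real assume e: "0 < e"
    have "(\<lambda>k. B * norm (y - res (\<delta> k) (emb y)) * K) \<longlonglongrightarrow> B * norm (y - y) * K"
      by (intro tendsto_intros res_tendsto)
    then have "\<forall>\<^sub>F k in sequentially. B * norm (y - res (\<delta> k) (emb y)) * K < e / 3"
      using e by (intro order_tendstoD) auto
    then obtain k where k: "B * norm (y - res (\<delta> k) (emb y)) * K < e / 3"
      by (auto simp: eventually_sequentially)
    define z where "z = res (\<delta> k) (emb y)"
    have z: "norm (a v (y - z)) < e / 3" if "norm v \<le> B" for v
    proof -
      have "norm (a v (y - z)) \<le> norm v * norm (y - z) * K" by (rule K)
      also have "\<dots> \<le> B * norm (y - z) * K"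
        using that K(2) by (intro mult_right_mono) auto
      finally show ?thesis using k by (simp add: z_def)
    qed
    have "a v z = yosida (\<delta> k) (emb y) \<bullet> emb v" for v
      unfolding z_def by (simp add: yosida_inner_emb form_sym)
    moreover have "(\<lambda>n. yosida (\<delta> k) (emb y) \<bullet> emb (X n)) \<longlonglongrightarrow> yosida (\<delta> k) (emb y) \<bullet> emb x"
      by (intro tendsto_intros lim)
    ultimately have "(\<lambda>n. a (X n) z) \<longlonglongrightarrow> a x z" by simp
    then obtain N where N: "\<And>n. n \<ge> N \<Longrightarrow> norm (a (X n) z - a x z) < e / 3"
      using LIMSEQ_D[of _ _ "e / 3"] e by (metis zero_less_divide_iff zero_less_numeral)
    have "norm (a (X n) y - a x y) < e" if "n \<ge> N" for n
    proof -
      have "norm x \<le> B" by (simp add: B_def)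
      have "a (X n) y - a x y = a (X n) (y - z) + (a (X n) z - a x z) - a x (y - z)"
        by (simp add: a.diff_right)
      then show ?thesis
        using z[OF X[of n]] N[OF that] z[OF \<open>norm x \<le> B\<close>] by (simp add: abs_if split: if_splits)
    qed
    then show "\<exists>N. \<forall>n\<ge>N. norm (a (X n) y - a x y) < e" by blast
  qed
qed

text \<open>Weak convergence and convergence of the quadratic form give norm convergence, as in a
  Hilbert space: expand \<open>a (X n - x) (X n - x)\<close>.\<close>

lemma form_strong_tendsto:
  assumes lim: "(\<lambda>n. emb (X n)) \<longlonglongrightarrow> emb x" and form: "(\<lambda>n. a (X n) (X n)) \<longlonglongrightarrow> a x x"
  shows "X \<longlonglongrightarrow> x"
proof -
  obtain C where C: "\<And>n. norm (a (X n) (X n)) \<le> C"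
    using convergent_imp_Bseq[OF convergentI[OF form]] by (metis BseqE)
  have "a (X n) (X n) \<le> C" for n
    using C[of n] by simp
  then have weak: "(\<lambda>n. a (X n) x) \<longlonglongrightarrow> a x x"
    by (rule form_weak_tendsto[OF lim])
  have "(\<lambda>n. M * ((norm (emb (X n) - emb x))\<^sup>2 + (a (X n) (X n) - 2 * a (X n) x + a x x)))
      \<longlonglongrightarrow> M * ((norm (emb x - emb x))\<^sup>2 + (a x x - 2 * a x x + a x x))"
    by (intro tendsto_intros lim form weak)
  then have lim0: "(\<lambda>n. M * ((norm (emb (X n) - emb x))\<^sup>2 + (a (X n) (X n) - 2 * a (X n) x + a x x))) \<longlonglongrightarrow> 0"
    by simp
  have "(norm (X n - x))\<^sup>2 \<le> M * ((norm (emb (X n) - emb x))\<^sup>2 + (a (X n) (X n) - 2 * a (X n) x + a x x))" for n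
    using norm_le_form[of "X n - x"]
    by (simp add: emb.diff a.diff_left a.diff_right form_sym[of x "X n"] algebra_simps)
  then have "(\<lambda>n. (norm (X n - x))\<^sup>2) \<longlonglongrightarrow> 0"
    by (intro tendsto_sandwich[OF _ _ tendsto_const lim0]) auto
  then have "(\<lambda>n. sqrt ((norm (X n - x))\<^sup>2)) \<longlonglongrightarrow> sqrt 0"
    by (intro tendsto_intros)
  then show ?thesis
    by (simp add: tendsto_norm_zero_iff LIM_zero_iff)
qed

end

section \<open>The regularised evolution\<close>

text \<open>\<open>I\<close> is multiplication by the imaginary unit seen as a real isometry, and
  \<open>IX\<close> is its lift to the form domain. \<open>g_inner_I\<close> is gauge invariance,
  the source of mass conservation; \<open>G_gradient\<close> makes \<open>g\<close> the gradient of
  \<open>G\<close>, the source of energy conservation.\<close>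

locale schroedinger_form = hilbert_form emb a M
  for emb :: "'x::banach \<Rightarrow> 'h::{real_inner,banach}" and a M +
  fixes I :: "'h \<Rightarrow> 'h" and IX :: "'x \<Rightarrow> 'x" and g :: "'h \<Rightarrow> 'h" and G :: "'h \<Rightarrow> real" and L :: real
  assumes bounded_linear_I: "bounded_linear I"
    and I_inner: "I u \<bullet> I v = u \<bullet> v"
    and I_I: "I (I u) = - u"
    and emb_IX: "emb (IX x) = I (emb x)"
    and form_IX: "a (IX x) (IX y) = a x y"
    and L_pos: "0 < L"
    and g_lipschitz: "norm (g u - g v) \<le> L * norm (u - v)"
    and g_inner_I: "g u \<bullet> I u = 0"
    and g_0: "g 0 = 0"
    and G_0: "G 0 = 0"
    and G_gradient: "\<bar>G v - G u - g u \<bullet> (v - u)\<bar> \<le> L * (norm (v - u))\<^sup>2"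
begin

sublocale I: bounded_linear I by (rule bounded_linear_I)

lemma norm_I [simp]: "norm (I u) = norm u"
  by (simp add: norm_eq_sqrt_inner I_inner)

lemma I_skew: "I u \<bullet> v = - (u \<bullet> I v)"
  using I_inner[of "I u" v] by (simp add: I_I)

lemma I_inner_self: "I u \<bullet> u = 0"
  using I_skew[of u u] by (simp add: inner_commute)

lemma IX_IX: "IX (IX x) = - x"
  by (rule emb_inject) (simp add: emb_IX I_I emb.neg)

lemma form_IX_skew: "a (IX x) y = - a x (IX y)"
  using form_IX[of "IX x" y] by (simp add: IX_IX a.minus_left)

lemma form_IX_self: "a x (IX x) = 0"
  using form_IX_skew[of x x] form_sym[of x "IX x"] by simp

lemma res_I:
  assumes "0 < e"
  shows "res e (I f) = IX (res e f)"
proof (rule res_unique[OF assms])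
  fix y
  show "emb (IX (res e f)) \<bullet> emb y + e * a (IX (res e f)) y = I f \<bullet> emb y"
    using res_eq[OF assms, of f "IX y"] by (simp add: emb_IX I_skew form_IX_skew)
qed

lemma I_yosida: "0 < e \<Longrightarrow> I (yosida e f) = yosida e (I f)"
  by (simp add: yosida_def I.scaleR I.diff res_I emb_IX)

lemma I_yosida_inner_self:
  assumes "0 < e"
  shows "I (yosida e f) \<bullet> f = 0"
  using yosida_sym[OF assms, of "I f" f] I_skew[of "yosida e f" f] 
  by (simp add: I_yosida[OF assms] inner_commute)

lemma norm_g_le: "norm (g u) \<le> L * norm u"
  using g_lipschitz[of u 0] by (simp add: g_0)

lemma abs_G_le: "\<bar>G u\<bar> \<le> L * (norm u)\<^sup>2"
  using G_gradient[of u 0] by (simp add: g_0 G_0)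

lemma has_vector_derivative_G:
  assumes "(u has_vector_derivative u') (at t within S)"
  shows "((\<lambda>t. G (u t)) has_vector_derivative g (u t) \<bullet> u') (at t within S)"
proof -
  have "(G has_derivative (\<lambda>h. g v \<bullet> h)) (at v)" for v
    unfolding has_derivative_iff_norm
  proof
    show "bounded_linear ((\<bullet>) (g v))" by (rule bounded_linear_inner_right)
    have lim: "((\<lambda>y. L * norm (y - v)) \<longlongrightarrow> L * norm (v - v)) (at v)"
      by (intro tendsto_intros)
    have *: "norm (G y - G v - g v \<bullet> (y - v)) / norm (y - v) \<le> L * norm (y - v)" for y
    proof (cases "y = v")
      case False
      then show ?thesis
        using G_gradient[of y v] by (simp add: divide_le_eq power2_eq_square mult.assoc)
    qed simp
    show "((\<lambda>y. norm (G y - G v - g v \<bullet> (y - v)) / norm (y - v)) \<longlongrightarrow> 0) (at v)"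
      by (rule tendsto_sandwich[OF _ _ tendsto_const]) (use lim * in auto)
  qed
  then have "((\<lambda>t. G (u t)) has_derivative (\<lambda>h. g (u t) \<bullet> (h *\<^sub>R u'))) (at t within S)"
    using assms unfolding has_vector_derivative_def by (rule has_derivative_compose[rotated])
  then show ?thesis
    by (simp add: has_vector_derivative_def)
qed

lemma continuous_g: "continuous_on S g"
  by (rule lipschitz_on_continuous_on[of L])
    (use g_lipschitz L_pos in \<open>auto intro!: lipschitz_onI simp: dist_norm\<close>)

lemma continuous_G: "continuous_on S G"
  by (intro continuous_at_imp_continuous_on ballI isCont_if_quadratic_remainder[OF G_gradient])

text \<open>The equation i u' = A u - g(u) solved for u', with A replaced by its Yosida
  approximation.\<close>

definition vf :: "real \<Rightarrow> 'h \<Rightarrow> 'h" where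
  "vf e u = I (g u - yosida e u)"

lemma vf_lipschitz:
  assumes "0 < e"
  shows "norm (vf e u - vf e v) \<le> (L + 2 / e) * norm (u - v)"
proof -
  have "vf e u - vf e v = I ((g u - g v) - yosida e (u - v))"
    by (simp add: vf_def I.diff yosida_diff[OF assms])
  then have "norm (vf e u - vf e v) = norm ((g u - g v) - yosida e (u - v))"
    by simp
  also have "\<dots> \<le> norm (g u - g v) + norm (yosida e (u - v))"
    by (rule norm_triangle_ineq4)
  also have "\<dots> \<le> L * norm (u - v) + 2 / e * norm (u - v)"
    by (intro add_mono g_lipschitz norm_yosida_le assms)
  finally show ?thesis by (simp add: algebra_simps)
qed

section \<open>Existence, stability and conservation laws of the regularised flow\<close>

definition solution :: "real \<Rightarrow> (real \<Rightarrow> 'h) \<Rightarrow> real \<Rightarrow> bool" where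
  "solution e u T \<longleftrightarrow> (\<forall>t\<in>{0..T}. (u has_vector_derivative vf e (u t)) (at t within {0..T}))"

definition flow :: "real \<Rightarrow> 'h \<Rightarrow> real \<Rightarrow> 'h" where
  "flow e w = (SOME u. u 0 = w \<and> (\<forall>t\<ge>0. (u has_vector_derivative vf e (u t)) (at t within {0..})))"

lemma
  assumes "0 < e"
  shows flow_0: "flow e w 0 = w"
    and flow_deriv: "\<And>t. 0 \<le> t \<Longrightarrow> (flow e w has_vector_derivative vf e (flow e w t)) (at t within {0..})"
proof -
  have "\<exists>u. u 0 = w \<and> (\<forall>t\<ge>0. (u has_vector_derivative vf e (u t)) (at t within {0..}))"
    by (rule picard_lindelof_global[of "L + 2 / e"])
      (use assms L_pos vf_lipschitz in \<open>auto intro!: add_pos_pos\<close>)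
  from someI_ex[OF this]
  show "flow e w 0 = w" "\<And>t. 0 \<le> t \<Longrightarrow> (flow e w has_vector_derivative vf e (flow e w t)) (at t within {0..})"
    unfolding flow_def by auto
qed

lemma solution_flow: "0 < e \<Longrightarrow> solution e (flow e w) T"
  unfolding solution_def
  by (intro ballI has_vector_derivative_within_subset[OF flow_deriv]) auto

lemma solution_flow_shift:
  assumes "0 < e" "0 \<le> h"
  shows "solution e (\<lambda>t. flow e w (t + h)) T"
  unfolding solution_def
proof
  fix t assume t: "t \<in> {0..T}"
  have "((\<lambda>t. t + h) has_vector_derivative 1) (at t within {0..T})"
    by (auto intro!: derivative_eq_intros)
  moreover have "(flow e w has_vector_derivative vf e (flow e w (t + h))) (at (t + h) within (\<lambda>t. t + h) ` {0..T})"
    using t assms by (intro has_vector_derivative_within_subset[OF flow_deriv]) auto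
  ultimately show "((\<lambda>t. flow e w (t + h)) has_vector_derivative vf e (flow e w (t + h))) (at t within {0..T})"
    using vector_diff_chain_within[of "\<lambda>t. t + h" 1 t "{0..T}" "flow e w"] by (simp add: o_def)
qed

text \<open>\<open>I\<close> composed with the Yosida approximation is skew and drops out of the
  derivative of the squared distance. Only \<open>L\<close> remains, unlike in
  \<open>vf_lipschitz\<close>, so the bound is uniform in \<open>e\<close>.\<close>

lemma solution_dist_le:
  assumes "0 < e" "0 \<le> T" and u: "solution e u T" and v: "solution e v T"
  shows "norm (u T - v T) \<le> exp (L * T) * norm (u 0 - v 0)"
proof -
  define y where "y = (\<lambda>t. (norm (u t - v t))\<^sup>2)"
  have "y T \<le> (y 0 + 0 * T) * exp (2 * L * T)"
  proof (rule gronwall_linear[where y' = "\<lambda>t. 2 * ((vf e (u t) - vf e (v t)) \<bullet> (u t - v t))"])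
    fix t assume t: "0 \<le> t" "t \<le> T"
    show "(y has_vector_derivative 2 * ((vf e (u t) - vf e (v t)) \<bullet> (u t - v t))) (at t within {0..T})"
      unfolding y_def using u v t
      by (intro has_vector_derivative_norm_sq has_vector_derivative_diff) (auto simp: solution_def)
    have "(vf e (u t) - vf e (v t)) \<bullet> (u t - v t) = I (g (u t) - g (v t)) \<bullet> (u t - v t)"
      using I_yosida_inner_self[OF assms(1), of "u t - v t"]
      by (simp add: vf_def I.diff yosida_diff[OF assms(1)] inner_diff_left inner_diff_right)
    also have "\<dots> \<le> norm (g (u t) - g (v t)) * norm (u t - v t)"
      using norm_cauchy_schwarz[of "I (g (u t) - g (v t))"] by simp
    also have "\<dots> \<le> L * norm (u t - v t) * norm (u t - v t)"
      by (intro mult_right_mono g_lipschitz) auto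
    finally show "2 * ((vf e (u t) - vf e (v t)) \<bullet> (u t - v t)) \<le> 2 * L * y t + 0"
      by (simp add: y_def power2_eq_square)
  qed (use assms L_pos in auto)
  then have "(norm (u T - v T))\<^sup>2 \<le> (exp (L * T) * norm (u 0 - v 0))\<^sup>2"
    by (simp add: y_def power_mult_distrib exp_double[symmetric] mult_ac)
  then show ?thesis
    by (rule power2_le_imp_le) simp
qed

lemma solution_unique:
  assumes "0 < e" "0 \<le> T" "solution e u T" "solution e v T" "u 0 = v 0"
  shows "u T = v T"
  using solution_dist_le[OF assms(1-4)] assms(5) by simp

lemma flow_mass:
  assumes "0 < e" "0 \<le> t"
  shows "norm (flow e w t) = norm w"
proof -
  have "(norm (flow e w t))\<^sup>2 = (norm (flow e w 0))\<^sup>2"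
  proof (rule has_vector_derivative_zero_imp_eq[OF assms(2)])
    fix s assume "s \<in> {0..t}"
    then have "((\<lambda>s. (norm (flow e w s))\<^sup>2) has_vector_derivative 2 * (vf e (flow e w s) \<bullet> flow e w s)) (at s within {0..t})"
      using solution_flow[OF assms(1), of w t] by (intro has_vector_derivative_norm_sq) (simp add: solution_def)
    moreover have "vf e (flow e w s) \<bullet> flow e w s = 0"
      using g_inner_I I_yosida_inner_self[OF assms(1)] by (simp add: vf_def I.diff inner_diff_left I_skew[of "g _"])
    ultimately show "((\<lambda>s. (norm (flow e w s))\<^sup>2) has_vector_derivative 0) (at s within {0..t})"
      by simp
  qed
  then show ?thesis
    by (simp add: flow_0[OF assms(1)])
qed

text \<open>The vector field is \<open>- I\<close> applied to the gradient of the regularised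
  energy, and \<open>I\<close> is skew.\<close>

lemma flow_energy:
  assumes "0 < e" "0 \<le> t"
  shows "yosida e (flow e w t) \<bullet> flow e w t / 2 - G (flow e w t) = yosida e w \<bullet> w / 2 - G w"
proof -
  define u where "u = flow e w"
  have "yosida e (u t) \<bullet> u t / 2 - G (u t) = yosida e (u 0) \<bullet> u 0 / 2 - G (u 0)"
  proof (rule has_vector_derivative_zero_imp_eq[OF assms(2), where f = "\<lambda>t. yosida e (u t) \<bullet> u t / 2 - G (u t)"])
    fix s assume "s \<in> {0..t}"
    then have d: "(u has_vector_derivative vf e (u s)) (at s within {0..t})"
      using solution_flow[OF assms(1), of w t] by (simp add: solution_def u_def)
    have d2: "((\<lambda>s. yosida e (u s)) has_vector_derivative yosida e (vf e (u s))) (at s within {0..t})"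
      by (rule bounded_linear.has_vector_derivative[OF bounded_linear_yosida d]) (rule assms)
    have d3: "((\<lambda>s. yosida e (u s) \<bullet> u s) has_vector_derivative
        yosida e (u s) \<bullet> vf e (u s) + yosida e (vf e (u s)) \<bullet> u s) (at s within {0..t})"
      by (rule bounded_bilinear.has_vector_derivative[OF bounded_bilinear_inner d2 d])
    have "((\<lambda>s. yosida e (u s) \<bullet> u s / 2 - G (u s)) has_vector_derivative
        (yosida e (u s) \<bullet> vf e (u s) + yosida e (vf e (u s)) \<bullet> u s) / 2 - g (u s) \<bullet> vf e (u s)) (at s within {0..t})"
      by (intro has_vector_derivative_diff has_vector_derivative_G[OF d] has_vector_derivative_divide d3)
    moreover have "yosida e (vf e (u s)) \<bullet> u s = yosida e (u s) \<bullet> vf e (u s)"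
      using yosida_sym[OF assms(1), of "vf e (u s)" "u s"] by (simp add: inner_commute)
    moreover have "(g (u s) - yosida e (u s)) \<bullet> vf e (u s) = 0"
      unfolding vf_def using I_inner_self[of "g (u s) - yosida e (u s)"] by (simp add: inner_commute)
    ultimately show "((\<lambda>s. yosida e (u s) \<bullet> u s / 2 - G (u s)) has_vector_derivative 0) (at s within {0..t})"
      by (simp add: inner_diff_left)
  qed
  then show ?thesis
    by (simp add: u_def flow_0[OF assms(1)])
qed

text \<open>The flow and its translate by \<open>\<delta> n\<close> are both solutions: apply the
  stability bound, divide by \<open>\<delta> n\<close> and let \<open>n\<close> grow. This bounds
  the time derivative for a merely Lipschitz \<open>g\<close>.\<close>

lemma norm_vf_flow_le:
  assumes "0 < e" "0 \<le> t"
  shows "norm (vf e (flow e w t)) \<le> exp (L * t) * norm (vf e w)"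
proof (rule LIMSEQ_le)
  have q: "(\<lambda>n. norm ((1 / \<delta> n) *\<^sub>R (flow e w (t + \<delta> n) - flow e w t))) \<longlonglongrightarrow> norm (vf e (flow e w t))"
    if "0 \<le> t" for t
    by (intro tendsto_norm tendsto_difference_quotient flow_deriv \<delta>_tendsto \<delta>_pos that assms)
  show "(\<lambda>n. norm ((1 / \<delta> n) *\<^sub>R (flow e w (t + \<delta> n) - flow e w t))) \<longlonglongrightarrow> norm (vf e (flow e w t))"
    by (rule q[OF assms(2)])
  show "(\<lambda>n. exp (L * t) * norm ((1 / \<delta> n) *\<^sub>R (flow e w (0 + \<delta> n) - flow e w 0))) \<longlonglongrightarrow> exp (L * t) * norm (vf e w)"
    using q[of 0] by (intro tendsto_mult_left) (simp add: flow_0[OF assms(1)])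
  have "norm (flow e w (t + \<delta> n) - flow e w t) \<le> exp (L * t) * norm (flow e w (0 + \<delta> n) - flow e w 0)" for n
    using solution_dist_le[OF assms solution_flow_shift[OF assms(1) less_imp_le[OF \<delta>_pos]] solution_flow[OF assms(1)]] by simp
  then have "1 / \<delta> n * norm (flow e w (t + \<delta> n) - flow e w t)
      \<le> 1 / \<delta> n * (exp (L * t) * norm (flow e w (0 + \<delta> n) - flow e w 0))" for n
    by (intro mult_left_mono) (auto simp: less_imp_le)
  then show "\<exists>N. \<forall>n\<ge>N. norm ((1 / \<delta> n) *\<^sub>R (flow e w (t + \<delta> n) - flow e w t))
      \<le> exp (L * t) * norm ((1 / \<delta> n) *\<^sub>R (flow e w (0 + \<delta> n) - flow e w 0))"
    by (simp add: mult.left_commute less_imp_le[OF \<delta>_pos])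
qed

text \<open>For data in the domain of the generator the Yosida terms stay bounded along the flow, since
  the time derivative of the flow is controlled by its initial value.\<close>

lemma norm_yosida_flow_le:
  assumes "0 < e" "0 \<le> t" "t \<le> T" and h: "\<And>y. a x y = h \<bullet> emb y"
  shows "norm (yosida e (flow e (emb x) t)) \<le> exp (L * T) * (L * norm (emb x) + norm h) + L * norm (emb x)"
proof -
  define u where "u = flow e (emb x) t"
  have "norm (vf e (emb x)) \<le> norm (g (emb x)) + norm (yosida e (emb x))"
    by (simp add: vf_def norm_triangle_ineq4)
  also have "norm (yosida e (emb x)) \<le> norm h"
    using yosida_emb_domain[OF assms(1) h] norm_emb_res_le[OF assms(1), of h] by simp
  finally have 1: "norm (vf e (emb x)) \<le> L * norm (emb x) + norm h"
    using norm_g_le[of "emb x"] by simp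
  have "norm (vf e u) \<le> exp (L * t) * norm (vf e (emb x))"
    unfolding u_def by (rule norm_vf_flow_le[OF assms(1,2)])
  also have "\<dots> \<le> exp (L * T) * (L * norm (emb x) + norm h)"
    using 1 assms L_pos by (intro mult_mono) auto
  finally have 2: "norm (g u - yosida e u) \<le> exp (L * T) * (L * norm (emb x) + norm h)"
    by (simp add: vf_def)
  have "norm (yosida e u) \<le> norm (g u - yosida e u) + norm (g u)"
    using norm_triangle_ineq4[of "g u" "g u - yosida e u"] by simp
  moreover have "norm u = norm (emb x)"
    unfolding u_def by (rule flow_mass[OF assms(1,2)])
  ultimately show ?thesis
    using 2 norm_g_le[of u] by (simp add: u_def)
qed

text \<open>Write each solution as its resolvent plus the parameter times its Yosida term. The
  resolvent parts pair to zero with \<open>I Y\<close>, because \<open>Y\<close> represents the form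
  at \<open>r\<close> and \<open>a r (IX r) = 0\<close>. What is left is of order
  \<open>e + d\<close> by the bound \<open>K\<close> on the Yosida terms.\<close>

lemma flow_domain_dist_le:
  assumes e: "0 < e" and d: "0 < d" and t: "0 \<le> t" "t \<le> T" and h: "\<And>y. a x y = h \<bullet> emb y"
    and K: "K = exp (L * T) * (L * norm (emb x) + norm h) + L * norm (emb x)"
  shows "(norm (flow e (emb x) t - flow d (emb x) t))\<^sup>2 \<le> 4 * K\<^sup>2 * (e + d) * T * exp (2 * L * T)"
proof -
  define u v where "u = flow e (emb x)" and "v = flow d (emb x)"
  define y where "y = (\<lambda>t. (norm (u t - v t))\<^sup>2)"
  have "y t \<le> (y 0 + 4 * K\<^sup>2 * (e + d) * t) * exp (2 * L * t)"
  proof (rule gronwall_linear[where y' = "\<lambda>t. 2 * ((vf e (u t) - vf d (v t)) \<bullet> (u t - v t))"])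
    fix s assume s: "0 \<le> s" "s \<le> t"
    show "(y has_vector_derivative 2 * ((vf e (u s) - vf d (v s)) \<bullet> (u s - v s))) (at s within {0..t})"
      unfolding y_def using solution_flow[OF e, of "emb x" t] solution_flow[OF d, of "emb x" t] s
      by (intro has_vector_derivative_norm_sq has_vector_derivative_diff) (auto simp: solution_def u_def v_def)
    define Y r where "Y = yosida e (u s) - yosida d (v s)" and "r = res e (u s) - res d (v s)"
    have K1: "norm (yosida e (u s)) \<le> K" and K2: "norm (yosida d (v s)) \<le> K"
      unfolding K u_def v_def using norm_yosida_flow_le[OF e s(1) _ h, of T]
        norm_yosida_flow_le[OF d s(1) _ h, of T] s t by simp_all
    have K0: "0 \<le> K" using K1 norm_ge_zero order_trans by blast
    have "u s - v s = emb r + (e *\<^sub>R yosida e (u s) - d *\<^sub>R yosida d (v s))"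
      using yosida_decomp[OF e, of "u s"] yosida_decomp[OF d, of "v s"] by (simp add: r_def emb.diff algebra_simps)
    moreover have "I Y \<bullet> emb r = 0"
    proof -
      have "Y \<bullet> emb (IX r) = a r (IX r)"
        unfolding Y_def r_def by (simp add: inner_diff_left yosida_inner_emb[OF e] yosida_inner_emb[OF d] a.diff_left)
      then show ?thesis
        by (simp add: I_skew emb_IX[symmetric] form_IX_self)
    qed
    ultimately have "I Y \<bullet> (u s - v s) = I Y \<bullet> (e *\<^sub>R yosida e (u s) - d *\<^sub>R yosida d (v s))"
      by (simp add: inner_add_right)
    then have "- (I Y \<bullet> (u s - v s)) \<le> norm Y * norm (e *\<^sub>R yosida e (u s) - d *\<^sub>R yosida d (v s))"
      using norm_cauchy_schwarz[of "- I Y"] by simp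
    also have "\<dots> \<le> (K + K) * (e * K + d * K)"
    proof (intro mult_mono)
      show "norm Y \<le> K + K"
        unfolding Y_def using norm_triangle_ineq4[of "yosida e (u s)" "yosida d (v s)"] K1 K2 by linarith
      have "norm (e *\<^sub>R yosida e (u s) - d *\<^sub>R yosida d (v s)) \<le> e * norm (yosida e (u s)) + d * norm (yosida d (v s))"
        using norm_triangle_ineq4[of "e *\<^sub>R yosida e (u s)" "d *\<^sub>R yosida d (v s)"] e d by simp
      also have "\<dots> \<le> e * K + d * K"
        using K1 K2 e d by (intro add_mono mult_left_mono) auto
      finally show "norm (e *\<^sub>R yosida e (u s) - d *\<^sub>R yosida d (v s)) \<le> e * K + d * K" .
    qed (use K0 in auto)
    also have "\<dots> = 2 * K\<^sup>2 * (e + d)"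
      by (simp add: power2_eq_square algebra_simps)
    finally have 1: "- (I Y \<bullet> (u s - v s)) \<le> 2 * K\<^sup>2 * (e + d)" .
    have "I (g (u s) - g (v s)) \<bullet> (u s - v s) \<le> norm (g (u s) - g (v s)) * norm (u s - v s)"
      using norm_cauchy_schwarz[of "I (g (u s) - g (v s))"] by simp
    also have "\<dots> \<le> L * norm (u s - v s) * norm (u s - v s)"
      by (intro mult_right_mono g_lipschitz) auto
    finally have 2: "I (g (u s) - g (v s)) \<bullet> (u s - v s) \<le> L * y s"
      by (simp add: y_def power2_eq_square)
    have "(vf e (u s) - vf d (v s)) \<bullet> (u s - v s) = I (g (u s) - g (v s)) \<bullet> (u s - v s) - I Y \<bullet> (u s - v s)"
      by (simp add: vf_def Y_def I.diff inner_diff_left)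
    then show "2 * ((vf e (u s) - vf d (v s)) \<bullet> (u s - v s)) \<le> 2 * L * y s + 4 * K\<^sup>2 * (e + d)"
      using 1 2 by linarith
  qed (use t e d L_pos in auto)
  also have "y 0 = 0"
    by (simp add: y_def u_def v_def flow_0 e d)
  also have "(0 + 4 * K\<^sup>2 * (e + d) * t) * exp (2 * L * t) \<le> (4 * K\<^sup>2 * (e + d) * T) * exp (2 * L * T)"
    using t e d L_pos by (intro mult_mono) (auto intro!: mult_left_mono)
  finally show ?thesis
    by (simp add: y_def u_def v_def)
qed

end

section \<open>Passage to the limit\<close>

context schroedinger_form
begin

section \<open>Convergence of the regularised flows in the ambient space\<close>

definition approx :: "nat \<Rightarrow> 'x \<Rightarrow> real \<Rightarrow> 'h" where
  "approx n x = flow (\<delta> n) (emb x)"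

definition evol :: "'x \<Rightarrow> real \<Rightarrow> 'h" where
  "evol x t = lim (\<lambda>n. approx n x t)"

lemma approx_0: "approx n x 0 = emb x"
  by (simp add: approx_def flow_0)

lemma norm_approx: "0 \<le> t \<Longrightarrow> norm (approx n x t) = norm (emb x)"
  by (simp add: approx_def flow_mass)

lemma continuous_on_approx: "continuous_on {0..} (approx n x)"
  unfolding approx_def
  by (rule continuous_on_vector_derivative[where f' = "\<lambda>t. vf (\<delta> n) (flow (\<delta> n) (emb x) t)"]) (simp add: flow_deriv)

lemma flow_dist_le:
  assumes "0 < e" "0 \<le> t" "t \<le> T"
  shows "norm (flow e v t - flow e w t) \<le> exp (L * T) * norm (v - w)"
proof -
  have "norm (flow e v t - flow e w t) \<le> exp (L * t) * norm (v - w)"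
    using solution_dist_le[OF assms(1,2) solution_flow[OF assms(1)] solution_flow[OF assms(1)], of v w]
    by (simp add: flow_0 assms(1))
  also have "\<dots> \<le> exp (L * T) * norm (v - w)"
    using assms L_pos by (intro mult_right_mono) auto
  finally show ?thesis .
qed

lemma uniformly_Cauchy_approx_domain:
  assumes h: "\<And>y. a x y = h \<bullet> emb y" and T: "0 \<le> T"
  shows "uniformly_Cauchy_on {0..T} (\<lambda>n. approx n x)"
proof (rule uniformly_Cauchy_onI)
  fix e :: real assume e: "0 < e"
  define K where "K = exp (L * T) * (L * norm (emb x) + norm h) + L * norm (emb x)"
  define B where "B = 4 * K\<^sup>2 * T * exp (2 * L * T)"
  have B: "0 \<le> B" using T by (simp add: B_def)
  have "(\<lambda>n. B * (\<delta> n + \<delta> n)) \<longlonglongrightarrow> B * (0 + 0)"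
    by (intro tendsto_intros \<delta>_tendsto)
  then have "\<forall>\<^sub>F n in sequentially. B * (\<delta> n + \<delta> n) < e\<^sup>2"
    using e by (intro order_tendstoD) auto
  then obtain N where N: "B * (\<delta> N + \<delta> N) < e\<^sup>2"
    by (auto simp: eventually_sequentially)
  show "\<exists>M. \<forall>t\<in>{0..T}. \<forall>m\<ge>M. \<forall>n\<ge>M. dist (approx m x t) (approx n x t) < e"
  proof (intro exI[of _ N] ballI allI impI)
    fix t m n assume t: "t \<in> {0..T}" and mn: "N \<le> m" "N \<le> n"
    have "(norm (approx m x t - approx n x t))\<^sup>2 \<le> 4 * K\<^sup>2 * (\<delta> m + \<delta> n) * T * exp (2 * L * T)"
      unfolding approx_def using t by (intro flow_domain_dist_le[OF _ _ _ _ h K_def]) auto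
    also have "\<dots> = B * (\<delta> m + \<delta> n)"
      by (simp add: B_def)
    also have "\<dots> \<le> B * (\<delta> N + \<delta> N)"
      using B mn by (intro mult_left_mono add_mono \<delta>_antimono) auto
    finally have "(norm (approx m x t - approx n x t))\<^sup>2 < e\<^sup>2"
      using N by simp
    then show "dist (approx m x t) (approx n x t) < e"
      using e by (simp add: dist_norm power_less_imp_less_base)
  qed
qed

text \<open>The data are replaced by a resolvent, which lies in the operator domain. Since the
  stability bound does not see the Yosida parameter, the error is uniform in \<open>n\<close> and
  \<open>t\<close>.\<close>

lemma uniformly_Cauchy_approx:
  assumes T: "0 \<le> T"
  shows "uniformly_Cauchy_on {0..T} (\<lambda>n. approx n x)"
proof (rule uniformly_Cauchy_onI)
  fix e :: real assume e: "0 < e"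
  have "(\<lambda>k. exp (L * T) * norm (emb x - emb (res (\<delta> k) (emb x)))) \<longlonglongrightarrow> exp (L * T) * norm (emb x - emb x)"
    by (intro tendsto_intros emb.tendsto res_tendsto)
  then have "\<forall>\<^sub>F k in sequentially. exp (L * T) * norm (emb x - emb (res (\<delta> k) (emb x))) < e / 3"
    by (rule order_tendstoD(2)) (use e in simp)
  then obtain k where k: "exp (L * T) * norm (emb x - emb (res (\<delta> k) (emb x))) < e / 3"
    by (auto simp: eventually_sequentially)
  define z where "z = res (\<delta> k) (emb x)"
  have "uniformly_Cauchy_on {0..T} (\<lambda>n. approx n z)"
    by (rule uniformly_Cauchy_approx_domain[where h = "yosida (\<delta> k) (emb x)", OF _ T])
      (simp add: z_def yosida_inner_emb)
  then obtain N where N: "\<And>t m n. t \<in> {0..T} \<Longrightarrow> m \<ge> N \<Longrightarrow> n \<ge> N \<Longrightarrow> dist (approx m z t) (approx n z t) < e / 3"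
    using e unfolding uniformly_Cauchy_on_def by (metis zero_less_divide_iff zero_less_numeral)
  have close: "dist (approx n x t) (approx n z t) < e / 3" if "t \<in> {0..T}" for n t
    using flow_dist_le[of "\<delta> n" t T "emb x" "emb z"] that k by (simp add: approx_def dist_norm z_def)
  show "\<exists>M. \<forall>t\<in>{0..T}. \<forall>m\<ge>M. \<forall>n\<ge>M. dist (approx m x t) (approx n x t) < e"
  proof (intro exI[of _ N] ballI allI impI)
    fix t m n assume t: "t \<in> {0..T}" and mn: "N \<le> m" "N \<le> n"
    have "dist (approx m x t) (approx n x t) \<le> dist (approx m x t) (approx m z t)
        + (dist (approx m z t) (approx n z t) + dist (approx n z t) (approx n x t))"
      by (meson add_left_mono dist_triangle order_trans)
    then show "dist (approx m x t) (approx n x t) < e"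
      using close[OF t, of m] close[OF t, of n] N[OF t mn] by (simp add: dist_commute)
  qed
qed

lemma uniform_limit_approx:
  assumes "0 \<le> T"
  shows "uniform_limit {0..T} (\<lambda>n. approx n x) (evol x) sequentially"
  using Cauchy_uniformly_convergent[OF uniformly_Cauchy_approx[OF assms]]
  unfolding uniformly_convergent_uniform_limit_iff evol_def .

lemma approx_tendsto: "0 \<le> t \<Longrightarrow> (\<lambda>n. approx n x t) \<longlonglongrightarrow> evol x t"
  using tendsto_uniform_limitI[OF uniform_limit_approx[of t], of t] by simp

lemma continuous_on_evol: "continuous_on {0..} (evol x)"
  by (rule continuous_on_atLeast_uniform_limit[OF continuous_on_approx uniform_limit_approx])

lemma evol_0: "evol x 0 = emb x"
  using approx_tendsto[of 0 x] by (simp add: approx_0 LIMSEQ_const_iff)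

lemma norm_evol: "0 \<le> t \<Longrightarrow> norm (evol x t) = norm (emb x)"
  using tendsto_norm[OF approx_tendsto[of t x]] by (simp add: norm_approx LIMSEQ_const_iff)

section \<open>Energy bounds and return of the limit to the form domain\<close>

lemma approx_energy_le:
  assumes "0 \<le> t"
  shows "a (res (\<delta> n) (approx n x t)) (res (\<delta> n) (approx n x t)) + \<delta> n * (norm (yosida (\<delta> n) (approx n x t)))\<^sup>2
    \<le> a x x - 2 * G (emb x) + 2 * G (approx n x t)"
  using flow_energy[OF \<delta>_pos assms, of n "emb x"] yosida_inner_self[OF \<delta>_pos, of n "approx n x t"]
    yosida_form_le[OF \<delta>_pos, of n x]
  by (simp add: approx_def field_simps)

lemma approx_energy_bound:
  assumes "0 \<le> t"
  shows "a (res (\<delta> n) (approx n x t)) (res (\<delta> n) (approx n x t)) \<le> a x x + 4 * L * (norm (emb x))\<^sup>2"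
    and "\<delta> n * (norm (yosida (\<delta> n) (approx n x t)))\<^sup>2 \<le> a x x + 4 * L * (norm (emb x))\<^sup>2"
proof -
  have "- 2 * G (emb x) + 2 * G (approx n x t) \<le> 4 * L * (norm (emb x))\<^sup>2"
    using abs_G_le[of "emb x"] abs_G_le[of "approx n x t"] by (simp add: norm_approx[OF assms])
  moreover have "0 \<le> \<delta> n * (norm (yosida (\<delta> n) (approx n x t)))\<^sup>2"
    by (simp add: less_imp_le)
  ultimately show "a (res (\<delta> n) (approx n x t)) (res (\<delta> n) (approx n x t)) \<le> a x x + 4 * L * (norm (emb x))\<^sup>2"
    "\<delta> n * (norm (yosida (\<delta> n) (approx n x t)))\<^sup>2 \<le> a x x + 4 * L * (norm (emb x))\<^sup>2"
    using approx_energy_le[OF assms, of n x] form_nonneg[of "res (\<delta> n) (approx n x t)"] by linarith+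
qed

text \<open>Form bounds are available only for the resolvents of the approximations, convergence
  only for the approximations themselves. The defect term of the energy makes their difference of
  order sqrt(\<open>\<delta> n\<close>).\<close>

lemma res_approx_tendsto:
  assumes "0 \<le> t"
  shows "(\<lambda>n. emb (res (\<delta> n) (approx n x t))) \<longlonglongrightarrow> evol x t"
proof -
  define C where "C = a x x + 4 * L * (norm (emb x))\<^sup>2"
  have "(norm (\<delta> n *\<^sub>R yosida (\<delta> n) (approx n x t)))\<^sup>2 \<le> \<delta> n * C" for n
  proof -
    have "(norm (\<delta> n *\<^sub>R yosida (\<delta> n) (approx n x t)))\<^sup>2 = \<delta> n * (\<delta> n * (norm (yosida (\<delta> n) (approx n x t)))\<^sup>2)"
      by (simp add: power_mult_distrib power2_eq_square[of "\<delta> n"])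
    then show ?thesis
      using approx_energy_bound(2)[OF assms, of n x] by (simp add: C_def mult_left_mono less_imp_le)
  qed
  then have bd: "norm (\<delta> n *\<^sub>R yosida (\<delta> n) (approx n x t)) \<le> sqrt (\<delta> n * C)" for n
    using real_le_rsqrt by blast
  have "(\<lambda>n. sqrt (\<delta> n * C)) \<longlonglongrightarrow> sqrt (0 * C)"
    by (intro tendsto_intros \<delta>_tendsto)
  then have "(\<lambda>n. sqrt (\<delta> n * C)) \<longlonglongrightarrow> 0"
    by simp
  from Lim_null_comparison[OF always_eventually[OF allI[OF bd]] this]
  have "(\<lambda>n. \<delta> n *\<^sub>R yosida (\<delta> n) (approx n x t)) \<longlonglongrightarrow> 0" .
  from tendsto_diff[OF approx_tendsto[OF assms] this]
  have "(\<lambda>n. approx n x t - \<delta> n *\<^sub>R yosida (\<delta> n) (approx n x t)) \<longlonglongrightarrow> evol x t"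
    by simp
  moreover have "approx n x t - \<delta> n *\<^sub>R yosida (\<delta> n) (approx n x t) = emb (res (\<delta> n) (approx n x t))" for n
    using yosida_decomp[OF \<delta>_pos, of "approx n x t" n] by (metis add_diff_cancel_right')
  ultimately show ?thesis by simp
qed

lemma ex_emb_evol:
  assumes "0 \<le> t"
  shows "\<exists>y. emb y = evol x t \<and> a y y \<le> a x x - 2 * G (emb x) + 2 * G (evol x t)"
proof (rule form_fatou[OF res_approx_tendsto[OF assms]])
  have "(\<lambda>n. G (approx n x t)) \<longlonglongrightarrow> G (evol x t)"
    by (rule continuous_on_tendsto_compose[OF continuous_G[of UNIV] approx_tendsto[OF assms]]) auto
  then show "(\<lambda>n. a x x - 2 * G (emb x) + 2 * G (approx n x t)) \<longlonglongrightarrow> a x x - 2 * G (emb x) + 2 * G (evol x t)"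
    by (intro tendsto_intros)
  show "a (res (\<delta> n) (approx n x t)) (res (\<delta> n) (approx n x t)) \<le> a x x - 2 * G (emb x) + 2 * G (approx n x t)" for n
    using approx_energy_le[OF assms, of n x] by (smt (verit) \<delta>_pos mult_nonneg_nonneg zero_le_power2)
qed

definition sol :: "'x \<Rightarrow> real \<Rightarrow> 'x" where
  "sol x t = (SOME y. emb y = evol x t)"

lemma emb_sol: "0 \<le> t \<Longrightarrow> emb (sol x t) = evol x t"
  unfolding sol_def by (rule someI_ex) (use ex_emb_evol in blast)

lemma sol_eqI: "0 \<le> t \<Longrightarrow> emb y = evol x t \<Longrightarrow> sol x t = y"
  using emb_sol[of t x] emb_inject by simp

lemma sol_energy_le:
  assumes "0 \<le> t"
  shows "a (sol x t) (sol x t) / 2 - G (emb (sol x t)) \<le> a x x / 2 - G (emb x)"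
  using ex_emb_evol[OF assms, of x] sol_eqI[OF assms] emb_sol[OF assms] by fastforce

section \<open>Time reversal and conservation of energy\<close>

lemma reversed: "schroedinger_form emb a M (\<lambda>u. - I u) (\<lambda>x. - IX x) g G L"
proof (intro schroedinger_form.intro hilbert_form_axioms schroedinger_form_axioms.intro)
  show "bounded_linear (\<lambda>u. - I u)"
    by (intro bounded_linear_minus bounded_linear_I)
  show "- I u \<bullet> - I v = u \<bullet> v" for u v
    by (simp add: I_inner)
  show "- I (- I u) = - u" "g u \<bullet> - I u = 0" for u
    by (simp_all add: I_I I.neg g_inner_I)
  show "emb (- IX x) = - I (emb x)" for x
    by (simp add: emb.neg emb_IX)
  show "a (- IX x) (- IX y) = a x y" for x y
    by (simp add: a.minus_left a.minus_right form_IX)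
qed (fact L_pos g_lipschitz g_0 G_0 G_gradient)+

text \<open>The path \<open>\<lambda>t. flow e w (T - t)\<close> solves the equation with
  \<open>- I\<close> and starts at \<open>flow e w T\<close>, so uniqueness identifies it with the
  reversed flow.\<close>

lemma flow_reversal:
  assumes e: "0 < e" and T: "0 \<le> T"
  shows "schroedinger_form.flow emb a (\<lambda>u. - I u) g e (flow e w T) T = w"
proof -
  interpret rev: schroedinger_form emb a M "\<lambda>u. - I u" "\<lambda>x. - IX x" g G L
    by (rule reversed)
  have "rev.solution e (\<lambda>t. flow e w (T - t)) T"
    unfolding rev.solution_def
  proof
    fix t assume t: "t \<in> {0..T}"
    have 1: "((\<lambda>t. T - t) has_vector_derivative - 1) (at t within {0..T})"
      by (auto intro!: derivative_eq_intros)
    have 2: "(flow e w has_vector_derivative vf e (flow e w (T - t))) (at (T - t) within (\<lambda>t. T - t) ` {0..T})"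
      using t e by (intro has_vector_derivative_within_subset[OF flow_deriv]) auto
    from vector_diff_chain_within[OF 1 2]
    show "((\<lambda>t. flow e w (T - t)) has_vector_derivative rev.vf e (flow e w (T - t))) (at t within {0..T})"
      by (simp add: o_def vf_def rev.vf_def)
  qed
  from rev.solution_unique[OF e T rev.solution_flow[OF e] this, of "flow e w T"] show ?thesis
    by (simp add: rev.flow_0[OF e] flow_0[OF e])
qed

text \<open>The reversed approximation started at \<open>sol x T\<close> is compared with the one
  started at \<open>approx n x T\<close>, which returns exactly to \<open>emb x\<close>. The two
  starting points approach each other in \<open>'h\<close>, so the reversed solution ends at
  \<open>x\<close>, and its energy inequality is the missing one.\<close>

lemma sol_energy:
  assumes T: "0 \<le> T"
  shows "a (sol x T) (sol x T) / 2 - G (emb (sol x T)) = a x x / 2 - G (emb x)"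
proof (rule antisym)
  interpret rev: schroedinger_form emb a M "\<lambda>u. - I u" "\<lambda>x. - IX x" g G L
    by (rule reversed)
  define y where "y = sol x T"
  have "(\<lambda>n. exp (L * T) * norm (emb y - approx n x T)) \<longlonglongrightarrow> exp (L * T) * norm (emb y - evol x T)"
    by (intro tendsto_intros approx_tendsto T)
  then have lim: "(\<lambda>n. exp (L * T) * norm (emb y - approx n x T)) \<longlonglongrightarrow> 0"
    by (simp add: y_def emb_sol[OF T])
  have bd: "norm (rev.approx n y T - emb x) \<le> exp (L * T) * norm (emb y - approx n x T)" for n
    using rev.flow_dist_le[of "\<delta> n" T T "emb y" "approx n x T"] T flow_reversal[OF \<delta>_pos T, of n "emb x"]
    by (simp add: rev.approx_def approx_def)
  from Lim_null_comparison[OF always_eventually[OF allI[OF bd]] lim]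
  have "(\<lambda>n. rev.approx n y T) \<longlonglongrightarrow> emb x"
    by (simp add: LIM_zero_iff)
  then have "rev.evol y T = emb x"
    using rev.approx_tendsto[OF T, of y] LIMSEQ_unique by blast
  then have "rev.sol y T = x"
    by (intro rev.sol_eqI[OF T]) simp
  then show "a x x / 2 - G (emb x) \<le> a (sol x T) (sol x T) / 2 - G (emb (sol x T))"
    using rev.sol_energy_le[OF T, of y] by (simp add: y_def)
qed (rule sol_energy_le[OF T])

text \<open>Valid for all times, but in the application \<open>L\<close> depends on the truncation
  level, so this bound cannot be used to choose that level. It only feeds the increment
  estimate.\<close>

lemma sol_form_bound:
  assumes "0 \<le> t"
  shows "a (sol x t) (sol x t) \<le> a x x + 4 * L * (norm (emb x))\<^sup>2"
  using sol_energy[OF assms, of x] abs_G_le[of "emb x"] abs_G_le[of "emb (sol x t)"]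
  by (simp add: emb_sol[OF assms] norm_evol[OF assms] field_simps)

lemma continuous_on_sol: "continuous_on {0..} (sol x)"
  unfolding continuous_on_sequentially
proof (intro ballI allI impI)
  fix X :: "nat \<Rightarrow> real" and t assume t: "t \<in> {0..}" and X: "(\<forall>n. X n \<in> {0..}) \<and> X \<longlonglongrightarrow> t"
  have lim: "(\<lambda>n. evol x (X n)) \<longlonglongrightarrow> evol x t"
    by (rule continuous_on_tendsto_compose[OF continuous_on_evol]) (use X t in auto)
  have "(\<lambda>n. G (evol x (X n))) \<longlonglongrightarrow> G (evol x t)"
    by (rule continuous_on_tendsto_compose[OF continuous_G[of UNIV] lim]) auto
  then have "(\<lambda>n. a x x - 2 * G (emb x) + 2 * G (evol x (X n))) \<longlonglongrightarrow> a x x - 2 * G (emb x) + 2 * G (evol x t)"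
    by (intro tendsto_intros)
  moreover have "a (sol x s) (sol x s) = a x x - 2 * G (emb x) + 2 * G (evol x s)" if "0 \<le> s" for s
    using sol_energy[OF that, of x] by (simp add: emb_sol[OF that] field_simps)
  ultimately have "(\<lambda>n. a (sol x (X n)) (sol x (X n))) \<longlonglongrightarrow> a (sol x t) (sol x t)"
    using X t by simp
  then show "(sol x \<circ> X) \<longlonglongrightarrow> sol x t"
    unfolding o_def using lim X t by (intro form_strong_tendsto) (simp_all add: emb_sol)
qed

section \<open>Weak form of the equation and short-time bounds\<close>

lemma approx_weak:
  assumes "0 \<le> t"
  shows "((\<lambda>s. vf (\<delta> n) (approx n x s) \<bullet> emb y) has_integral (approx n x t \<bullet> emb y - emb x \<bullet> emb y)) {0..t}"
proof -
  have "((\<lambda>s. vf (\<delta> n) (approx n x s) \<bullet> emb y) has_integral (approx n x t \<bullet> emb y - approx n x 0 \<bullet> emb y)) {0..t}"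
  proof (rule fundamental_theorem_of_calculus[OF assms])
    fix s assume "s \<in> {0..t}"
    then have "(approx n x has_vector_derivative vf (\<delta> n) (approx n x s)) (at s within {0..t})"
      using solution_flow[OF \<delta>_pos, of n "emb x" t] by (simp add: solution_def approx_def)
    from bounded_linear.has_vector_derivative[OF bounded_linear_inner_left this]
    show "((\<lambda>s. approx n x s \<bullet> emb y) has_vector_derivative vf (\<delta> n) (approx n x s) \<bullet> emb y) (at s within {0..t})" .
  qed
  then show ?thesis by (simp add: approx_0)
qed

text \<open>Moving \<open>I\<close> onto the test element turns the Yosida term into the form of the
  resolvent against \<open>IX y\<close>, for which weak convergence at each time is enough; the
  energy bound supplies the dominating constant.\<close>

lemma sol_weak:
  assumes t: "0 \<le> t"
  shows "emb (sol x t) \<bullet> emb y = emb x \<bullet> emb y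
    + integral {0..t} (\<lambda>s. a (sol x s) (IX y) + I (g (emb (sol x s))) \<bullet> emb y)"
proof -
  define C where "C = a x x + 4 * L * (norm (emb x))\<^sup>2"
  define f where "f = (\<lambda>n s. vf (\<delta> n) (approx n x s) \<bullet> emb y)"
  have f_eq: "f n s = I (g (approx n x s)) \<bullet> emb y + a (res (\<delta> n) (approx n x s)) (IX y)" for n s
    using yosida_inner_emb[OF \<delta>_pos, of n "approx n x s" "IX y"]
    by (simp add: f_def vf_def I.diff inner_diff_left I_skew[of "yosida _ _"] emb_IX)
  have I_f: "(f n has_integral (approx n x t \<bullet> emb y - emb x \<bullet> emb y)) {0..t}" for n
    unfolding f_def by (rule approx_weak[OF t])
  have bd: "norm (f n s) \<le> L * norm (emb x) * norm (emb y) + (C + a y y) / 2" if "s \<in> {0..t}" for n s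
  proof -
    define r where "r = res (\<delta> n) (approx n x s)"
    have "\<bar>I (g (approx n x s)) \<bullet> emb y\<bar> \<le> norm (g (approx n x s)) * norm (emb y)"
      using Cauchy_Schwarz_ineq2[of "I (g (approx n x s))" "emb y"] by simp
    also have "\<dots> \<le> L * norm (emb x) * norm (emb y)"
      using norm_g_le[of "approx n x s"] that by (intro mult_right_mono) (auto simp: norm_approx)
    finally have 1: "\<bar>I (g (approx n x s)) \<bullet> emb y\<bar> \<le> L * norm (emb x) * norm (emb y)" .
    have "a r (IX y) \<le> (a r r + a y y) / 2" "- a r (IX y) \<le> (a r r + a y y) / 2"
      using form_le_avg[of r "IX y"] form_le_avg[of "- r" "IX y"]
      by (simp_all add: form_IX a.minus_left a.minus_right)
    moreover have "a r r \<le> C"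
      unfolding r_def C_def using that by (intro approx_energy_bound) auto
    ultimately have 2: "\<bar>a r (IX y)\<bar> \<le> (C + a y y) / 2"
      by (simp add: abs_le_iff field_simps)
    show ?thesis
      unfolding f_eq r_def[symmetric] real_norm_def using 1 2 by linarith
  qed
  have conv: "(\<lambda>n. f n s) \<longlonglongrightarrow> a (sol x s) (IX y) + I (g (emb (sol x s))) \<bullet> emb y" if "s \<in> {0..t}" for s
  proof -
    have s: "0 \<le> s" using that by simp
    have "(\<lambda>n. g (approx n x s)) \<longlonglongrightarrow> g (evol x s)"
      by (rule continuous_on_tendsto_compose[OF continuous_g[of UNIV] approx_tendsto[OF s]]) auto
    then have 1: "(\<lambda>n. I (g (approx n x s)) \<bullet> emb y) \<longlonglongrightarrow> I (g (emb (sol x s))) \<bullet> emb y"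
      unfolding emb_sol[OF s] by (intro tendsto_intros I.tendsto)
    have "(\<lambda>n. a (res (\<delta> n) (approx n x s)) (IX y)) \<longlonglongrightarrow> a (sol x s) (IX y)"
    proof (rule form_weak_tendsto)
      show "(\<lambda>n. emb (res (\<delta> n) (approx n x s))) \<longlonglongrightarrow> emb (sol x s)"
        unfolding emb_sol[OF s] by (rule res_approx_tendsto[OF s])
      show "a (res (\<delta> n) (approx n x s)) (res (\<delta> n) (approx n x s)) \<le> C" for n
        unfolding C_def by (rule approx_energy_bound[OF s])
    qed
    from tendsto_add[OF 1 this] show ?thesis
      by (simp add: f_eq add.commute)
  qed
  have "(\<lambda>n. integral {0..t} (f n)) \<longlonglongrightarrow> integral {0..t} (\<lambda>s. a (sol x s) (IX y) + I (g (emb (sol x s))) \<bullet> emb y)"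
    by (rule dominated_convergence[where h = "\<lambda>s. L * norm (emb x) * norm (emb y) + (C + a y y) / 2"])
      (use I_f bd conv in \<open>auto intro: has_integral_integrable\<close>)
  moreover have "(\<lambda>n. integral {0..t} (f n)) \<longlonglongrightarrow> evol x t \<bullet> emb y - emb x \<bullet> emb y"
    unfolding integral_unique[OF I_f] by (intro tendsto_intros approx_tendsto[OF t])
  ultimately show ?thesis
    using LIMSEQ_unique[of "\<lambda>n. integral {0..t} (f n)"] by (fastforce simp: emb_sol[OF t])
qed

lemma sol_0: "sol x 0 = x"
  by (rule sol_eqI) (simp_all add: evol_0)

text \<open>Test the weak equation with the increment \<open>y\<close> itself: its squared norm
  becomes an integral over \<open>{0..t}\<close> of a bounded integrand.\<close>

lemma sol_increment_le:
  assumes t: "0 \<le> t" and r: "0 \<le> r" "a x x + (norm (emb x))\<^sup>2 \<le> r\<^sup>2"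
  shows "(norm (emb (sol x t) - emb x))\<^sup>2 \<le> (5 / 2 * (r\<^sup>2 + 4 * L * r\<^sup>2) + 2 * L * r\<^sup>2) * t"
proof -
  define A where "A = r\<^sup>2 + 4 * L * r\<^sup>2"
  define y where "y = sol x t - x"
  define f where "f s = a (sol x s) (IX y) + I (g (emb (sol x s))) \<bullet> emb y" for s
  have xr: "(norm (emb x))\<^sup>2 \<le> r\<^sup>2" "a x x \<le> r\<^sup>2"
    using r(2) form_nonneg[of x] zero_le_power2[of "norm (emb x)"] by linarith+
  have emb_x: "norm (emb x) \<le> r"
    using xr(1) r(1) by (rule power2_le_imp_le)
  have A: "a (sol x s) (sol x s) \<le> A" if "0 \<le> s" for s
    using sol_form_bound[OF that, of x] xr L_pos mult_left_mono[OF xr(1), of "4 * L"]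
    unfolding A_def by linarith
  have ay: "a y y \<le> 4 * A"
  proof -
    have "a x x \<le> A"
      using A[of 0] by (simp add: sol_0)
    moreover have "a y y \<le> 2 * a (sol x t) (sol x t) + 2 * a x x"
      using form_nonneg[of "sol x t + x"]
      by (simp add: y_def a.diff_left a.diff_right a.add_left a.add_right)
    ultimately show ?thesis using A[OF t] by linarith
  qed
  have emb_y: "norm (emb y) \<le> 2 * r"
    using norm_triangle_ineq4[of "emb (sol x t)" "emb x"] emb_x
    by (simp add: y_def emb.diff emb_sol[OF t] norm_evol[OF t])
  \<comment> \<open>\<open>(A + 4 * A) / 2\<close> comes from the form term and
    \<open>(L * r) * (2 * r)\<close> from the nonlinear one.\<close>
  have f_le: "norm (f s) \<le> 5 / 2 * A + 2 * L * r\<^sup>2" if "s \<in> {0..t}" for s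
  proof -
    have s: "0 \<le> s" using that by simp
    have "a (sol x s) (IX y) \<le> (a (sol x s) (sol x s) + a y y) / 2"
      "- a (sol x s) (IX y) \<le> (a (sol x s) (sol x s) + a y y) / 2"
      using form_le_avg[of "sol x s" "IX y"] form_le_avg[of "- sol x s" "IX y"]
      by (simp_all add: form_IX a.minus_left a.minus_right)
    then have 1: "\<bar>a (sol x s) (IX y)\<bar> \<le> 5 / 2 * A"
      using A[OF s] ay by (simp add: abs_le_iff field_simps)
    have "\<bar>I (g (emb (sol x s))) \<bullet> emb y\<bar> \<le> norm (g (emb (sol x s))) * norm (emb y)"
      using Cauchy_Schwarz_ineq2[of "I (g (emb (sol x s)))" "emb y"] by simp
    also have "\<dots> \<le> (L * r) * (2 * r)"
    proof (rule mult_mono)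
      show "norm (g (emb (sol x s))) \<le> L * r"
        using norm_g_le[of "emb (sol x s)"] order_trans[OF _ mult_left_mono[OF emb_x less_imp_le[OF L_pos]]]
        by (simp add: emb_sol[OF s] norm_evol[OF s])
    qed (use emb_y r L_pos in auto)
    finally have "\<bar>I (g (emb (sol x s))) \<bullet> emb y\<bar> \<le> 2 * L * r\<^sup>2"
      by (simp add: power2_eq_square mult_ac)
    with 1 show ?thesis
      unfolding f_def real_norm_def by linarith
  qed
  have "continuous_on {0..t} f"
    unfolding f_def
    by (intro continuous_intros a.continuous_on I.continuous_on emb.continuous_on
        continuous_on_compose2[OF continuous_g[of UNIV]] continuous_on_subset[OF continuous_on_sol]) auto
  then have "f integrable_on {0..t}"
    by (rule integrable_continuous_real)
  then have "norm (integral {0..t} f) \<le> integral {0..t} (\<lambda>s. 5 / 2 * A + 2 * L * r\<^sup>2)"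
    by (intro Henstock_Kurzweil_Integration.integral_norm_bound_integral f_le) auto
  moreover have "integral {0..t} f = (norm (emb y))\<^sup>2"
    using sol_weak[OF t, of x y]
    by (simp add: f_def[abs_def] y_def emb.diff power2_norm_eq_inner inner_diff_left)
  ultimately show ?thesis
    using t by (simp add: A_def y_def emb.diff mult.commute)
qed

text \<open>By energy conservation the growth of the form is an increment of \<open>G\<close>, which is small as soon as
  \<open>sol x t\<close> is close to \<open>x\<close> in the ambient norm only.\<close>

lemma sol_short_time:
  assumes t: "0 \<le> t" and r: "0 \<le> r" "a x x + (norm (emb x))\<^sup>2 \<le> r\<^sup>2"
    and small: "(6 * L * r)\<^sup>2 * ((5 / 2 * (r\<^sup>2 + 4 * L * r\<^sup>2) + 2 * L * r\<^sup>2) * t) \<le> 1"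
  shows "a (sol x t) (sol x t) + (norm (emb (sol x t)))\<^sup>2 \<le> r\<^sup>2 + 1"
proof -
  define d where "d = norm (emb (sol x t) - emb x)"
  have "(norm (emb x))\<^sup>2 \<le> r\<^sup>2"
    using r(2) form_nonneg[of x] by linarith
  then have emb_x: "norm (emb x) \<le> r"
    using r(1) by (rule power2_le_imp_le)
  have "(6 * L * r)\<^sup>2 * d\<^sup>2 \<le> 1"
    using mult_left_mono[OF sol_increment_le[OF t r], of "(6 * L * r)\<^sup>2"] small
    unfolding d_def by (meson order_trans zero_le_power2)
  then have "(6 * L * r * d)\<^sup>2 \<le> 1\<^sup>2"
    by (simp add: power_mult_distrib)
  then have 1: "6 * L * r * d \<le> 1"
    by (rule power2_le_imp_le) simp
  have d: "d \<le> 2 * r" "0 \<le> d"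
    using norm_triangle_ineq4[of "emb (sol x t)" "emb x"] emb_x
    by (simp_all add: d_def emb_sol[OF t] norm_evol[OF t])
  have "\<bar>g (emb x) \<bullet> (emb (sol x t) - emb x)\<bar> \<le> norm (g (emb x)) * d"
    unfolding d_def by (rule Cauchy_Schwarz_ineq2)
  also have "\<dots> \<le> (L * r) * d"
    using order_trans[OF norm_g_le[of "emb x"] mult_left_mono[OF emb_x less_imp_le[OF L_pos]]] d(2)
    by (rule mult_right_mono)
  finally have "G (emb (sol x t)) - G (emb x) \<le> (L * r) * d + L * d\<^sup>2"
    using G_gradient[of "emb (sol x t)" "emb x"] unfolding d_def by linarith
  \<comment> \<open>By mass conservation \<open>d \<le> 2 * r\<close>, so twice the increment of
    \<open>G\<close> is at most \<open>2 * (L * r * d + 2 * L * r * d)\<close>; this is the factor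
    \<open>6\<close> in \<open>small\<close>.\<close>
  moreover have "L * d\<^sup>2 \<le> L * ((2 * r) * d)"
    using L_pos d by (intro mult_left_mono) (auto simp: power2_eq_square intro!: mult_right_mono)
  ultimately have "2 * (G (emb (sol x t)) - G (emb x)) \<le> 1"
    using 1 by (simp add: algebra_simps)
  then show ?thesis
    using sol_energy[OF t, of x] r(2) by (simp add: emb_sol[OF t] norm_evol[OF t])
qed

end

section \<open>Completeness of \<open>L\<^sup>2\<close>\<close>

lemma square_integrable_rep_L2: "square_integrable (rep_L2 X)"
  using Quotient_rep_reflp[OF Quotient_L2, of X] by (simp add: L2_rel_def)

lemma abs_rep_L2 [simp]: "abs_L2 (rep_L2 X) = X"
  by (rule Quotient_abs_rep[OF Quotient_L2])

lemma AE_rep_abs_L2: "square_integrable f \<Longrightarrow> AE z in lborel. rep_L2 (abs_L2 f) z = f z"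
  using Quotient_rep_abs[OF Quotient_L2, of f] by (simp add: L2_rel_def)

lemma abs_L2_eqI:
  "square_integrable f \<Longrightarrow> square_integrable g \<Longrightarrow> AE z in lborel. f z = g z \<Longrightarrow> abs_L2 f = abs_L2 g"
  using Quotient_rel_abs[OF Quotient_L2, of f g] by (simp add: L2_rel_def)

lemma borel_measurable_rep_L2 [measurable]: "rep_L2 X \<in> borel_measurable borel"
  using square_integrable_rep_L2[of X] by (simp add: square_integrable_def)

lemma square_integrable_diff:
  assumes "square_integrable f" "square_integrable g"
  shows "square_integrable (\<lambda>z. f z - g z)"
  using square_integrable_add[OF assms(1) square_integrable_cmult[OF assms(2), of "-1"]] by simp

lemma abs_L2_diff:
  assumes "square_integrable f" "square_integrable g"
  shows "abs_L2 (\<lambda>z. f z - g z) = abs_L2 f - abs_L2 g"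
proof -
  have "abs_L2 (\<lambda>z. f z - g z) + abs_L2 g = abs_L2 (\<lambda>z. f z - g z + g z)"
    using assms square_integrable_diff[OF assms] by (simp add: plus_L2.abs_eq L2_rel_def)
  then show ?thesis by (simp add: algebra_simps)
qed

lemma AE_rep_L2_diff: "AE z in lborel. rep_L2 (X - Y) z = rep_L2 X z - rep_L2 Y z"
proof -
  have "X - Y = abs_L2 (\<lambda>z. rep_L2 X z - rep_L2 Y z)"
    using abs_L2_diff[of "rep_L2 X" "rep_L2 Y"] square_integrable_rep_L2 by simp
  then show ?thesis
    using AE_rep_abs_L2 square_integrable_diff[OF square_integrable_rep_L2 square_integrable_rep_L2] by simp
qed

lemma AE_rep_L2_cscale: "AE z in lborel. rep_L2 (cscale_L2 c X) z = c * rep_L2 X z"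
proof -
  have "cscale_L2 c X = abs_L2 (\<lambda>z. c * rep_L2 X z)"
    using cscale_L2.abs_eq[of "rep_L2 X" c] square_integrable_rep_L2 by (simp add: L2_rel_def)
  then show ?thesis
    using AE_rep_abs_L2 square_integrable_cmult[OF square_integrable_rep_L2] by simp
qed

lemma inner_abs_L2:
  "square_integrable f \<Longrightarrow> square_integrable g \<Longrightarrow> abs_L2 f \<bullet> abs_L2 g = (LINT z|lborel. f z \<bullet> g z)"
  by (simp add: inner_L2.abs_eq L2_rel_def)

lemma inner_L2_rep: "X \<bullet> Y = (LINT z|lborel. rep_L2 X z \<bullet> rep_L2 Y z)"
  using inner_abs_L2[OF square_integrable_rep_L2 square_integrable_rep_L2, of X Y] by simp

lemma norm_abs_L2: "square_integrable f \<Longrightarrow> (norm (abs_L2 f))\<^sup>2 = (LINT z|lborel. (cmod (f z))\<^sup>2)"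
  by (simp add: norm_L2.abs_eq L2_rel_def)

lemma norm_L2_rep: "(norm X)\<^sup>2 = (LINT z|lborel. (cmod (rep_L2 X z))\<^sup>2)"
  using norm_abs_L2[OF square_integrable_rep_L2, of X] by simp

lemma L2_pair_rep: "L2_pair X Y = (LINT z|lborel. rep_L2 X z * rep_L2 Y z)"
  using L2_pair.abs_eq[of "rep_L2 X" "rep_L2 Y"] square_integrable_rep_L2 by (simp add: L2_rel_def)

lemma L2_pair_abs:
  "square_integrable f \<Longrightarrow> square_integrable g \<Longrightarrow> L2_pair (abs_L2 f) (abs_L2 g) = (LINT z|lborel. f z * g z)"
  by (simp add: L2_pair.abs_eq L2_rel_def)

lemma nn_integral_norm_abs_L2:
  assumes "square_integrable f"
  shows "(\<integral>\<^sup>+z. ennreal ((cmod (f z))\<^sup>2) \<partial>lborel) = ennreal ((norm (abs_L2 f))\<^sup>2)"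
  unfolding norm_abs_L2[OF assms]
  by (rule nn_integral_eq_integral) (use assms in \<open>auto simp: square_integrable_def\<close>)

lemma norm_L2_le_nn_integral:
  assumes [measurable]: "f \<in> borel_measurable lborel"
    and le: "(\<integral>\<^sup>+z. ennreal ((cmod (f z))\<^sup>2) \<partial>lborel) \<le> ennreal (c\<^sup>2)" and c: "0 \<le> c"
  shows "square_integrable f" "norm (abs_L2 f) \<le> c"
proof -
  have "integrable lborel (\<lambda>z. (cmod (f z))\<^sup>2)"
    using le by (intro integrableI_bounded) (auto simp: less_top[symmetric] top_unique)
  then show *: "square_integrable f"
    by (simp add: square_integrable_def)
  have "ennreal ((norm (abs_L2 f))\<^sup>2) \<le> ennreal (c\<^sup>2)"
    using le nn_integral_norm_abs_L2[OF *] by simp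
  then have "(norm (abs_L2 f))\<^sup>2 \<le> c\<^sup>2" by simp
  then show "norm (abs_L2 f) \<le> c"
    using c by (rule power2_le_imp_le)
qed

text \<open>Riesz--Fischer: along a subsequence with \<open>\<parallel>d n\<parallel> \<le> 2\<^sup>-\<^sup>n\<close> the series \<open>\<Sum>n. 2\<^sup>n |d n|\<^sup>2\<close> has finite
  integral, so \<open>d n\<close> decays geometrically almost everywhere.\<close>

lemma summable_norm_of_weighted_square:
  fixes d :: "nat \<Rightarrow> complex"
  assumes "(\<Sum>n. ennreal (2^n * (cmod (d n))\<^sup>2)) \<noteq> \<infinity>"
  shows "summable (\<lambda>n. cmod (d n))"
proof -
  have "summable (\<lambda>n. 2^n * (cmod (d n))\<^sup>2)"
    by (rule summable_suminf_not_top) (use assms in auto)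
  then have "Bseq (\<lambda>n. 2^n * (cmod (d n))\<^sup>2)"
    using summable_LIMSEQ_zero convergentI convergent_imp_Bseq by blast
  then obtain C where C: "0 < C" "\<And>n. 2^n * (cmod (d n))\<^sup>2 \<le> C"
    by (auto elim!: BseqE simp: norm_mult norm_power)
  have "cmod (d n) \<le> sqrt C * (1 / sqrt 2)^n" for n
  proof -
    have "((1 / sqrt 2)^n)\<^sup>2 = ((1 / sqrt 2)\<^sup>2)^n"
      by (simp only: power_mult[symmetric] mult.commute)
    also have "\<dots> = (1 / 2)^n"
      by (simp add: power_divide)
    finally have "(sqrt C * (1 / sqrt 2)^n)\<^sup>2 = C / 2^n"
      using C(1) by (simp add: power_mult_distrib power_divide)
    moreover have "(cmod (d n))\<^sup>2 \<le> C / 2^n"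
      using C(2)[of n] by (simp add: pos_le_divide_eq mult.commute)
    ultimately have "(cmod (d n))\<^sup>2 \<le> (sqrt C * (1 / sqrt 2)^n)\<^sup>2"
      by simp
    then show ?thesis
      by (rule power2_le_imp_le) (use C(1) in simp)
  qed
  moreover have "summable (\<lambda>n. sqrt C * (1 / sqrt 2)^n)"
    by (intro summable_mult summable_geometric) (simp add: field_simps)
  ultimately show ?thesis
    using summable_comparison_test'[of "\<lambda>n. sqrt C * (1 / sqrt 2)^n" 0 "\<lambda>n. cmod (d n)"] by simp
qed

text \<open>The weighted series gives a pointwise limit almost everywhere. Fatou's lemma, applied to
  the squared distances from a fixed \<open>f n\<close>, shows both that the limit is square
  integrable and that it is the limit in norm.\<close>

lemma L2_fast_Cauchy_convergent:
  fixes X :: "nat \<Rightarrow> L2"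
  assumes fast: "\<And>n. norm (X (Suc n) - X n) \<le> (1/2)^n" and "Cauchy X"
  shows "convergent X"
proof -
  define f where "f n = rep_L2 (X n)" for n
  have f: "square_integrable (f n)" for n
    by (simp add: f_def square_integrable_rep_L2)
  have [measurable]: "f n \<in> borel_measurable borel" for n
    by (simp add: f_def)
  have X: "X n = abs_L2 (f n)" for n
    by (simp add: f_def)
  define d where "d n z = f (Suc n) z - f n z" for n z
  have nd: "(\<integral>\<^sup>+z. ennreal ((cmod (f m z - f n z))\<^sup>2) \<partial>lborel) = ennreal ((norm (X m - X n))\<^sup>2)" for m n
    using nn_integral_norm_abs_L2[OF square_integrable_diff[OF f f], of m n]
    by (simp add: X abs_L2_diff[OF f f])
  have "(\<integral>\<^sup>+z. (\<Sum>n. ennreal (2^n * (cmod (d n z))\<^sup>2)) \<partial>lborel) = (\<Sum>n. \<integral>\<^sup>+z. ennreal (2^n * (cmod (d n z))\<^sup>2) \<partial>lborel)"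
    unfolding d_def by (rule nn_integral_suminf) measurable
  also have "\<dots> \<le> (\<Sum>n. ennreal ((1/2)^n))"
  proof (rule suminf_le)
    fix n
    have "(\<integral>\<^sup>+z. ennreal (2^n * (cmod (d n z))\<^sup>2) \<partial>lborel) = ennreal (2^n) * (\<integral>\<^sup>+z. ennreal ((cmod (d n z))\<^sup>2) \<partial>lborel)"
      unfolding d_def by (subst nn_integral_cmult[symmetric]) (auto simp: ennreal_mult)
    also have "\<dots> = ennreal (2^n * (norm (X (Suc n) - X n))\<^sup>2)"
      unfolding d_def nd by (simp add: ennreal_mult)
    \<comment> \<open>The weight \<open>2^n\<close> uses up only one of the two factors
      \<open>(1/2)^n\<close>, so the series still converges.\<close>
    also have "\<dots> \<le> ennreal (2^n * ((1/2)^n)\<^sup>2)"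
      using fast[of n] by (intro ennreal_leI mult_left_mono power_mono) auto
    also have "2^n * ((1/2::real)^n)\<^sup>2 = (1/2)^n"
      by (simp add: power2_eq_square power_divide)
    finally show "(\<integral>\<^sup>+z. ennreal (2^n * (cmod (d n z))\<^sup>2) \<partial>lborel) \<le> ennreal ((1/2)^n)" .
  qed auto
  also have "\<dots> = ennreal (\<Sum>n. (1/2)^n)"
    by (rule suminf_ennreal2) (auto intro: summable_geometric)
  also have "\<dots> < \<infinity>" by simp
  finally have "(\<integral>\<^sup>+z. (\<Sum>n. ennreal (2^n * (cmod (d n z))\<^sup>2)) \<partial>lborel) \<noteq> \<infinity>"
    by simp
  then have "AE z in lborel. (\<Sum>n. ennreal (2^n * (cmod (d n z))\<^sup>2)) \<noteq> \<infinity>"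
    unfolding d_def by (intro nn_integral_noteq_infinite) (auto simp: d_def)
  then have conv: "AE z in lborel. (\<lambda>n. f n z) \<longlonglongrightarrow> lim (\<lambda>n. f n z)"
  proof (rule AE_mp, intro AE_I2 impI)
    fix z assume "(\<Sum>n. ennreal (2^n * (cmod (d n z))\<^sup>2)) \<noteq> \<infinity>"
    then have "summable (\<lambda>n. cmod (d n z))"
      by (rule summable_norm_of_weighted_square)
    then have "convergent (\<lambda>n. \<Sum>i<n. d i z)"
      unfolding summable_iff_convergent[symmetric] by (rule summable_norm_cancel)
    then have "convergent (\<lambda>n. f 0 z + (\<Sum>i<n. d i z))"
      by (rule convergent_add[OF convergent_const])
    moreover have "f 0 z + (\<Sum>i<n. d i z) = f n z" for n
      unfolding d_def by (subst sum_lessThan_telescope) simp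
    ultimately have "convergent (\<lambda>n. f n z)"
      by simp
    then show "(\<lambda>n. f n z) \<longlonglongrightarrow> lim (\<lambda>n. f n z)"
      by (rule convergent_LIMSEQ_iff[THEN iffD1])
  qed
  define F where "F z = lim (\<lambda>n. f n z)" for z
  have [measurable]: "F \<in> borel_measurable borel"
    unfolding F_def[abs_def] by (intro borel_measurable_lim_metric) measurable
  have key: "square_integrable (\<lambda>z. F z - f n z)" "norm (abs_L2 (\<lambda>z. F z - f n z)) \<le> e"
    if e: "0 < e" and n: "\<And>m. m \<ge> n \<Longrightarrow> norm (X m - X n) \<le> e" for n e
  proof -
    have "(\<integral>\<^sup>+z. ennreal ((cmod (F z - f n z))\<^sup>2) \<partial>lborel) \<le> (\<integral>\<^sup>+z. liminf (\<lambda>m. ennreal ((cmod (f m z - f n z))\<^sup>2)) \<partial>lborel)"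
    proof (rule nn_integral_mono_AE)
      show "AE z in lborel. ennreal ((cmod (F z - f n z))\<^sup>2) \<le> liminf (\<lambda>m. ennreal ((cmod (f m z - f n z))\<^sup>2))"
        using conv
      proof (rule AE_mp, intro AE_I2 impI)
        fix z assume "(\<lambda>n. f n z) \<longlonglongrightarrow> lim (\<lambda>n. f n z)"
        then have "(\<lambda>m. ennreal ((cmod (f m z - f n z))\<^sup>2)) \<longlonglongrightarrow> ennreal ((cmod (F z - f n z))\<^sup>2)"
          unfolding F_def by (intro tendsto_ennrealI tendsto_power tendsto_norm tendsto_diff tendsto_const)
        then have "liminf (\<lambda>m. ennreal ((cmod (f m z - f n z))\<^sup>2)) = ennreal ((cmod (F z - f n z))\<^sup>2)"
          by (rule lim_imp_Liminf[OF sequentially_bot])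
        then show "ennreal ((cmod (F z - f n z))\<^sup>2) \<le> liminf (\<lambda>m. ennreal ((cmod (f m z - f n z))\<^sup>2))"
          by (simp only: order.refl)
      qed
    qed
    also have "\<dots> \<le> liminf (\<lambda>m. \<integral>\<^sup>+z. ennreal ((cmod (f m z - f n z))\<^sup>2) \<partial>lborel)"
      by (rule nn_integral_liminf) measurable
    also have "\<dots> = liminf (\<lambda>m. ennreal ((norm (X m - X n))\<^sup>2))"
      by (simp add: nd)
    also have "\<dots> \<le> limsup (\<lambda>m. ennreal ((norm (X m - X n))\<^sup>2))"
      by (rule Liminf_le_Limsup) simp
    also have "\<dots> \<le> ennreal (e\<^sup>2)"
      by (rule Limsup_bounded, rule eventually_sequentiallyI[of n])
        (use n in \<open>auto intro!: ennreal_leI power_mono\<close>)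
    finally show "square_integrable (\<lambda>z. F z - f n z)" "norm (abs_L2 (\<lambda>z. F z - f n z)) \<le> e"
      using norm_L2_le_nn_integral[of "\<lambda>z. F z - f n z" e] e by auto
  qed
  have "\<exists>N. \<forall>m\<ge>N. \<forall>n\<ge>N. norm (X m - X n) < 1"
    using \<open>Cauchy X\<close> by (rule CauchyD) simp
  then obtain N where "\<And>m n. m \<ge> N \<Longrightarrow> n \<ge> N \<Longrightarrow> norm (X m - X n) < 1" by blast
  then have "square_integrable (\<lambda>z. F z - f N z)"
    by (intro key(1)[of 1]) (auto intro: less_imp_le)
  from square_integrable_add[OF this f[of N]] have F: "square_integrable F"
    by simp
  have "X \<longlonglongrightarrow> abs_L2 F"
  proof (rule LIMSEQ_I)
    fix e :: real assume e: "0 < e"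
    then obtain N where N: "\<And>m n. m \<ge> N \<Longrightarrow> n \<ge> N \<Longrightarrow> norm (X m - X n) < e / 2"
      using CauchyD[OF \<open>Cauchy X\<close>, of "e / 2"] by auto
    have "norm (X n - abs_L2 F) < e" if "n \<ge> N" for n
      using key(2)[of "e / 2" n] N that e abs_L2_diff[OF F f, of n]
      by (simp add: X norm_minus_commute less_imp_le)
    then show "\<exists>N. \<forall>n\<ge>N. norm (X n - abs_L2 F) < e" by blast
  qed
  then show ?thesis by (rule convergentI)
qed

instance L2 :: banach
proof
  fix X :: "nat \<Rightarrow> L2" assume X: "Cauchy X"
  have "\<exists>N. \<forall>m\<ge>N. \<forall>n\<ge>N. norm (X m - X n) < (1/2)^k" for k
    by (rule CauchyD[OF X]) simp
  then obtain N where N: "\<And>k m n. m \<ge> N k \<Longrightarrow> n \<ge> N k \<Longrightarrow> norm (X m - X n) < (1/2)^k"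
    by metis
  \<comment> \<open>Each index passes its predecessor, for strict monotonicity, and the threshold of
    the next accuracy.\<close>
  define r where "r = rec_nat (N 0) (\<lambda>k m. max (Suc m) (N (Suc k)))"
  have r: "r (Suc k) = max (Suc (r k)) (N (Suc k))" "r k \<ge> N k" for k
    by (cases k; simp add: r_def)+
  have sm: "strict_mono r"
    by (rule strict_monoI_Suc) (simp add: r)
  have "convergent (X \<circ> r)"
  proof (rule L2_fast_Cauchy_convergent)
    show "norm ((X \<circ> r) (Suc n) - (X \<circ> r) n) \<le> (1/2)^n" for n
      using N[of n "r (Suc n)" "r n"] r(2)[of n] r(1)[of n] by (auto intro!: less_imp_le)
    show "Cauchy (X \<circ> r)"
      by (rule Cauchy_subseq_Cauchy[OF X sm])
  qed
  then obtain l where "(X \<circ> r) \<longlonglongrightarrow> l"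
    by (auto simp: convergent_def)
  then have "X \<longlonglongrightarrow> l"
    using Cauchy_converges_subseq[OF X sm] by (simp add: o_def)
  then show "convergent X" by (rule convergentI)
qed

section \<open>Complex conjugation on \<open>L\<^sup>2\<close>\<close>

text \<open>The dual pairing \<open>L2_pair\<close> is bilinear, whereas the inner product is the
  real part of a sesquilinear form; conjugation translates between them in
  \<open>Re_L2_pair\<close>.\<close>

definition cnj_L2 :: "L2 \<Rightarrow> L2" where
  "cnj_L2 X = abs_L2 (\<lambda>z. cnj (rep_L2 X z))"

lemma square_integrable_cnj: "square_integrable f \<Longrightarrow> square_integrable (\<lambda>z. cnj (f z))"
  using borel_measurable_continuous_on[OF continuous_on_cnj[OF continuous_on_id], of f lborel]
  by (auto simp: square_integrable_def)

lemma AE_rep_cnj_L2: "AE z in lborel. rep_L2 (cnj_L2 X) z = cnj (rep_L2 X z)"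
  unfolding cnj_L2_def by (intro AE_rep_abs_L2 square_integrable_cnj square_integrable_rep_L2)

lemma L2_eqI:
  assumes "AE z in lborel. rep_L2 X z = rep_L2 Y z"
  shows "X = Y"
  using abs_L2_eqI[OF square_integrable_rep_L2 square_integrable_rep_L2 assms] by simp

lemma cnj_abs_L2: "square_integrable f \<Longrightarrow> cnj_L2 (abs_L2 f) = abs_L2 (\<lambda>z. cnj (f z))"
  unfolding cnj_L2_def using AE_rep_abs_L2[of f]
  by (intro abs_L2_eqI square_integrable_cnj square_integrable_rep_L2) auto

lemma cnj_L2_diff: "cnj_L2 (X - Y) = cnj_L2 X - cnj_L2 Y"
proof (rule L2_eqI)
  show "AE z in lborel. rep_L2 (cnj_L2 (X - Y)) z = rep_L2 (cnj_L2 X - cnj_L2 Y) z"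
    using AE_rep_cnj_L2[of "X - Y"] AE_rep_L2_diff[of X Y] AE_rep_L2_diff[of "cnj_L2 X" "cnj_L2 Y"]
      AE_rep_cnj_L2[of X] AE_rep_cnj_L2[of Y]
    by eventually_elim simp
qed

lemma norm_cnj_L2: "norm (cnj_L2 X) = norm X"
proof -
  have "(norm (cnj_L2 X))\<^sup>2 = (norm X)\<^sup>2"
    unfolding cnj_L2_def norm_L2_rep[of X]
    by (simp add: norm_abs_L2 square_integrable_cnj square_integrable_rep_L2)
  then show ?thesis by simp
qed

lemma tendsto_cnj_L2:
  assumes "(X \<longlongrightarrow> x) F"
  shows "((\<lambda>n. cnj_L2 (X n)) \<longlongrightarrow> cnj_L2 x) F"
proof -
  have "((\<lambda>n. norm (X n - x)) \<longlongrightarrow> 0) F"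
    using assms by (simp add: tendsto_norm_zero_iff LIM_zero_iff)
  then have "((\<lambda>n. norm (cnj_L2 (X n) - cnj_L2 x)) \<longlongrightarrow> 0) F"
    by (simp only: norm_cnj_L2 flip: cnj_L2_diff)
  then have "((\<lambda>n. cnj_L2 (X n) - cnj_L2 x) \<longlongrightarrow> 0) F"
    by (rule tendsto_norm_zero_cancel)
  then show ?thesis by (simp add: LIM_zero_iff)
qed

lemma Re_L2_pair: "Re (L2_pair X Y) = X \<bullet> cnj_L2 Y"
proof -
  have "X \<bullet> cnj_L2 Y = abs_L2 (rep_L2 X) \<bullet> abs_L2 (\<lambda>z. cnj (rep_L2 Y z))"
    by (simp add: cnj_L2_def)
  also have "\<dots> = (LINT z|lborel. rep_L2 X z \<bullet> cnj (rep_L2 Y z))"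
    by (intro inner_abs_L2 square_integrable_cnj square_integrable_rep_L2)
  also have "\<dots> = (LINT z|lborel. Re (rep_L2 X z * rep_L2 Y z))"
    by (simp add: inner_complex_def)
  also have "\<dots> = Re (LINT z|lborel. rep_L2 X z * rep_L2 Y z)"
    by (intro integral_Re square_integrable_times square_integrable_rep_L2)
  finally show ?thesis by (simp add: L2_pair_rep)
qed

lemma L2_pair_cscale_right: "L2_pair X (cscale_L2 c Y) = c * L2_pair X Y"
proof -
  have "L2_pair X (cscale_L2 c Y) = L2_pair (abs_L2 (rep_L2 X)) (abs_L2 (\<lambda>z. c * rep_L2 Y z))"
    using cscale_L2.abs_eq[of "rep_L2 Y" c] square_integrable_rep_L2 by (simp add: L2_rel_def)
  also have "\<dots> = (LINT z|lborel. rep_L2 X z * (c * rep_L2 Y z))"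
    by (intro L2_pair_abs square_integrable_cmult square_integrable_rep_L2)
  also have "\<dots> = (LINT z|lborel. c * (rep_L2 X z * rep_L2 Y z))"
    by (simp add: mult_ac)
  finally show ?thesis by (simp add: L2_pair_rep)
qed

lemma cscale_L2_comp: "cscale_L2 c (cscale_L2 d X) = cscale_L2 (c * d) X"
proof (rule L2_eqI)
  show "AE z in lborel. rep_L2 (cscale_L2 c (cscale_L2 d X)) z = rep_L2 (cscale_L2 (c * d) X) z"
    using AE_rep_L2_cscale[of c "cscale_L2 d X"] AE_rep_L2_cscale[of d X] AE_rep_L2_cscale[of "c * d" X]
    by eventually_elim simp
qed

lemma cscale_L2_minus1: "cscale_L2 (- 1) X = - X"
  using cscale_L2_of_real[of "- 1" X] by simp

lemma cnj_L2_cscale: "cnj_L2 (cscale_L2 c X) = cscale_L2 (cnj c) (cnj_L2 X)"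
proof (rule L2_eqI)
  show "AE z in lborel. rep_L2 (cnj_L2 (cscale_L2 c X)) z = rep_L2 (cscale_L2 (cnj c) (cnj_L2 X)) z"
    using AE_rep_cnj_L2[of "cscale_L2 c X"] AE_rep_L2_cscale[of c X] AE_rep_L2_cscale[of "cnj c" "cnj_L2 X"]
      AE_rep_cnj_L2[of X]
    by eventually_elim simp
qed

lemma inner_cscale_ii: "cscale_L2 \<i> X \<bullet> cscale_L2 \<i> Y = X \<bullet> Y"
proof -
  have "cscale_L2 \<i> Z = abs_L2 (\<lambda>z. \<i> * rep_L2 Z z)" for Z
    using cscale_L2.abs_eq[of "rep_L2 Z" \<i>] square_integrable_rep_L2 by (simp add: L2_rel_def)
  then have "cscale_L2 \<i> X \<bullet> cscale_L2 \<i> Y = (LINT z|lborel. (\<i> * rep_L2 X z) \<bullet> (\<i> * rep_L2 Y z))"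
    by (simp add: inner_abs_L2 square_integrable_cmult square_integrable_rep_L2)
  also have "\<dots> = X \<bullet> Y"
    unfolding inner_L2_rep by (simp add: inner_complex_def add.commute)
  finally show ?thesis .
qed

section \<open>Nemytskii operators\<close>

text \<open>Pointwise counterpart of the hypotheses on \<open>g\<close> and \<open>G\<close> in
  \<open>schroedinger_form\<close>; both inequalities integrate over the plane with the same
  constant \<open>L\<close>.\<close>

locale lipschitz_gradient =
  fixes \<phi> :: "complex \<Rightarrow> complex" and \<Gamma> :: "complex \<Rightarrow> real" and L :: real
  assumes lipschitz: "cmod (\<phi> z - \<phi> w) \<le> L * cmod (z - w)"
    and at_zero: "\<phi> 0 = 0" "\<Gamma> 0 = 0"
    and L_pos: "0 < L"
    and gradient: "\<bar>\<Gamma> w - \<Gamma> z - \<phi> z \<bullet> (w - z)\<bar> \<le> L * (cmod (w - z))\<^sup>2"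
begin

definition nem :: "L2 \<Rightarrow> L2" where
  "nem X = abs_L2 (\<lambda>z. \<phi> (rep_L2 X z))"

definition pot :: "L2 \<Rightarrow> real" where
  "pot X = (LINT z|lborel. \<Gamma> (rep_L2 X z))"

lemma continuous_phi: "continuous_on UNIV \<phi>"
  by (rule lipschitz_on_continuous_on[of L])
    (use lipschitz L_pos in \<open>auto intro!: lipschitz_onI simp: dist_norm\<close>)

lemma isCont_Gamma: "isCont \<Gamma> z"
  by (rule isCont_if_quadratic_remainder[OF gradient])

lemma measurable_phi [measurable]: "\<phi> \<in> borel_measurable borel"
  and measurable_Gamma [measurable]: "\<Gamma> \<in> borel_measurable borel"
  using continuous_phi isCont_Gamma
  by (auto intro!: borel_measurable_continuous_onI continuous_at_imp_continuous_on)

lemma cmod_phi_le: "cmod (\<phi> z) \<le> L * cmod z"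
  using lipschitz[of z 0] by (simp add: at_zero)

lemma abs_Gamma_le: "\<bar>\<Gamma> z\<bar> \<le> L * (cmod z)\<^sup>2"
  using gradient[of z 0] by (simp add: at_zero)

lemma square_integrable_phi:
  assumes "square_integrable f"
  shows "square_integrable (\<lambda>z. \<phi> (f z))"
proof -
  have [measurable]: "f \<in> borel_measurable borel"
    using assms by (simp add: square_integrable_def)
  have "integrable lborel (\<lambda>z. (cmod (\<phi> (f z)))\<^sup>2)"
  proof (rule Bochner_Integration.integrable_bound)
    show "integrable lborel (\<lambda>z. L\<^sup>2 * (cmod (f z))\<^sup>2)"
      using assms by (simp add: square_integrable_def)
    show "AE z in lborel. norm ((cmod (\<phi> (f z)))\<^sup>2) \<le> norm (L\<^sup>2 * (cmod (f z))\<^sup>2)"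
      using cmod_phi_le by (auto simp: power_mult_distrib[symmetric] intro!: power_mono)
  qed simp
  then show ?thesis by (simp add: square_integrable_def)
qed

lemma integrable_Gamma:
  assumes "square_integrable f"
  shows "integrable lborel (\<lambda>z. \<Gamma> (f z))"
proof (rule Bochner_Integration.integrable_bound)
  show "integrable lborel (\<lambda>z. L * (cmod (f z))\<^sup>2)"
    using assms by (simp add: square_integrable_def)
  have [measurable]: "f \<in> borel_measurable borel"
    using assms by (simp add: square_integrable_def)
  show "(\<lambda>z. \<Gamma> (f z)) \<in> borel_measurable lborel" by simp
  show "AE z in lborel. norm (\<Gamma> (f z)) \<le> norm (L * (cmod (f z))\<^sup>2)"
    using abs_Gamma_le L_pos by (simp add: abs_mult)
qed

lemma AE_rep_nem: "AE z in lborel. rep_L2 (nem X) z = \<phi> (rep_L2 X z)"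
  unfolding nem_def by (intro AE_rep_abs_L2 square_integrable_phi square_integrable_rep_L2)

lemma nem_lipschitz: "norm (nem X - nem Y) \<le> L * norm (X - Y)"
proof -
  note s = square_integrable_rep_L2
  have "(norm (nem X - nem Y))\<^sup>2 = (LINT z|lborel. (cmod (\<phi> (rep_L2 X z) - \<phi> (rep_L2 Y z)))\<^sup>2)"
    unfolding nem_def by (simp add: norm_abs_L2 square_integrable_diff square_integrable_phi s flip: abs_L2_diff)
  also have "\<dots> \<le> (LINT z|lborel. L\<^sup>2 * (cmod (rep_L2 X z - rep_L2 Y z))\<^sup>2)"
    using square_integrable_diff[OF s s, of X Y]
      square_integrable_diff[OF square_integrable_phi[OF s] square_integrable_phi[OF s], of X Y] lipschitz
    by (intro integral_mono)
      (auto simp: square_integrable_def intro!: power_mono[OF lipschitz, THEN order_trans]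
        power_mult_distrib[THEN eq_refl])
  also have "\<dots> = L\<^sup>2 * (norm (X - Y))\<^sup>2"
    using norm_abs_L2[OF square_integrable_diff[OF s s], of X Y] abs_L2_diff[OF s s, of X Y] by simp
  finally have "(norm (nem X - nem Y))\<^sup>2 \<le> (L * norm (X - Y))\<^sup>2"
    by (simp add: power_mult_distrib)
  then show ?thesis
    by (rule power2_le_imp_le) (use L_pos in simp)
qed

lemma pot_gradient: "\<bar>pot Y - pot X - nem X \<bullet> (Y - X)\<bar> \<le> L * (norm (Y - X))\<^sup>2"
proof -
  note s = square_integrable_rep_L2
  note i = integrable_Gamma[OF s] square_integrable_inner[OF square_integrable_phi[OF s] square_integrable_diff[OF s s]]
  have "nem X \<bullet> (Y - X) = (LINT z|lborel. \<phi> (rep_L2 X z) \<bullet> (rep_L2 Y z - rep_L2 X z))"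
    unfolding nem_def using inner_abs_L2[OF square_integrable_phi[OF s] square_integrable_diff[OF s s], of X Y X]
      abs_L2_diff[OF s s, of Y X] by simp
  then have "\<bar>pot Y - pot X - nem X \<bullet> (Y - X)\<bar>
      = \<bar>LINT z|lborel. \<Gamma> (rep_L2 Y z) - \<Gamma> (rep_L2 X z) - \<phi> (rep_L2 X z) \<bullet> (rep_L2 Y z - rep_L2 X z)\<bar>"
    unfolding pot_def using i by simp
  also have "\<dots> \<le> (LINT z|lborel. L * (cmod (rep_L2 Y z - rep_L2 X z))\<^sup>2)"
    using i square_integrable_diff[OF s s, of Y X] gradient
    by (intro integral_abs_bound_integral) (auto simp: square_integrable_def)
  also have "\<dots> = L * (norm (Y - X))\<^sup>2"
    using norm_abs_L2[OF square_integrable_diff[OF s s], of Y X] abs_L2_diff[OF s s, of Y X] by simp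
  finally show ?thesis .
qed

lemma nem_0: "nem 0 = 0"
proof -
  have "AE z in lborel. rep_L2 0 z = 0"
    using AE_rep_L2_diff[of 0 0] by simp
  then have "AE z in lborel. rep_L2 (nem 0) z = rep_L2 0 z"
    using AE_rep_nem[of 0] by eventually_elim (simp add: at_zero)
  then show ?thesis by (rule L2_eqI)
qed

lemma pot_0: "pot 0 = 0"
proof -
  have "AE z in lborel. \<Gamma> (rep_L2 0 z) = 0"
    using AE_rep_L2_diff[of 0 0] by eventually_elim (simp add: at_zero)
  then show ?thesis
    unfolding pot_def by (simp add: integral_eq_zero_AE)
qed

lemma nem_inner_ii:
  assumes "\<And>z. \<phi> z \<bullet> (\<i> * z) = 0"
  shows "nem X \<bullet> cscale_L2 \<i> X = 0"
proof -
  note s = square_integrable_rep_L2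
  have "cscale_L2 \<i> X = abs_L2 (\<lambda>z. \<i> * rep_L2 X z)"
    using cscale_L2.abs_eq[of "rep_L2 X" \<i>] s by (simp add: L2_rel_def)
  then show ?thesis
    unfolding nem_def
    by (simp add: inner_abs_L2 square_integrable_phi square_integrable_cmult s assms)
qed

end

section \<open>The truncated power nonlinearity\<close>

text \<open>Only the modulus inside the power is cut off, so the map stays a real radial multiple of
  \<open>z\<close>: it is still gauge invariant and still a gradient.\<close>

definition trunc_power :: "real \<Rightarrow> real \<Rightarrow> complex \<Rightarrow> complex" where
  "trunc_power p K z = of_real (min (cmod z) K powr (p - 2)) * z"

text \<open>The primitive is written in terms of \<open>|z|\<^sup>2\<close>, which is smooth at the origin.\<close>

definition trunc_potential :: "real \<Rightarrow> real \<Rightarrow> complex \<Rightarrow> real" where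
  "trunc_potential p K z = integral {0..(cmod z)\<^sup>2} (\<lambda>s. min (sqrt s) K powr (p - 2)) / 2"

text \<open>For \<open>q < 1\<close> the power is not Lipschitz near 0. The factor \<open>b\<close>
  compensates: it lies below the intermediate point \<open>x\<close> of the mean value theorem, so
  \<open>x powr (q - 1) * b \<le> x powr q\<close>.\<close>

lemma powr_diff_mult_le:
  fixes a b q K :: real
  assumes "0 < q" "0 \<le> b" "b \<le> a" "0 < K"
  shows "(min a K powr q - min b K powr q) * b \<le> q * K powr q * (a - b)"
proof (cases "b = 0 \<or> K \<le> b \<or> a = b")
  case True
  then show ?thesis
    using assms by auto
next
  case False
  define c where "c = min a K"
  have b: "0 < b" "b < c" and c: "c \<le> K" "c \<le> a"
    using False assms by (auto simp: c_def)
  have "\<exists>x>b. x < c \<and> c powr q - b powr q = (c - b) * (q * x powr (q - 1))"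
    by (rule MVT2[OF b(2)]) (use b in \<open>auto intro!: has_real_derivative_powr\<close>)
  then obtain x where x: "b < x" "x < c" "c powr q - b powr q = (c - b) * (q * x powr (q - 1))"
    by blast
  have "x powr (q - 1) * b \<le> x powr (q - 1) * x"
    using x by (intro mult_left_mono) auto
  also have "\<dots> = x powr q"
    using x b by (simp add: powr_diff)
  also have "\<dots> \<le> K powr q"
    using x b c assms by (intro powr_mono2) auto
  finally have "(c - b) * q * (x powr (q - 1) * b) \<le> (a - b) * q * K powr q"
    using b c assms by (intro mult_mono) auto
  then have "(c powr q - b powr q) * b \<le> q * K powr q * (a - b)"
    by (simp add: x(3) mult_ac)
  moreover have "min b K = b" using False by simp
  ultimately show ?thesis by (simp add: c_def)
qed

text \<open>The difference is split so that the increment of the scalar factor multiplies the number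
  of smaller modulus, as \<open>powr_diff_mult_le\<close> requires. The two parts contribute
  \<open>1\<close> and \<open>p - 2\<close> to the factor \<open>p - 1\<close>.\<close>

lemma trunc_power_lipschitz:
  assumes "2 < p" "0 < K"
  shows "cmod (trunc_power p K z - trunc_power p K w) \<le> (p - 1) * K powr (p - 2) * cmod (z - w)"
proof -
  define q where "q = p - 2"
  have q: "0 < q" using assms by (simp add: q_def)
  define \<theta> where "\<theta> r = min r K powr q" for r
  have le: "cmod (trunc_power p K z - trunc_power p K w) \<le> (p - 1) * K powr (p - 2) * cmod (z - w)"
    if zw: "cmod w \<le> cmod z" for z w
  proof -
    have \<theta>: "\<theta> (cmod w) \<le> \<theta> (cmod z)" "\<theta> (cmod z) \<le> K powr q" "0 \<le> \<theta> (cmod z)"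
      unfolding \<theta>_def using zw q assms by (auto intro!: powr_mono2)
    have "trunc_power p K z - trunc_power p K w
        = of_real (\<theta> (cmod z)) * (z - w) + of_real (\<theta> (cmod z) - \<theta> (cmod w)) * w"
      by (simp add: trunc_power_def \<theta>_def q_def algebra_simps)
    then have "cmod (trunc_power p K z - trunc_power p K w)
        \<le> cmod (of_real (\<theta> (cmod z)) * (z - w)) + cmod (of_real (\<theta> (cmod z) - \<theta> (cmod w)) * w)"
      by (simp only: norm_triangle_ineq)
    also have "\<dots> = \<theta> (cmod z) * cmod (z - w) + (\<theta> (cmod z) - \<theta> (cmod w)) * cmod w"
      using \<theta> by (simp only: norm_mult norm_of_real)
    also have "\<dots> \<le> K powr q * cmod (z - w) + q * K powr q * (cmod z - cmod w)"
      using \<theta> powr_diff_mult_le[OF q _ zw assms(2)]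
      by (intro add_mono mult_right_mono) (auto simp: \<theta>_def)
    also have "\<dots> \<le> K powr q * cmod (z - w) + q * K powr q * cmod (z - w)"
      using q norm_triangle_ineq2[of z w] by (intro add_left_mono mult_left_mono) auto
    finally show ?thesis
      by (simp add: q_def algebra_simps)
  qed
  show ?thesis
    using le[of w z] le[of z w] by (cases "cmod w \<le> cmod z") (auto simp: norm_minus_commute)
qed

text \<open>Along a line \<open>|z|^2\<close> is a polynomial, so the origin needs no separate case;
  the one-sided derivative of the outer integral at 0 suffices because \<open>|z|^2\<close> is
  nonnegative.\<close>

lemma has_vector_derivative_trunc_potential:
  assumes "2 < p" "0 < K"
  shows "((\<lambda>t. trunc_potential p K (z + of_real t * h)) has_vector_derivative
    trunc_power p K (z + of_real t * h) \<bullet> h) (at t)"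
proof -
  define \<theta> where "\<theta> s = min (sqrt s) K powr (p - 2)" for s
  define w where "w t = z + of_real t * h" for t :: real
  have "continuous_on {0..} \<theta>"
    unfolding \<theta>_def using assms
    by (intro continuous_intros continuous_on_powr') auto
  from has_vector_derivative_integral_atLeast[OF this, where w = 0]
  have 1: "((\<lambda>r. integral {0..r} \<theta>) has_vector_derivative \<theta> r) (at r within {0..})" if "0 \<le> r" for r
    using that by simp
  have w: "(w has_vector_derivative h) (at t)"
    unfolding w_def by (auto intro!: derivative_eq_intros simp: scaleR_conv_of_real has_vector_derivative_def)
  have 2: "((\<lambda>t. (cmod (w t))\<^sup>2) has_vector_derivative 2 * (w t \<bullet> h)) (at t)"
    using has_vector_derivative_norm_sq[OF w] by (simp add: inner_commute)
  have "(((\<lambda>r. integral {0..r} \<theta>) \<circ> (\<lambda>t. (cmod (w t))\<^sup>2)) has_vector_derivative (2 * (w t \<bullet> h)) *\<^sub>R \<theta> ((cmod (w t))\<^sup>2)) (at t)"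
    by (rule vector_diff_chain_within[OF 2])
      (rule has_vector_derivative_within_subset[OF 1], auto)
  from has_vector_derivative_divide[OF this, of 2]
  have "((\<lambda>t. trunc_potential p K (w t)) has_vector_derivative (w t \<bullet> h) * \<theta> ((cmod (w t))\<^sup>2)) (at t)"
    by (simp add: o_def trunc_potential_def \<theta>_def[abs_def])
  moreover have "(w t \<bullet> h) * \<theta> ((cmod (w t))\<^sup>2) = trunc_power p K (w t) \<bullet> h"
    by (simp add: trunc_power_def \<theta>_def inner_complex_def algebra_simps)
  ultimately show ?thesis
    unfolding w_def by simp
qed

text \<open>Mean value theorem along the segment from \<open>z\<close> to \<open>w\<close>, then the
  Lipschitz bound for the gradient at the intermediate point.\<close>

lemma trunc_potential_gradient:
  assumes "2 < p" "0 < K"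
  shows "\<bar>trunc_potential p K w - trunc_potential p K z - trunc_power p K z \<bullet> (w - z)\<bar>
    \<le> (p - 1) * K powr (p - 2) * (cmod (w - z))\<^sup>2"
proof -
  define h where "h = w - z"
  define f where "f t = trunc_potential p K (z + of_real t * h)" for t :: real
  have "\<exists>t. 0 < t \<and> t < 1 \<and> f 1 - f 0 = (1 - 0) * (trunc_power p K (z + of_real t * h) \<bullet> h)"
    by (rule MVT2) (use has_vector_derivative_trunc_potential[OF assms] in
        \<open>auto simp: f_def has_real_derivative_iff_has_vector_derivative\<close>)
  then obtain t where t: "0 < t" "t < 1" "f 1 - f 0 = trunc_power p K (z + of_real t * h) \<bullet> h"
    by auto
  have "\<bar>f 1 - f 0 - trunc_power p K z \<bullet> h\<bar> = \<bar>(trunc_power p K (z + of_real t * h) - trunc_power p K z) \<bullet> h\<bar>"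
    by (simp add: t(3) inner_diff_left)
  also have "\<dots> \<le> cmod (trunc_power p K (z + of_real t * h) - trunc_power p K z) * cmod h"
    by (rule Cauchy_Schwarz_ineq2)
  also have "\<dots> \<le> ((p - 1) * K powr (p - 2) * cmod (z + of_real t * h - z)) * cmod h"
    by (intro mult_right_mono trunc_power_lipschitz assms) simp
  also have "\<dots> = t * ((p - 1) * K powr (p - 2) * (cmod h)\<^sup>2)"
    using t by (simp add: norm_mult power2_eq_square)
  also have "\<dots> \<le> 1 * ((p - 1) * K powr (p - 2) * (cmod h)\<^sup>2)"
    using t assms by (intro mult_right_mono) auto
  finally show ?thesis
    by (simp add: f_def h_def)
qed

lemma trunc_power_eq: "cmod z \<le> K \<Longrightarrow> trunc_power p K z = of_real (cmod z powr (p - 2)) * z"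
  by (simp add: trunc_power_def min_def)

lemma trunc_power_ii: "trunc_power p K z \<bullet> (\<i> * z) = 0"
  by (simp add: trunc_power_def inner_complex_def)

lemma trunc_potential_eq:
  assumes "2 < p" and z: "cmod z \<le> K"
  shows "trunc_potential p K z = cmod z powr p / p"
proof -
  define F where "F s = 2 / p * sqrt s powr p" for s
  \<comment> \<open>\<open>sqrt\<close> is not differentiable at 0, hence the version of the
    fundamental theorem that asks for derivatives in the interior only.\<close>
  have "((\<lambda>s. min (sqrt s) K powr (p - 2)) has_integral F ((cmod z)\<^sup>2) - F 0) {0..(cmod z)\<^sup>2}"
  proof (rule fundamental_theorem_of_calculus_interior)
    show "continuous_on {0..(cmod z)\<^sup>2} F"
      unfolding F_def using assms by (intro continuous_intros continuous_on_powr') auto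
    fix s assume s: "s \<in> {0<..<(cmod z)\<^sup>2}"
    have "sqrt s \<le> K"
      using s z by (metis greaterThanLessThan_iff less_imp_le norm_ge_zero order_trans real_le_lsqrt)
    moreover have "2 / p * (p * sqrt s powr (p - 1) * (inverse (sqrt s) / 2)) = sqrt s powr (p - 2)"
      using s assms(1) by (simp add: powr_diff power2_eq_square field_simps)
    moreover have "(F has_real_derivative 2 / p * (p * sqrt s powr (p - 1) * (inverse (sqrt s) / 2))) (at s)"
      unfolding F_def using s by (auto intro!: derivative_eq_intros)
    ultimately show "(F has_vector_derivative min (sqrt s) K powr (p - 2)) (at s)"
      by (simp add: min_absorb1 flip: has_real_derivative_iff_has_vector_derivative)
  qed simp
  then have "integral {0..(cmod z)\<^sup>2} (\<lambda>s. min (sqrt s) K powr (p - 2)) = 2 / p * cmod z powr p"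
    by (simp add: integral_unique F_def)
  then show ?thesis
    by (simp add: trunc_potential_def)
qed

lemma lipschitz_gradient_trunc:
  assumes "2 < p" "0 < K"
  shows "lipschitz_gradient (trunc_power p K) (trunc_potential p K) ((p - 1) * K powr (p - 2))"
  using assms trunc_power_lipschitz trunc_potential_gradient
  by unfold_locales (auto simp: trunc_power_def trunc_potential_def)


section \<open>The space \<open>H\<^sup>1\<^sup>,\<^sup>2\<close>\<close>

lemmas H12_defs = H12_L2.rep_eq H12_dx.rep_eq H12_dyy.rep_eq

lemma H12_eqI:
  assumes "H12_L2 u = H12_L2 v" "H12_dx u = H12_dx v" "H12_dyy u = H12_dyy v"
  shows "u = v"
  using assms by (intro H12_triple_inject[THEN iffD1]) (auto simp: H12_defs prod_eq_iff)

lemma norm_H12_components: "norm (H12_dx u) \<le> norm u" "norm (H12_dyy u) \<le> norm u" "norm (H12_L2 u) \<le> norm u"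
  by (simp_all add: norm_H12_def)

lemma tendsto_H12I:
  assumes "((\<lambda>n. H12_L2 (U n)) \<longlongrightarrow> H12_L2 u) F" "((\<lambda>n. H12_dx (U n)) \<longlongrightarrow> H12_dx u) F"
    "((\<lambda>n. H12_dyy (U n)) \<longlongrightarrow> H12_dyy u) F"
  shows "(U \<longlongrightarrow> u) F"
proof -
  have eq: "norm (U n - u) = norm (H12_dx (U n) - H12_dx u) + norm (H12_dyy (U n) - H12_dyy u) + norm (H12_L2 (U n) - H12_L2 u)" for n
    by (simp add: norm_H12_def linear_diff[OF bounded_linear.linear[OF bounded_linear_H12_dx]]
        linear_diff[OF bounded_linear.linear[OF bounded_linear_H12_dyy]] linear_diff[OF bounded_linear.linear[OF bounded_linear_H12_L2]])
  have "((\<lambda>n. norm (H12_dx (U n) - H12_dx u) + norm (H12_dyy (U n) - H12_dyy u) + norm (H12_L2 (U n) - H12_L2 u)) \<longlongrightarrow>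
      norm (H12_dx u - H12_dx u) + norm (H12_dyy u - H12_dyy u) + norm (H12_L2 u - H12_L2 u)) F"
    by (intro tendsto_intros assms)
  then have "((\<lambda>n. norm (U n - u)) \<longlongrightarrow> 0) F"
    unfolding eq by simp
  then show ?thesis
    by (simp add: tendsto_norm_zero_iff LIM_zero_iff)
qed

instance H12 :: banach
proof
  fix U :: "nat \<Rightarrow> H12" assume "Cauchy U"
  then have "Cauchy (\<lambda>n. H12_L2 (U n))" "Cauchy (\<lambda>n. H12_dx (U n))" "Cauchy (\<lambda>n. H12_dyy (U n))"
    by (auto intro: bounded_linear.Cauchy bounded_linear_H12_L2 bounded_linear_H12_dx bounded_linear_H12_dyy)
  then obtain u v w where lim: "(\<lambda>n. H12_L2 (U n)) \<longlonglongrightarrow> u" "(\<lambda>n. H12_dx (U n)) \<longlonglongrightarrow> v" "(\<lambda>n. H12_dyy (U n)) \<longlonglongrightarrow> w"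
    by (meson Cauchy_convergent convergent_def)
  have "(\<lambda>n. (H12_L2 (U n), H12_dx (U n), H12_dyy (U n))) \<longlonglongrightarrow> (u, v, w)"
    by (intro tendsto_Pair lim)
  moreover have "(H12_L2 (U n), H12_dx (U n), H12_dyy (U n)) \<in> closure test_graph" for n
    using H12_triple[of "U n"] by (simp add: H12_defs)
  ultimately have *: "(u, v, w) \<in> closure test_graph"
    by (rule closed_sequentially[OF closed_closure, rotated]) 
  define l where "l = Abs_H12 (u, v, w)"
  have "H12_triple l = (u, v, w)"
    unfolding l_def by (rule Abs_H12_inverse[OF *])
  then have "H12_L2 l = u" "H12_dx l = v" "H12_dyy l = w"
    by (simp_all add: H12_defs)
  then have "U \<longlonglongrightarrow> l"
    using lim by (intro tendsto_H12I) simp_all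
  then show "convergent U" by (rule convergentI)
qed

lemma H12_cscale [simp]:
  "H12_L2 (cscale_H12 c u) = cscale_L2 c (H12_L2 u)"
  "H12_dx (cscale_H12 c u) = cscale_L2 c (H12_dx u)"
  "H12_dyy (cscale_H12 c u) = cscale_L2 c (H12_dyy u)"
  by (simp_all add: H12_defs cscale_H12.rep_eq cscale_triple_def case_prod_beta)

section \<open>Complex conjugation on the anisotropic Sobolev space, and pointwise bounds under L2
  limits\<close>

lemma has_vector_derivative_cnj:
  "(f has_vector_derivative D) (at x) \<Longrightarrow> ((\<lambda>s. cnj (f s)) has_vector_derivative cnj D) (at x)"
  by (rule bounded_linear.has_vector_derivative[OF bounded_linear_cnj])

lemma dX_cnj: "(\<And>z. f differentiable (at z)) \<Longrightarrow> dX (\<lambda>z. cnj (f z)) = (\<lambda>z. cnj (dX f z))"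
  by (rule ext, clarify, subst dX_def)
    (simp add: vector_derivative_at has_vector_derivative_cnj has_dX)

lemma dY_cnj: "(\<And>z. f differentiable (at z)) \<Longrightarrow> dY (\<lambda>z. cnj (f z)) = (\<lambda>z. cnj (dY f z))"
  by (rule ext, clarify, subst dY_def)
    (simp add: vector_derivative_at has_vector_derivative_cnj has_dY)

lemma differentiable_cnj: "f differentiable (at z) \<Longrightarrow> (\<lambda>z. cnj (f z)) differentiable (at z)"
  unfolding differentiable_def using bounded_linear.has_derivative[OF bounded_linear_cnj] by blast

lemma Ck_cnj: "Ck k f \<Longrightarrow> Ck k (\<lambda>z. cnj (f z))"
  by (induction k arbitrary: f)
    (auto simp: dX_cnj dY_cnj differentiable_cnj simp del: split_paired_All intro!: continuous_intros)

lemma test_functions_cnj: "f \<in> test_functions \<Longrightarrow> (\<lambda>z. cnj (f z)) \<in> test_functions"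
  by (simp add: test_functions_def Ck_cnj)

lemma closure_test_graph_cnj:
  assumes "(u, v, w) \<in> closure test_graph"
  shows "(cnj_L2 u, cnj_L2 v, cnj_L2 w) \<in> closure test_graph"
proof -
  obtain U where U: "\<And>n. U n \<in> test_graph" "U \<longlonglongrightarrow> (u, v, w)"
    using assms by (auto simp: closure_sequential)
  define V where "V n = (cnj_L2 (fst (U n)), cnj_L2 (fst (snd (U n))), cnj_L2 (snd (snd (U n))))" for n
  have "(\<lambda>n. fst (U n)) \<longlonglongrightarrow> u" "(\<lambda>n. fst (snd (U n))) \<longlonglongrightarrow> v" "(\<lambda>n. snd (snd (U n))) \<longlonglongrightarrow> w"
    using tendsto_fst[OF U(2)] tendsto_fst[OF tendsto_snd[OF U(2)]] tendsto_snd[OF tendsto_snd[OF U(2)]]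
    by simp_all
  then have "V \<longlonglongrightarrow> (cnj_L2 u, cnj_L2 v, cnj_L2 w)"
    unfolding V_def by (intro tendsto_Pair tendsto_cnj_L2)
  moreover have "V n \<in> test_graph" for n
  proof -
    obtain f where f: "f \<in> test_functions" and Un: "U n = (abs_L2 f, abs_L2 (dX f), abs_L2 (dY (dY f)))"
      using U(1)[of n] by (auto simp: test_graph_def)
    note d = test_functions_differentiable[OF f]
    note s = test_functions_square_integrable[OF f]
    have "V n = (abs_L2 (\<lambda>z. cnj (f z)), abs_L2 (dX (\<lambda>z. cnj (f z))), abs_L2 (dY (dY (\<lambda>z. cnj (f z)))))"
      by (simp add: V_def Un cnj_abs_L2 s dX_cnj dY_cnj d)
    then show ?thesis
      using test_functions_cnj[OF f] by (auto simp: test_graph_def)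
  qed
  ultimately show ?thesis
    unfolding closure_sequential by blast
qed

definition cnj_H12 :: "H12 \<Rightarrow> H12" where
  "cnj_H12 u = Abs_H12 (cnj_L2 (H12_L2 u), cnj_L2 (H12_dx u), cnj_L2 (H12_dyy u))"

lemma cnj_H12 [simp]:
  "H12_L2 (cnj_H12 u) = cnj_L2 (H12_L2 u)"
  "H12_dx (cnj_H12 u) = cnj_L2 (H12_dx u)"
  "H12_dyy (cnj_H12 u) = cnj_L2 (H12_dyy u)"
proof -
  have "(H12_L2 u, H12_dx u, H12_dyy u) \<in> closure test_graph"
    using H12_triple[of u] by (simp add: H12_defs)
  then have "H12_triple (cnj_H12 u) = (cnj_L2 (H12_L2 u), cnj_L2 (H12_dx u), cnj_L2 (H12_dyy u))"
    unfolding cnj_H12_def by (intro Abs_H12_inverse closure_test_graph_cnj)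
  then show "H12_L2 (cnj_H12 u) = cnj_L2 (H12_L2 u)"
    "H12_dx (cnj_H12 u) = cnj_L2 (H12_dx u)" "H12_dyy (cnj_H12 u) = cnj_L2 (H12_dyy u)"
    by (simp_all add: H12_defs)
qed

text \<open>If \<open>X n\<close> stays below \<open>C'\<close>, the excess of the modulus of
  \<open>x\<close> over \<open>C'\<close> is at most the pointwise distance from \<open>x\<close> to
  \<open>X n\<close>. The integral of the squared excess is therefore at most the squared distance
  in L2, hence 0; finally \<open>C'\<close> decreases to \<open>C\<close> through a countable
  set.\<close>

lemma AE_norm_rep_L2_le_limit:
  assumes lim: "X \<longlonglongrightarrow> x" and c: "c \<longlonglongrightarrow> C" and bd: "\<And>n. AE z in lborel. cmod (rep_L2 (X n) z) \<le> c n"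
  shows "AE z in lborel. cmod (rep_L2 x z) \<le> C"
proof -
  have *: "AE z in lborel. cmod (rep_L2 x z) \<le> C'" if C': "C < C'" for C'
  proof -
    define J where "J = (\<integral>\<^sup>+z. ennreal ((max 0 (cmod (rep_L2 x z) - C'))\<^sup>2) \<partial>lborel)"
    have "\<forall>\<^sub>F n in sequentially. c n < C'"
      by (rule order_tendstoD(2)[OF c C'])
    then have "\<forall>\<^sub>F n in sequentially. J \<le> ennreal ((norm (x - X n))\<^sup>2)"
    proof eventually_elim
      case (elim n)
      have "J \<le> (\<integral>\<^sup>+z. ennreal ((cmod (rep_L2 x z - rep_L2 (X n) z))\<^sup>2) \<partial>lborel)"
        unfolding J_def
      proof (rule nn_integral_mono_AE)
        show "AE z in lborel. ennreal ((max 0 (cmod (rep_L2 x z) - C'))\<^sup>2)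
            \<le> ennreal ((cmod (rep_L2 x z - rep_L2 (X n) z))\<^sup>2)"
          using bd[of n]
        proof eventually_elim
          case (elim z)
          have "cmod (rep_L2 x z) - C' \<le> cmod (rep_L2 x z - rep_L2 (X n) z)"
            using norm_triangle_ineq2[of "rep_L2 x z" "rep_L2 (X n) z"] elim \<open>c n < C'\<close> by linarith
          then show ?case
            by (intro ennreal_leI power_mono) auto
        qed
      qed
      also have "\<dots> = ennreal ((norm (x - X n))\<^sup>2)"
        using nn_integral_norm_abs_L2[OF square_integrable_diff[OF square_integrable_rep_L2 square_integrable_rep_L2], of x "X n"]
          abs_L2_diff[OF square_integrable_rep_L2 square_integrable_rep_L2, of x "X n"] by simp
      finally show ?case .
    qed
    moreover have "(\<lambda>n. ennreal ((norm (x - X n))\<^sup>2)) \<longlonglongrightarrow> ennreal ((norm (x - x))\<^sup>2)"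
      by (intro tendsto_ennrealI tendsto_intros lim)
    ultimately have "J \<le> ennreal ((norm (x - x))\<^sup>2)"
      by (intro tendsto_lowerbound[where F = sequentially]) auto
    then have "J = 0" by simp
    then have "AE z in lborel. ennreal ((max 0 (cmod (rep_L2 x z) - C'))\<^sup>2) = 0"
      unfolding J_def by (subst (asm) nn_integral_0_iff_AE) auto
    then show ?thesis
      by eventually_elim (auto simp: max_def split: if_splits)
  qed
  have "AE z in lborel. \<forall>k. cmod (rep_L2 x z) \<le> C + 1 / real (Suc k)"
    unfolding AE_all_countable by (intro allI *) simp
  then show ?thesis
  proof eventually_elim
    case (elim z)
    have "(\<lambda>k. C + 1 / real (Suc k)) \<longlonglongrightarrow> C + 0"
      by (intro tendsto_intros LIMSEQ_Suc[OF lim_1_over_n])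
    then show ?case
      using elim by (intro LIMSEQ_le_const[of "\<lambda>k. C + 1 / real (Suc k)" C]) auto
  qed
qed

section \<open>The embedding of \<open>H\<^sup>1\<^sup>,\<^sup>2\<close> into \<open>L\<^sup>\<infinity>\<close>\<close>

lemma has_derivative_dX_dY:
  assumes "f differentiable (at (x, y))"
  shows "(f has_derivative (\<lambda>(h, k). h *\<^sub>R dX f (x, y) + k *\<^sub>R dY f (x, y))) (at (x, y))"
proof -
  obtain D where D: "(f has_derivative D) (at (x, y))"
    using assms by (auto simp: differentiable_def)
  interpret D: bounded_linear D by (rule has_derivative_bounded_linear[OF D])
  have 1: "((\<lambda>s. (s, y)) has_derivative (\<lambda>h. (h, 0))) (at x)"
    and 2: "((\<lambda>s. (x, s)) has_derivative (\<lambda>h. (0, h))) (at y)"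
    by (auto intro!: derivative_eq_intros)
  have "((\<lambda>s. f (s, y)) has_derivative (\<lambda>h. D (h, 0))) (at x)"
    using has_derivative_compose[OF 1, of f D] D by simp
  moreover have "((\<lambda>s. f (s, y)) has_derivative (\<lambda>h. h *\<^sub>R dX f (x, y))) (at x)"
    using has_dX[OF assms] by (simp add: has_vector_derivative_def)
  ultimately have "(\<lambda>h. D (h, 0)) = (\<lambda>h. h *\<^sub>R dX f (x, y))"
    by (rule has_derivative_unique)
  then have DX: "D (h, 0) = h *\<^sub>R dX f (x, y)" for h
    by metis
  have "((\<lambda>s. f (x, s)) has_derivative (\<lambda>h. D (0, h))) (at y)"
    using has_derivative_compose[OF 2, of f D] D by simp
  moreover have "((\<lambda>s. f (x, s)) has_derivative (\<lambda>h. h *\<^sub>R dY f (x, y))) (at y)"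
    using has_dY[OF assms] by (simp add: has_vector_derivative_def)
  ultimately have "(\<lambda>h. D (0, h)) = (\<lambda>h. h *\<^sub>R dY f (x, y))"
    by (rule has_derivative_unique)
  then have DY: "D (0, k) = k *\<^sub>R dY f (x, y)" for k
    by metis
  have "D (h, k) = h *\<^sub>R dX f (x, y) + k *\<^sub>R dY f (x, y)" for h k
    using D.add[of "(h, 0)" "(0, k)"] by (simp add: DX DY)
  then have "D = (\<lambda>(h, k). h *\<^sub>R dX f (x, y) + k *\<^sub>R dY f (x, y))"
    by auto
  with D show ?thesis by simp
qed

lemma has_vector_derivative_path:
  assumes "f differentiable (at (c t, d t))"
    and "(c has_vector_derivative c') (at t)" "(d has_vector_derivative d') (at t)"
  shows "((\<lambda>t. f (c t, d t)) has_vector_derivative (c' *\<^sub>R dX f (c t, d t) + d' *\<^sub>R dY f (c t, d t))) (at t)"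
proof -
  have "((\<lambda>t. (c t, d t)) has_derivative (\<lambda>h. (h *\<^sub>R c', h *\<^sub>R d'))) (at t)"
    using assms(2,3) unfolding has_vector_derivative_def by (rule has_derivative_Pair)
  from has_derivative_compose[OF this has_derivative_dX_dY[OF assms(1)]]
  show ?thesis
    by (simp add: has_vector_derivative_def scaleR_add_right mult_ac)
qed

lemma norm_diff_le_nn_integral:
  fixes h :: "real \<Rightarrow> 'a::euclidean_space"
  assumes "a \<le> b" and h: "\<And>t. (h has_vector_derivative h' t) (at t)" and cont: "continuous_on UNIV h'"
  shows "ennreal (norm (h b - h a)) \<le> (\<integral>\<^sup>+t. ennreal (norm (h' t)) * indicator {a..b} t \<partial>lborel)"
proof -
  have c: "continuous_on {a..b} h'" by (rule continuous_on_subset[OF cont]) simp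
  have "(LINT t|lborel. indicator {a..b} t *\<^sub>R h' t) = h b - h a"
    by (rule integral_FTC_Icc[OF assms(1) _ c]) (rule has_vector_derivative_at_within[OF h])
  moreover have "integrable lborel (\<lambda>t. indicator {a..b} t *\<^sub>R h' t)"
    by (rule borel_integrable_compact) (use c in auto)
  ultimately have "ennreal (norm (h b - h a)) \<le> (\<integral>\<^sup>+t. ennreal (norm (indicator {a..b} t *\<^sub>R h' t)) \<partial>lborel)"
    using integral_norm_bound_ennreal by metis
  also have "\<dots> = (\<integral>\<^sup>+t. ennreal (norm (h' t)) * indicator {a..b} t \<partial>lborel)"
    by (intro nn_integral_cong) (auto simp: indicator_def)
  finally show ?thesis .
qed

text \<open>Negative factors are allowed because the reflected half of the symmetrised average uses
  \<open>b = - r\<close>.\<close>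

lemma nn_integral_affine_plane:
  fixes g :: "real \<times> real \<Rightarrow> ennreal"
  assumes [measurable]: "g \<in> borel_measurable borel" and "a \<noteq> 0" "b \<noteq> 0"
  shows "(\<integral>\<^sup>+z. g z \<partial>lborel) = ennreal (\<bar>a\<bar> * \<bar>b\<bar>) * (\<integral>\<^sup>+s. \<integral>\<^sup>+t. g (x + a * s, y + b * t) \<partial>lborel \<partial>lborel)"
proof -
  have "(\<integral>\<^sup>+z. g z \<partial>lborel) = (\<integral>\<^sup>+u. \<integral>\<^sup>+v. g (u, v) \<partial>lborel \<partial>lborel)"
    by (subst lborel_prod[symmetric], subst lborel.nn_integral_fst[symmetric]) (auto simp: lborel_prod)
  also have "\<dots> = ennreal \<bar>a\<bar> * (\<integral>\<^sup>+s. \<integral>\<^sup>+v. g (x + a * s, v) \<partial>lborel \<partial>lborel)"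
    by (rule nn_integral_real_affine[OF _ assms(2)]) measurable
  also have "(\<integral>\<^sup>+s. \<integral>\<^sup>+v. g (x + a * s, v) \<partial>lborel \<partial>lborel)
      = (\<integral>\<^sup>+s. ennreal \<bar>b\<bar> * (\<integral>\<^sup>+t. g (x + a * s, y + b * t) \<partial>lborel) \<partial>lborel)"
    by (intro nn_integral_cong nn_integral_real_affine[OF _ assms(3)]) measurable
  also have "\<dots> = ennreal \<bar>b\<bar> * (\<integral>\<^sup>+s. \<integral>\<^sup>+t. g (x + a * s, y + b * t) \<partial>lborel \<partial>lborel)"
    by (rule nn_integral_cmult) measurable
  finally show ?thesis
    by (simp add: ennreal_mult mult.assoc)
qed

text \<open>Stands in for the Cauchy-Schwarz inequality: it bounds first powers by squares inside
  nonnegative integrals, with a weight \<open>c\<close> to be optimised at the end.\<close>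

lemma am_gm_weighted:
  fixes w c :: real
  assumes "0 < c"
  shows "w \<le> c / 2 + w\<^sup>2 / (2 * c)"
proof -
  have "0 \<le> (w - c)\<^sup>2 / (2 * c)"
    using assms by simp
  also have "\<dots> = c / 2 + w\<^sup>2 / (2 * c) - w"
    using assms by (simp add: power2_diff field_simps power2_eq_square)
  finally show ?thesis by simp
qed

lemma test_functions_continuous:
  assumes "f \<in> test_functions"
  shows "continuous_on UNIV f" "continuous_on UNIV (dX f)" "continuous_on UNIV (dY f)"
    "continuous_on UNIV (dY (dY f))"
proof -
  have C2: "Ck (Suc (Suc 0)) f" by (rule test_functions_Ck[OF assms])
  then have C1: "Ck (Suc 0) (dX f)" "Ck (Suc 0) (dY f)"
    using Ck.simps(2)[of "Suc 0" f] by blast+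
  then have C0: "Ck 0 (dY (dY f))"
    using Ck.simps(2)[of 0 "dY f"] by blast
  show "continuous_on UNIV f" "continuous_on UNIV (dX f)" "continuous_on UNIV (dY f)"
    "continuous_on UNIV (dY (dY f))"
    using C2 C1 C0 by (blast intro: Ck_imp_continuous)+
qed

definition nn_sq :: "(real \<times> real \<Rightarrow> complex) \<Rightarrow> ennreal" where
  "nn_sq f = (\<integral>\<^sup>+z. ennreal ((cmod (f z))\<^sup>2) \<partial>lborel)"

text \<open>Derivative in \<open>r\<close> of the symmetrised value
  \<open>f (x + r^2 * s, y + r * t) + f (x + r^2 * s, y - r * t)\<close>; the scaling matches one
  \<open>x\<close>-derivative with two \<open>y\<close>-derivatives.\<close>

definition scaling_deriv :: "(real \<times> real \<Rightarrow> complex) \<Rightarrow> real \<Rightarrow> real \<Rightarrow> real \<Rightarrow> real \<Rightarrow> real \<Rightarrow> complex" where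
  "scaling_deriv f x y s t r =
    (2 * r * s) *\<^sub>R (dX f (x + r\<^sup>2 * s, y + r * t) + dX f (x + r\<^sup>2 * s, y + (- r) * t))
    + t *\<^sub>R (dY f (x + r\<^sup>2 * s, y + r * t) - dY f (x + r\<^sup>2 * s, y + (- r) * t))"

text \<open>The pointwise value is compared with averages over the anisotropic boxes
  \<open>[x, x + r\<^sup>2] \<times> [y - r, y + r]\<close>, \<open>0 < r \<le> 1\<close>. Symmetrising in \<open>y\<close> turns the first
  \<open>y\<close>-derivative into a second one, and the rate of change of the average in \<open>r\<close> is then
  \<open>O(r\<^sup>-\<^sup>1\<^sup>/\<^sup>2)\<close>, which is integrable.\<close>

lemma average_derivative_bound:
  assumes f: "f \<in> test_functions" and r: "0 < r" "r \<le> 1" and c: "0 < c"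
  shows "(\<integral>\<^sup>+s. \<integral>\<^sup>+t. ennreal (cmod (scaling_deriv f x y s t r)) * indicator {0..1} t * indicator {0..1} s \<partial>lborel \<partial>lborel)
    \<le> ennreal (3 * r * c) + ennreal (2 / (r\<^sup>2 * c)) * nn_sq (dX f) + ennreal (1 / (2 * r\<^sup>2 * c)) * nn_sq (dY (dY f))"
proof -
  note contX = test_functions_continuous(2)[OF f] and contY = test_functions_continuous(3)[OF f]
    and contYY = test_functions_continuous(4)[OF f]
  have [measurable]: "dX f \<in> borel_measurable borel" "dY f \<in> borel_measurable borel" "dY (dY f) \<in> borel_measurable borel"
    using contX contY contYY by (auto intro: borel_measurable_continuous_onI)
  define S where "S s t = dX f (x + r\<^sup>2 * s, y + r * t) + dX f (x + r\<^sup>2 * s, y + (- r) * t)" for s t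
  define D where "D s t = dY f (x + r\<^sup>2 * s, y + r * t) - dY f (x + r\<^sup>2 * s, y + (- r) * t)" for s t
  have split: "scaling_deriv f x y s t r = (2 * r * s) *\<^sub>R S s t + t *\<^sub>R D s t" for s t
    by (simp add: scaling_deriv_def S_def D_def)
  define P where "P b s t = ennreal ((cmod (dX f (x + r\<^sup>2 * s, y + b * t)))\<^sup>2)" for b s t
  define Q where "Q s = (\<integral>\<^sup>+\<tau>. ennreal ((cmod (dY (dY f) (x + r\<^sup>2 * s, y + 1 * \<tau>)))\<^sup>2) \<partial>lborel)" for s
  have [measurable]: "case_prod (P b) \<in> borel_measurable (borel \<Otimes>\<^sub>M borel)" for b
  proof -
    have [measurable]: "(\<lambda>z. dX f (x + r\<^sup>2 * fst z, y + b * snd z)) \<in> borel_measurable (borel \<Otimes>\<^sub>M borel)"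
      unfolding borel_prod
      by (intro borel_measurable_continuous_onI continuous_on_compose2[OF contX] continuous_intros) auto
    show ?thesis
      unfolding P_def case_prod_beta by measurable
  qed
  have [measurable]: "Q \<in> borel_measurable borel"
    unfolding Q_def by measurable
  have IP: "ennreal (r ^ 3) * (\<integral>\<^sup>+s. \<integral>\<^sup>+t. P b s t \<partial>lborel \<partial>lborel) = nn_sq (dX f)" if "\<bar>b\<bar> = r" for b
  proof -
    have "\<bar>r\<^sup>2\<bar> * \<bar>b\<bar> = r ^ 3"
      using that r by (simp add: power2_eq_square power3_eq_cube)
    then show ?thesis
      unfolding nn_sq_def P_def
      using nn_integral_affine_plane[of "\<lambda>z. ennreal ((cmod (dX f z))\<^sup>2)" "r\<^sup>2" b x y] that r by auto
  qed
  \<comment> \<open>Only \<open>x\<close> is rescaled here, since \<open>\<tau>\<close> already runs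
    over the whole line; the Jacobian is \<open>r^2\<close> instead of the \<open>r ^ 3\<close> of
    \<open>IP\<close>.\<close>
  have IQ: "ennreal (r\<^sup>2) * (\<integral>\<^sup>+s. Q s \<partial>lborel) = nn_sq (dY (dY f))"
    unfolding nn_sq_def Q_def
    using nn_integral_affine_plane[of "\<lambda>z. ennreal ((cmod (dY (dY f) z))\<^sup>2)" "r\<^sup>2" 1 x y] r by simp
  have bX: "ennreal (cmod ((2 * r * s) *\<^sub>R S s t))
      \<le> ennreal (2 * r * c) + ennreal (r / c) * (P r s t + P (- r) s t)" if s: "s \<in> {0..1}" for s t
  proof -
    define v w where "v = cmod (dX f (x + r\<^sup>2 * s, y + r * t))" and "w = cmod (dX f (x + r\<^sup>2 * s, y + (- r) * t))"
    have "cmod ((2 * r * s) *\<^sub>R S s t)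
        = (2 * r * s) * cmod (S s t)"
      using s r by simp
    also have "\<dots> \<le> (2 * r * 1) * (v + w)"
      unfolding S_def v_def w_def using s r by (intro mult_mono norm_triangle_ineq) auto
    also have "\<dots> \<le> (2 * r * 1) * ((c / 2 + v\<^sup>2 / (2 * c)) + (c / 2 + w\<^sup>2 / (2 * c)))"
      using r by (intro mult_left_mono add_mono am_gm_weighted c) auto
    also have "\<dots> = 2 * r * c + r / c * (v\<^sup>2 + w\<^sup>2)"
      using c by (simp add: field_simps)
    finally have "ennreal (cmod ((2 * r * s) *\<^sub>R S s t))
        \<le> ennreal (2 * r * c + r / c * (v\<^sup>2 + w\<^sup>2))"
      by (rule ennreal_leI)
    also have "\<dots> = ennreal (2 * r * c) + ennreal (r / c * (v\<^sup>2 + w\<^sup>2))"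
      by (rule ennreal_plus) (use r c in auto)
    also have "ennreal (r / c * (v\<^sup>2 + w\<^sup>2)) = ennreal (r / c) * ennreal (v\<^sup>2 + w\<^sup>2)"
      by (rule ennreal_mult) (use r c in auto)
    also have "ennreal (v\<^sup>2 + w\<^sup>2) = P r s t + P (- r) s t"
      unfolding P_def v_def w_def by (rule ennreal_plus) auto
    finally show ?thesis .
  qed
  \<comment> \<open>The difference of the two first derivatives is an integral of the second one
    over an interval of half-length \<open>r * t\<close>. The interval is enlarged to half-length
    \<open>r\<close> for the constant part and to the whole line for the square.\<close>
  have bY: "ennreal (cmod (t *\<^sub>R D s t))
      \<le> ennreal (r * c) + ennreal (1 / (2 * c)) * Q s" if t: "t \<in> {0..1}" for s t
  proof -
    define g where "g \<tau> = dY (dY f) (x + r\<^sup>2 * s, y + 1 * \<tau>)" for \<tau>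
    have [measurable]: "g \<in> borel_measurable borel"
      unfolding g_def by measurable
    have "cmod (t *\<^sub>R D s t)
        \<le> cmod (D s t)"
      using t by (simp add: mult_left_le_one_le)
    then have "ennreal (cmod (t *\<^sub>R D s t))
        \<le> ennreal (cmod (D s t))"
      by (rule ennreal_leI)
    also have "\<dots> \<le> (\<integral>\<^sup>+\<tau>. ennreal (cmod (g \<tau>)) * indicator {- (r * t)..r * t} \<tau> \<partial>lborel)"
    proof -
      have "((\<lambda>\<tau>. dY f (x + r\<^sup>2 * s, y + \<tau>)) has_vector_derivative g \<tau>) (at \<tau>)" for \<tau>
      proof -
        have "((\<lambda>\<tau>. y + \<tau>) has_vector_derivative 1) (at \<tau>)"
          by (auto intro!: derivative_eq_intros)
        from has_vector_derivative_path[of "dY f" "\<lambda>_. x + r\<^sup>2 * s" \<tau> "\<lambda>\<tau>. y + \<tau>", OF _ has_vector_derivative_const this]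
        show ?thesis
          using test_functions_differentiable(2)[OF f] by (simp add: g_def)
      qed
      moreover have "continuous_on UNIV g"
        unfolding g_def by (intro continuous_on_compose2[OF contYY] continuous_intros) auto
      ultimately show ?thesis
        using norm_diff_le_nn_integral[of "- (r * t)" "r * t" "\<lambda>\<tau>. dY f (x + r\<^sup>2 * s, y + \<tau>)" g] t r by (simp add: D_def)
    qed
    also have "\<dots> \<le> (\<integral>\<^sup>+\<tau>. ennreal (c / 2) * indicator {- r..r} \<tau> + ennreal (1 / (2 * c)) * ennreal ((cmod (g \<tau>))\<^sup>2) \<partial>lborel)"
    proof (rule nn_integral_mono)
      fix \<tau> :: real
      have "r * t \<le> r" using t r by (simp add: mult_left_le)
      moreover have "ennreal (cmod (g \<tau>)) \<le> ennreal (c / 2) + ennreal (1 / (2 * c)) * ennreal ((cmod (g \<tau>))\<^sup>2)"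
      proof -
        have "ennreal (cmod (g \<tau>)) \<le> ennreal (c / 2 + (cmod (g \<tau>))\<^sup>2 / (2 * c))"
          by (intro ennreal_leI am_gm_weighted c)
        also have "\<dots> = ennreal (c / 2) + ennreal (1 / (2 * c) * (cmod (g \<tau>))\<^sup>2)"
          using c by (subst ennreal_plus[symmetric]) auto
        also have "ennreal (1 / (2 * c) * (cmod (g \<tau>))\<^sup>2) = ennreal (1 / (2 * c)) * ennreal ((cmod (g \<tau>))\<^sup>2)"
          by (rule ennreal_mult) (use c in auto)
        finally show ?thesis .
      qed
      ultimately show "ennreal (cmod (g \<tau>)) * indicator {- (r * t)..r * t} \<tau>
          \<le> ennreal (c / 2) * indicator {- r..r} \<tau> + ennreal (1 / (2 * c)) * ennreal ((cmod (g \<tau>))\<^sup>2)"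
        by (auto simp: indicator_def)
    qed
    also have "\<dots> = ennreal (c / 2) * ennreal (2 * r) + ennreal (1 / (2 * c)) * Q s"
      using r by (simp add: nn_integral_add nn_integral_cmult nn_integral_cmult_indicator Q_def g_def)
    also have "ennreal (c / 2) * ennreal (2 * r) = ennreal (r * c)"
      using r c by (subst ennreal_mult[symmetric]) (auto simp: mult.commute)
    finally show ?thesis .
  qed
  have "(\<integral>\<^sup>+s. \<integral>\<^sup>+t. ennreal (cmod (scaling_deriv f x y s t r)) * indicator {0..1} t * indicator {0..1} s \<partial>lborel \<partial>lborel)
    \<le> (\<integral>\<^sup>+s. \<integral>\<^sup>+t. (ennreal (3 * r * c) * indicator {0..1} s * indicator {0..1} t + ennreal (r / c) * P r s t + ennreal (r / c) * P (- r) s t)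
        + (ennreal (1 / (2 * c)) * Q s) * indicator {0..1} t \<partial>lborel \<partial>lborel)"
  proof (intro nn_integral_mono)
    fix s t :: real
    show "ennreal (cmod (scaling_deriv f x y s t r)) * indicator {0..1} t * indicator {0..1} s
      \<le> (ennreal (3 * r * c) * indicator {0..1} s * indicator {0..1} t + ennreal (r / c) * P r s t + ennreal (r / c) * P (- r) s t)
        + (ennreal (1 / (2 * c)) * Q s) * indicator {0..1} t"
    proof (cases "s \<in> {0..1} \<and> t \<in> {0..1}")
      case True
      define u v where "u = (2 * r * s) *\<^sub>R S s t"
        and "v = t *\<^sub>R D s t"
      have "ennreal (cmod (u + v)) \<le> ennreal (cmod u + cmod v)"
        by (intro ennreal_leI norm_triangle_ineq)
      also have "\<dots> = ennreal (cmod u) + ennreal (cmod v)"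
        by (simp add: ennreal_plus)
      also have "\<dots> \<le> (ennreal (2 * r * c) + ennreal (r / c) * (P r s t + P (- r) s t)) + (ennreal (r * c) + ennreal (1 / (2 * c)) * Q s)"
        unfolding u_def v_def using True by (intro add_mono bX bY) auto
      also have "\<dots> = (ennreal (2 * r * c) + ennreal (r * c)) + ennreal (r / c) * P r s t + ennreal (r / c) * P (- r) s t + ennreal (1 / (2 * c)) * Q s"
        by (simp add: distrib_left add_ac)
      also have "ennreal (2 * r * c) + ennreal (r * c) = ennreal (3 * r * c)"
        using r c by (subst ennreal_plus[symmetric]) (auto simp: algebra_simps)
      finally show ?thesis
        using True by (simp add: u_def v_def split)
    qed (auto simp: indicator_def)
  qed
  also have "\<dots> = ennreal (3 * r * c) + ennreal (r / c) * (\<integral>\<^sup>+s. \<integral>\<^sup>+t. P r s t \<partial>lborel \<partial>lborel)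
      + ennreal (r / c) * (\<integral>\<^sup>+s. \<integral>\<^sup>+t. P (- r) s t \<partial>lborel \<partial>lborel) + ennreal (1 / (2 * c)) * (\<integral>\<^sup>+s. Q s \<partial>lborel)"
    by (simp add: nn_integral_add nn_integral_cmult nn_integral_cmult_indicator)
  also have "\<dots> = ennreal (3 * r * c) + ennreal (1 / (r\<^sup>2 * c)) * (ennreal (r ^ 3) * (\<integral>\<^sup>+s. \<integral>\<^sup>+t. P r s t \<partial>lborel \<partial>lborel))
      + ennreal (1 / (r\<^sup>2 * c)) * (ennreal (r ^ 3) * (\<integral>\<^sup>+s. \<integral>\<^sup>+t. P (- r) s t \<partial>lborel \<partial>lborel))
      + ennreal (1 / (2 * r\<^sup>2 * c)) * (ennreal (r\<^sup>2) * (\<integral>\<^sup>+s. Q s \<partial>lborel))"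
  proof -
    have 1: "r / c = 1 / (r\<^sup>2 * c) * r ^ 3" "1 / (2 * c) = 1 / (2 * r\<^sup>2 * c) * r\<^sup>2"
      using r c by (simp_all add: field_simps power2_eq_square power3_eq_cube)
    have "ennreal (r / c) = ennreal (1 / (r\<^sup>2 * c)) * ennreal (r ^ 3)"
      "ennreal (1 / (2 * c)) = ennreal (1 / (2 * r\<^sup>2 * c)) * ennreal (r\<^sup>2)"
      unfolding 1 using r c by (intro ennreal_mult; simp)+
    then show ?thesis by (simp only: mult.assoc)
  qed
  also have "\<dots> = ennreal (3 * r * c) + (ennreal (1 / (r\<^sup>2 * c)) * nn_sq (dX f) + ennreal (1 / (r\<^sup>2 * c)) * nn_sq (dX f))
      + ennreal (1 / (2 * r\<^sup>2 * c)) * nn_sq (dY (dY f))"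
    using r by (simp add: IP IQ add.assoc)
  also have "ennreal (1 / (r\<^sup>2 * c)) * nn_sq (dX f) + ennreal (1 / (r\<^sup>2 * c)) * nn_sq (dX f) = ennreal (2 / (r\<^sup>2 * c)) * nn_sq (dX f)"
    using r c by (subst distrib_right[symmetric], subst ennreal_plus[symmetric]) (auto simp: mult.commute)
  finally show ?thesis .
qed


lemma nn_integral_inverse_sqrt:
  "(\<integral>\<^sup>+r. ennreal (r powr (- 1 / 2)) * indicator {0..1} r \<partial>lborel) = 2"
proof -
  have "((\<lambda>r. r powr (- 1 / 2)) has_integral (1 powr (- 1 / 2 + 1) / (- 1 / 2 + 1))) {0..1::real}"
    by (rule has_integral_powr_from_0) auto
  from nn_integral_has_integral_lebesgue'[OF _ this] show ?thesis
    by simp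
qed

text \<open>\<open>2 * f (x, y)\<close> is the value at \<open>r = 0\<close> of the symmetrised path
  \<open>p s t\<close>. After averaging over the unit square of \<open>(s, t)\<close>, the endpoint
  \<open>r = 1\<close> contributes \<open>2 * N\<close> and the derivative \<open>11 * N\<close>;
  half of \<open>13\<close> is rounded up to \<open>7\<close>.\<close>

lemma sobolev_test_function:
  assumes f: "f \<in> test_functions" and N: "0 < N"
    and le: "nn_sq f \<le> ennreal (N\<^sup>2)" "nn_sq (dX f) \<le> ennreal (N\<^sup>2)" "nn_sq (dY (dY f)) \<le> ennreal (N\<^sup>2)"
  shows "cmod (f (x, y)) \<le> 7 * N"
proof -
  note cont = test_functions_continuous[OF f]
  have [measurable]: "f \<in> borel_measurable borel"
    using cont by (auto intro: borel_measurable_continuous_onI)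
  define p where "p s t r = f (x + r\<^sup>2 * s, y + r * t) + f (x + r\<^sup>2 * s, y + (- r) * t)" for s t r
  define p' where "p' = scaling_deriv f x y"
  have der: "(p s t has_vector_derivative p' s t r) (at r)" for s t r
  proof -
    have 1: "((\<lambda>r. x + r\<^sup>2 * s) has_vector_derivative 2 * r * s) (at r)"
      "((\<lambda>r. y + r * t) has_vector_derivative t) (at r)" "((\<lambda>r. y + (- r) * t) has_vector_derivative - t) (at r)"
      unfolding has_real_derivative_iff_has_vector_derivative[symmetric] by (auto intro!: derivative_eq_intros)
    from has_vector_derivative_add[OF
        has_vector_derivative_path[of f "\<lambda>r. x + r\<^sup>2 * s" r "\<lambda>r. y + r * t", OF test_functions_differentiable(1)[OF f] 1(1,2)]
        has_vector_derivative_path[of f "\<lambda>r. x + r\<^sup>2 * s" r "\<lambda>r. y + (- r) * t", OF test_functions_differentiable(1)[OF f] 1(1,3)]]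
    show ?thesis
      unfolding p_def[abs_def] p'_def scaling_deriv_def by (simp add: algebra_simps)
  qed
  have cont_p': "continuous_on UNIV (\<lambda>z. p' (fst z) (fst (snd z)) (snd (snd z)))"
    unfolding p'_def scaling_deriv_def
    by (intro continuous_intros continuous_on_compose2[OF cont(2)] continuous_on_compose2[OF cont(3)]) auto
  have meas_p': "(\<lambda>z. ennreal (cmod (p' (fst z) (fst (snd z)) (snd (snd z))))) \<in> borel_measurable (borel \<Otimes>\<^sub>M borel \<Otimes>\<^sub>M borel)"
    unfolding borel_prod using borel_measurable_continuous_onI[OF cont_p'] by measurable
  have [measurable]: "(\<lambda>z. ennreal (cmod (p' (a z) (b z) (c z)))) \<in> borel_measurable M"
    if [measurable]: "a \<in> borel_measurable M" "b \<in> borel_measurable M" "c \<in> borel_measurable M" for a b c and M :: "'z measure"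
    using measurable_compose[of "\<lambda>z. (a z, b z, c z)" M, OF _ meas_p'] by simp
  define A where "A b s t = ennreal ((cmod (f (x + 1 * s, y + b * t)))\<^sup>2)" for b s t
  have [measurable]: "case_prod (A b) \<in> borel_measurable (borel \<Otimes>\<^sub>M borel)" for b
  proof -
    have [measurable]: "(\<lambda>z. f (x + 1 * fst z, y + b * snd z)) \<in> borel_measurable (borel \<Otimes>\<^sub>M borel)"
      unfolding borel_prod
      by (intro borel_measurable_continuous_onI continuous_on_compose2[OF cont(1)] continuous_intros) auto
    show ?thesis
      unfolding A_def case_prod_beta by measurable
  qed
  have IA: "(\<integral>\<^sup>+s. \<integral>\<^sup>+t. A b s t \<partial>lborel \<partial>lborel) = nn_sq f" if "\<bar>b\<bar> = 1" for b
    unfolding nn_sq_def A_def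
    using nn_integral_affine_plane[of "\<lambda>z. ennreal ((cmod (f z))\<^sup>2)" 1 b x y] that by auto
  have p1: "ennreal (cmod (p s t 1)) \<le> ennreal N + ennreal (1 / (2 * N)) * (A 1 s t + A (- 1) s t)" for s t
  proof -
    define v w where "v = cmod (f (x + 1 * s, y + 1 * t))" and "w = cmod (f (x + 1 * s, y + (- 1) * t))"
    have "cmod (p s t 1) \<le> v + w"
      unfolding p_def v_def w_def using norm_triangle_ineq by simp
    also have "\<dots> \<le> (N / 2 + v\<^sup>2 / (2 * N)) + (N / 2 + w\<^sup>2 / (2 * N))"
      by (intro add_mono am_gm_weighted N)
    also have "\<dots> = N + 1 / (2 * N) * (v\<^sup>2 + w\<^sup>2)"
      using N by (simp add: field_simps)
    finally have "ennreal (cmod (p s t 1)) \<le> ennreal (N + 1 / (2 * N) * (v\<^sup>2 + w\<^sup>2))"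
      by (rule ennreal_leI)
    also have "\<dots> = ennreal N + ennreal (1 / (2 * N) * (v\<^sup>2 + w\<^sup>2))"
      by (rule ennreal_plus) (use N in auto)
    also have "ennreal (1 / (2 * N) * (v\<^sup>2 + w\<^sup>2)) = ennreal (1 / (2 * N)) * ennreal (v\<^sup>2 + w\<^sup>2)"
      by (rule ennreal_mult) (use N in auto)
    also have "ennreal (v\<^sup>2 + w\<^sup>2) = A 1 s t + A (- 1) s t"
      unfolding A_def v_def w_def by (rule ennreal_plus) auto
    finally show ?thesis .
  qed
  have path: "ennreal (2 * cmod (f (x, y))) \<le> ennreal N + ennreal (1 / (2 * N)) * (A 1 s t + A (- 1) s t)
      + (\<integral>\<^sup>+r. ennreal (cmod (p' s t r)) * indicator {0..1} r \<partial>lborel)" for s t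
  proof -
    have "continuous_on UNIV (p' s t)"
      using continuous_on_compose2[OF cont_p', of UNIV "\<lambda>r. (s, t, r)"] by (simp add: continuous_on_Pair)
    then have ftc: "ennreal (cmod (p s t 1 - p s t 0)) \<le> (\<integral>\<^sup>+r. ennreal (cmod (p' s t r)) * indicator {0..1} r \<partial>lborel)"
      by (intro norm_diff_le_nn_integral der) auto
    have "p s t 0 = 2 * f (x, y)" by (simp add: p_def)
    then have "2 * cmod (f (x, y)) = cmod (p s t 0)" by (simp add: norm_mult)
    also have "\<dots> \<le> cmod (p s t 1) + cmod (p s t 1 - p s t 0)"
      using norm_triangle_ineq4[of "p s t 1" "p s t 1 - p s t 0"] by simp
    finally have "ennreal (2 * cmod (f (x, y))) \<le> ennreal (cmod (p s t 1) + cmod (p s t 1 - p s t 0))"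
      by (rule ennreal_leI)
    also have "\<dots> = ennreal (cmod (p s t 1)) + ennreal (cmod (p s t 1 - p s t 0))"
      by (rule ennreal_plus) auto
    also have "\<dots> \<le> (ennreal N + ennreal (1 / (2 * N)) * (A 1 s t + A (- 1) s t))
        + (\<integral>\<^sup>+r. ennreal (cmod (p' s t r)) * indicator {0..1} r \<partial>lborel)"
      by (intro add_mono p1 ftc)
    finally show ?thesis .
  qed
  have unit_square: "(\<integral>\<^sup>+s. \<integral>\<^sup>+t. k * indicator {0..1::real} t * indicator {0..1::real} s \<partial>lborel \<partial>lborel) = k" for k :: ennreal
  proof -
    have "(\<integral>\<^sup>+t. k * indicator {0..1::real} t * indicator {0..1::real} s \<partial>lborel) = k * indicator {0..1} s" for s :: real
      by (subst nn_integral_multc) (auto simp: nn_integral_cmult_indicator)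
    then show ?thesis
      by (simp add: nn_integral_cmult_indicator)
  qed
  define J where "J s t = (\<integral>\<^sup>+r. ennreal (cmod (p' s t r)) * indicator {0..1} t * indicator {0..1} s * indicator {0..1} r \<partial>lborel)" for s t
  have [measurable]: "case_prod J \<in> borel_measurable (borel \<Otimes>\<^sub>M borel)"
    unfolding J_def by measurable
  define k1 k2 where "k1 = ennreal N" and "k2 = ennreal (1 / (2 * N))"
  have "ennreal (2 * cmod (f (x, y))) = (\<integral>\<^sup>+s. \<integral>\<^sup>+t. ennreal (2 * cmod (f (x, y))) * indicator {0..1::real} t * indicator {0..1::real} s \<partial>lborel \<partial>lborel)"
    by (rule unit_square[symmetric])
  also have "\<dots> \<le> (\<integral>\<^sup>+s. \<integral>\<^sup>+t. k1 * indicator {0..1} t * indicator {0..1} s + k2 * (A 1 s t + A (- 1) s t) + J s t \<partial>lborel \<partial>lborel)"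
  proof (intro nn_integral_mono)
    fix s t :: real
    show "ennreal (2 * cmod (f (x, y))) * indicator {0..1} t * indicator {0..1} s
        \<le> k1 * indicator {0..1} t * indicator {0..1} s + k2 * (A 1 s t + A (- 1) s t) + J s t"
    proof (cases "s \<in> {0..1} \<and> t \<in> {0..1}")
      case True
      then have "J s t = (\<integral>\<^sup>+r. ennreal (cmod (p' s t r)) * indicator {0..1} r \<partial>lborel)"
        unfolding J_def by simp
      then show ?thesis
        using path[of s t] True by (simp only: k1_def k2_def indicator_simps mult_1_right)
    qed (auto simp: indicator_def)
  qed
  also have "\<dots> = k1 + k2 * ((\<integral>\<^sup>+s. \<integral>\<^sup>+t. A 1 s t \<partial>lborel \<partial>lborel) + (\<integral>\<^sup>+s. \<integral>\<^sup>+t. A (- 1) s t \<partial>lborel \<partial>lborel))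
      + (\<integral>\<^sup>+s. \<integral>\<^sup>+t. J s t \<partial>lborel \<partial>lborel)"
    by (simp add: nn_integral_add nn_integral_cmult unit_square)
  also have "\<dots> = k1 + k2 * (nn_sq f + nn_sq f)
      + (\<integral>\<^sup>+s. \<integral>\<^sup>+t. \<integral>\<^sup>+r. ennreal (cmod (p' s t r)) * indicator {0..1} t * indicator {0..1} s * indicator {0..1} r \<partial>lborel \<partial>lborel \<partial>lborel)"
    unfolding J_def by (simp only: IA abs_one abs_minus_cancel)
  also have "(\<integral>\<^sup>+s. \<integral>\<^sup>+t. \<integral>\<^sup>+r. ennreal (cmod (p' s t r)) * indicator {0..1} t * indicator {0..1} s * indicator {0..1} r \<partial>lborel \<partial>lborel \<partial>lborel)
      = (\<integral>\<^sup>+s. \<integral>\<^sup>+r. \<integral>\<^sup>+t. ennreal (cmod (p' s t r)) * indicator {0..1} t * indicator {0..1} s * indicator {0..1} r \<partial>lborel \<partial>lborel \<partial>lborel)"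
    by (intro nn_integral_cong lborel_pair.Fubini'[symmetric]) measurable
  also have "\<dots> = (\<integral>\<^sup>+r. \<integral>\<^sup>+s. \<integral>\<^sup>+t. ennreal (cmod (p' s t r)) * indicator {0..1} t * indicator {0..1} s * indicator {0..1} r \<partial>lborel \<partial>lborel \<partial>lborel)"
    by (intro lborel_pair.Fubini'[symmetric]) measurable
  also have "\<dots> \<le> (\<integral>\<^sup>+r. ennreal (11 / 2 * N) * (ennreal (r powr (- 1 / 2)) * indicator {0..1} r) \<partial>lborel)"
  proof (rule nn_integral_mono_AE)
    \<comment> \<open>At \<open>r = 0\<close> the right-hand side is \<open>0\<close>, since
      \<open>0 powr a = 0\<close>; this single point is discarded.\<close>
    have "AE r in lborel. r \<noteq> (0::real)"
      by (rule AE_lborel_singleton)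
    then show "AE r in lborel. (\<integral>\<^sup>+s. \<integral>\<^sup>+t. ennreal (cmod (p' s t r)) * indicator {0..1} t * indicator {0..1} s * indicator {0..1} r \<partial>lborel \<partial>lborel)
        \<le> ennreal (11 / 2 * N) * (ennreal (r powr (- 1 / 2)) * indicator {0..1} r)"
    proof eventually_elim
      case (elim r)
      show ?case
      proof (cases "r \<in> {0..1}")
        case True
        then have r: "0 < r" "r \<le> 1" using elim by auto
        \<comment> \<open>This weight balances the terms of \<open>average_derivative_bound\<close>:
          each becomes a multiple of \<open>N * r powr (- 1 / 2)\<close>, with coefficients
          \<open>3\<close>, \<open>2\<close> and \<open>1 / 2\<close> adding up to
          \<open>11 / 2\<close>.\<close>
        define c where "c = N * r powr (- 3 / 2)"
        have c: "0 < c" using N r by (simp add: c_def)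
        have rp: "r * r powr (- 3 / 2) = r powr (- 1 / 2)" "r powr (- 1 / 2) * (r\<^sup>2 * r powr (- 3 / 2)) = 1"
          using r powr_add[of r 1 "- 3 / 2"] powr_add[of r 2 "- 3 / 2"] powr_add[of r "- 1 / 2" "1 / 2"]
          by (simp_all add: powr_numeral)
        have k1: "3 * r * c = 3 * N * r powr (- 1 / 2)"
          using rp(1) by (simp add: c_def)
        have k2: "1 / (r\<^sup>2 * c) * N\<^sup>2 = N * r powr (- 1 / 2)"
          using rp(2) N r by (simp add: c_def field_simps power2_eq_square)
        have "2 / (r\<^sup>2 * c) * N\<^sup>2 = 2 * (1 / (r\<^sup>2 * c) * N\<^sup>2)"
          "1 / (2 * r\<^sup>2 * c) * N\<^sup>2 = (1 / (r\<^sup>2 * c) * N\<^sup>2) / 2"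
          by simp_all
        then have k2': "2 / (r\<^sup>2 * c) * N\<^sup>2 = 2 * N * r powr (- 1 / 2)"
          "1 / (2 * r\<^sup>2 * c) * N\<^sup>2 = N * r powr (- 1 / 2) / 2"
          unfolding k2 by simp_all
        have k3: "ennreal (2 / (r\<^sup>2 * c)) * ennreal (N\<^sup>2) = ennreal (2 * N * r powr (- 1 / 2))"
          unfolding k2'(1)[symmetric] by (rule ennreal_mult[symmetric]) (use c in auto)
        have k4: "ennreal (1 / (2 * r\<^sup>2 * c)) * ennreal (N\<^sup>2) = ennreal (N * r powr (- 1 / 2) / 2)"
          unfolding k2'(2)[symmetric] by (rule ennreal_mult[symmetric]) (use c in auto)
        have "(\<integral>\<^sup>+s. \<integral>\<^sup>+t. ennreal (cmod (p' s t r)) * indicator {0..1} t * indicator {0..1} s \<partial>lborel \<partial>lborel)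
            \<le> ennreal (3 * r * c) + ennreal (2 / (r\<^sup>2 * c)) * nn_sq (dX f) + ennreal (1 / (2 * r\<^sup>2 * c)) * nn_sq (dY (dY f))"
          unfolding p'_def by (rule average_derivative_bound[OF f r c])
        also have "\<dots> \<le> ennreal (3 * r * c) + ennreal (2 / (r\<^sup>2 * c)) * ennreal (N\<^sup>2) + ennreal (1 / (2 * r\<^sup>2 * c)) * ennreal (N\<^sup>2)"
          by (intro add_mono mult_left_mono le) auto
        also have "\<dots> = ennreal (11 / 2 * N * r powr (- 1 / 2))"
          unfolding k1 k3 k4 using N by (simp flip: ennreal_plus)
        also have "\<dots> = ennreal (11 / 2 * N) * ennreal (r powr (- 1 / 2))"
          by (rule ennreal_mult) (use N in auto)
        finally show ?thesis
          using True by simp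
      qed simp
    qed
  qed
  also have "\<dots> = ennreal (11 / 2 * N) * 2"
    by (subst nn_integral_cmult, measurable) (simp only: nn_integral_inverse_sqrt)
  finally have "ennreal (2 * cmod (f (x, y))) \<le> k1 + k2 * (nn_sq f + nn_sq f) + ennreal (11 / 2 * N) * 2"
    by (simp add: add_left_mono)
  also have "\<dots> \<le> ennreal N + ennreal (1 / (2 * N)) * (ennreal (N\<^sup>2) + ennreal (N\<^sup>2)) + ennreal (11 / 2 * N) * ennreal 2"
    unfolding k1_def k2_def by (intro add_mono mult_left_mono le) auto
  also have "\<dots> = ennreal (N + 1 / (2 * N) * (N\<^sup>2 + N\<^sup>2) + 11 / 2 * N * 2)"
  proof -
    have "ennreal (N + 1 / (2 * N) * (N\<^sup>2 + N\<^sup>2) + 11 / 2 * N * 2)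
        = ennreal N + ennreal (1 / (2 * N) * (N\<^sup>2 + N\<^sup>2)) + ennreal (11 / 2 * N * 2)"
      using N by (subst ennreal_plus, simp, simp)+ simp
    also have "ennreal (1 / (2 * N) * (N\<^sup>2 + N\<^sup>2)) = ennreal (1 / (2 * N)) * ennreal (N\<^sup>2 + N\<^sup>2)"
      by (rule ennreal_mult) (use N in auto)
    also have "ennreal (N\<^sup>2 + N\<^sup>2) = ennreal (N\<^sup>2) + ennreal (N\<^sup>2)"
      by (rule ennreal_plus) auto
    also have "ennreal (11 / 2 * N * 2) = ennreal (11 / 2 * N) * ennreal 2"
      by (rule ennreal_mult) (use N in auto)
    finally show ?thesis by (rule sym)
  qed
  also have "N + 1 / (2 * N) * (N\<^sup>2 + N\<^sup>2) + 11 / 2 * N * 2 = 13 * N"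
    using N by (simp add: power2_eq_square field_simps)
  finally have "2 * cmod (f (x, y)) \<le> 13 * N"
    using N by (subst (asm) ennreal_le_iff) auto
  then show ?thesis using N by simp
qed

lemma AE_norm_val_le: "AE z in lborel. cmod (val u z) \<le> 7 * norm u"
proof -
  obtain U where U: "\<And>n. U n \<in> test_graph" "U \<longlonglongrightarrow> H12_triple u"
    using H12_triple[of u] by (auto simp: closure_sequential)
  \<comment> \<open>The added \<open>1 / real (Suc n)\<close> makes \<open>N n\<close> positive, as
    \<open>sobolev_test_function\<close> requires, and vanishes in the limit.\<close>
  define N where "N n = norm (fst (snd (U n))) + norm (snd (snd (U n))) + norm (fst (U n)) + 1 / real (Suc n)" for n
  have bd: "AE z in lborel. cmod (rep_L2 (fst (U n)) z) \<le> 7 * N n" for n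
  proof -
    obtain f where f: "f \<in> test_functions" and Un: "U n = (abs_L2 f, abs_L2 (dX f), abs_L2 (dY (dY f)))"
      using U(1)[of n] by (auto simp: test_graph_def)
    note s = test_functions_square_integrable[OF f]
    have N: "0 < N n"
      unfolding N_def by (intro add_nonneg_pos add_nonneg_nonneg) auto
    have "nn_sq f \<le> ennreal ((N n)\<^sup>2)" "nn_sq (dX f) \<le> ennreal ((N n)\<^sup>2)" "nn_sq (dY (dY f)) \<le> ennreal ((N n)\<^sup>2)"
      unfolding nn_sq_def nn_integral_norm_abs_L2[OF s(1)] nn_integral_norm_abs_L2[OF s(2)] nn_integral_norm_abs_L2[OF s(3)]
      by (intro ennreal_leI power_mono; simp add: N_def Un)+
    from sobolev_test_function[OF f N this]
    have "cmod (f z) \<le> 7 * N n" for z by (cases z) auto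
    then show ?thesis
      using AE_rep_abs_L2[OF s(1)] by (auto simp: Un)
  qed
  have c: "(\<lambda>n. 7 * N n) \<longlonglongrightarrow> 7 * (norm (H12_dx u) + norm (H12_dyy u) + norm (H12_L2 u) + 0)"
    unfolding N_def H12_defs
    by (intro tendsto_intros U(2) LIMSEQ_Suc[OF lim_1_over_n])
  have "(\<lambda>n. fst (U n)) \<longlonglongrightarrow> H12_L2 u"
    unfolding H12_defs by (intro tendsto_intros U(2))
  from AE_norm_rep_L2_le_limit[OF this c bd] show ?thesis
    by (simp add: val_def norm_H12_def)
qed

section \<open>Integration by parts\<close>

lemma test_functions_vanish:
  assumes "f \<in> test_functions"
  obtains K where "compact K" "closed K" "\<And>z. z \<notin> K \<Longrightarrow> f z = 0"
proof (rule that[of "closure {z. f z \<noteq> 0}"])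
  show "compact (closure {z. f z \<noteq> 0})"
    using assms by (simp add: test_functions_def)
  show "f z = 0" if "z \<notin> closure {z. f z \<noteq> 0}" for z
    using that closure_subset[of "{z. f z \<noteq> 0}"] by auto
qed simp

lemma test_functions_dX: "f \<in> test_functions \<Longrightarrow> dX f \<in> test_functions"
  and test_functions_dY: "f \<in> test_functions \<Longrightarrow> dY f \<in> test_functions"
proof -
  assume f: "f \<in> test_functions"
  obtain K where K: "compact K" "closed K" "\<And>z. z \<notin> K \<Longrightarrow> f z = 0"
    using test_functions_vanish[OF f] by blast
  have "Ck k (dX f)" "Ck k (dY f)" for k
    using test_functions_Ck[OF f, of "Suc k"] Ck.simps(2)[of k f] by blast+
  moreover have "compact (closure {z. dX f z \<noteq> 0})"
  proof -
    have "{z. dX f z \<noteq> 0} \<subseteq> K"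
      using dX_outside[OF K(2), of f] K(3) by blast
    then show ?thesis
      using K(1,2) closure_minimal compact_Int_closed[OF K(1) closed_closure]
      by (metis closed_closure inf.absorb2)
  qed
  moreover have "compact (closure {z. dY f z \<noteq> 0})"
  proof -
    have "{z. dY f z \<noteq> 0} \<subseteq> K"
      using dY_outside[OF K(2), of f] K(3) by blast
    then show ?thesis
      using K(1,2) closure_minimal compact_Int_closed[OF K(1) closed_closure]
      by (metis closed_closure inf.absorb2)
  qed
  ultimately show "dX f \<in> test_functions" "dY f \<in> test_functions"
    by (simp_all add: test_functions_def)
qed

lemma integral_line_derivative_zero:
  fixes F F' :: "real \<Rightarrow> real"
  assumes der: "\<And>x. (F has_real_derivative F' x) (at x)" and cont: "continuous_on UNIV F'"
    and van: "\<And>x. R \<le> \<bar>x\<bar> \<Longrightarrow> F x = 0 \<and> F' x = 0" and R: "0 \<le> R"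
  shows "(LINT x|lborel. F' x) = 0"
proof -
  have "(LINT x|lborel. F' x) = (LINT x|lborel. indicator {- R..R} x *\<^sub>R F' x)"
  proof (rule Bochner_Integration.integral_cong)
    fix x
    have "x \<in> {- R..R} \<or> R \<le> \<bar>x\<bar>" by (simp, linarith)
    then show "F' x = indicator {- R..R} x *\<^sub>R F' x"
      using van[of x] by auto
  qed simp
  also have "\<dots> = F R - F (- R)"
  proof (rule integral_FTC_Icc)
    show "(F has_vector_derivative F' x) (at x within {- R..R})" for x
      using der[of x] by (simp add: has_real_derivative_iff_has_vector_derivative has_vector_derivative_at_within)
  qed (use R in \<open>auto intro: continuous_on_subset[OF cont]\<close>)
  also have "\<dots> = 0" using van[of R] van[of "- R"] R by simp
  finally show ?thesis .
qed

lemma integrable_compact_support: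
  fixes h :: "real \<times> real \<Rightarrow> real"
  assumes "continuous_on UNIV h" "compact K" "\<And>z. z \<notin> K \<Longrightarrow> h z = 0"
  shows "integrable lborel h"
proof -
  have "integrable lborel (\<lambda>z. indicator K z *\<^sub>R h z)"
    by (rule borel_integrable_compact) (use assms in \<open>auto intro: continuous_on_subset\<close>)
  also have "(\<lambda>z. indicator K z *\<^sub>R h z) = h"
    using assms(3) by (auto simp: indicator_def fun_eq_iff)
  finally show ?thesis .
qed

text \<open>The derivative of \<open>f z \<bullet> g z\<close> integrates to zero along every line
  in the direction of differentiation, because the support is bounded; Fubini's theorem does the
  rest.\<close>

lemma test_functions_parts:
  assumes f: "f \<in> test_functions" and g: "g \<in> test_functions"
  shows "abs_L2 (dX f) \<bullet> abs_L2 g = - (abs_L2 f \<bullet> abs_L2 (dX g))" (is ?X)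
    and "abs_L2 (dY f) \<bullet> abs_L2 g = - (abs_L2 f \<bullet> abs_L2 (dY g))" (is ?Y)
proof -
  note df = test_functions_differentiable(1)[OF f] and dg = test_functions_differentiable(1)[OF g]
  note cf = test_functions_continuous[OF f] and cg = test_functions_continuous[OF g]
  note s = test_functions_square_integrable(1)
  obtain K where K: "compact K" "closed K" "\<And>z. z \<notin> K \<Longrightarrow> f z = 0"
    using test_functions_vanish[OF f] by blast
  have vX: "dX f z = 0" and vY: "dY f z = 0" if "z \<notin> K" for z
    using dX_outside[OF K(2), of f] dY_outside[OF K(2), of f] K(3) that by blast+
  obtain R0 where R0: "\<And>z. z \<in> K \<Longrightarrow> norm z \<le> R0"
    using compact_imp_bounded[OF K(1)] by (auto simp: bounded_iff)
  define R where "R = \<bar>R0\<bar> + 1"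
  have far: "(x, y) \<notin> K" if "R \<le> \<bar>x\<bar> \<or> R \<le> \<bar>y\<bar>" for x y
  proof
    assume "(x, y) \<in> K"
    then have "norm (x, y) \<le> R0" by (rule R0)
    moreover have "\<bar>x\<bar> \<le> norm (x, y)" "\<bar>y\<bar> \<le> norm (x, y)"
      using norm_fst_le[of x y] norm_snd_le[of y x] by simp_all
    ultimately show False using that by (auto simp: R_def)
  qed
  have R: "0 \<le> R" by (simp add: R_def)
  define F where "F z = f z \<bullet> g z" for z
  define FX where "FX z = dX f z \<bullet> g z + f z \<bullet> dX g z" for z
  define FY where "FY z = dY f z \<bullet> g z + f z \<bullet> dY g z" for z
  have cont: "continuous_on UNIV FX" "continuous_on UNIV FY"
    unfolding FX_def FY_def by (intro continuous_intros cf cg)+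
  have van: "F z = 0" "FX z = 0" "FY z = 0" if "z \<notin> K" for z
    using K(3)[OF that] vX[OF that] vY[OF that] by (simp_all add: F_def FX_def FY_def)
  have int: "integrable (lborel \<Otimes>\<^sub>M lborel) FX" "integrable (lborel \<Otimes>\<^sub>M lborel) FY"
    unfolding lborel_prod using integrable_compact_support[OF _ K(1)] cont van by blast+
  have "(LINT x|lborel. FX (x, y)) = 0" for y
  proof (rule integral_line_derivative_zero[OF _ _ _ R])
    show "((\<lambda>x. F (x, y)) has_real_derivative FX (x, y)) (at x)" for x
      unfolding F_def FX_def has_real_derivative_iff_has_vector_derivative
      using bounded_bilinear.has_vector_derivative[OF bounded_bilinear_inner has_dX[OF df] has_dX[OF dg]]
      by (simp add: add.commute)
    show "continuous_on UNIV (\<lambda>x. FX (x, y))"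
      by (intro continuous_on_compose2[OF cont(1)] continuous_intros) auto
    show "R \<le> \<bar>x\<bar> \<Longrightarrow> F (x, y) = 0 \<and> FX (x, y) = 0" for x
      using van far by blast
  qed
  then have "integral\<^sup>L (lborel \<Otimes>\<^sub>M lborel) FX = 0"
    using lborel_pair.integral_snd[of "\<lambda>x y. FX (x, y)"] int(1) by simp
  then have X0: "(LINT z|lborel. FX z) = 0"
    by (simp add: lborel_prod)
  have "(LINT y|lborel. FY (x, y)) = 0" for x
  proof (rule integral_line_derivative_zero[OF _ _ _ R])
    show "((\<lambda>y. F (x, y)) has_real_derivative FY (x, y)) (at y)" for y
      unfolding F_def FY_def has_real_derivative_iff_has_vector_derivative
      using bounded_bilinear.has_vector_derivative[OF bounded_bilinear_inner has_dY[OF df] has_dY[OF dg]]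
      by (simp add: add.commute)
    show "continuous_on UNIV (\<lambda>y. FY (x, y))"
      by (intro continuous_on_compose2[OF cont(2)] continuous_intros) auto
    show "R \<le> \<bar>y\<bar> \<Longrightarrow> F (x, y) = 0 \<and> FY (x, y) = 0" for y
      using van far by blast
  qed
  then have "integral\<^sup>L (lborel \<Otimes>\<^sub>M lborel) FY = 0"
    using lborel_pair.integral_fst'[of FY] int(2) by simp
  then have Y0: "(LINT z|lborel. FY z) = 0"
    by (simp add: lborel_prod)
  have sq: "square_integrable f" "square_integrable g" "square_integrable (dX f)" "square_integrable (dY f)"
    "square_integrable (dX g)" "square_integrable (dY g)"
    using s f g test_functions_dX test_functions_dY by blast+
  show ?X
    using X0 sq unfolding FX_def by (simp add: inner_abs_L2 square_integrable_inner)
  show ?Y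
    using Y0 sq unfolding FY_def by (simp add: inner_abs_L2 square_integrable_inner)
qed

text \<open>A limit \<open>v\<close> of \<open>\<partial>\<^sub>x f n\<close> with \<open>f n \<longlonglongrightarrow> 0\<close> is orthogonal to every \<open>\<partial>\<^sub>x f m\<close> after an integration by
  parts, hence to itself; likewise for \<open>\<partial>\<^sub>y\<^sub>y\<close>.\<close>

lemma H12_L2_eq_0D:
  assumes "H12_L2 u = 0"
  shows "u = 0"
proof -
  obtain U where U: "\<And>n. U n \<in> test_graph" "U \<longlonglongrightarrow> H12_triple u"
    using H12_triple[of u] by (auto simp: closure_sequential)
  have "\<exists>f. f \<in> test_functions \<and> U n = (abs_L2 f, abs_L2 (dX f), abs_L2 (dY (dY f)))" for n
    using U(1)[of n] by (auto simp: test_graph_def)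
  then obtain f where f: "\<And>n. f n \<in> test_functions"
    and Uf: "\<And>n. U n = (abs_L2 (f n), abs_L2 (dX (f n)), abs_L2 (dY (dY (f n))))"
    by metis
  have lim0: "(\<lambda>n. abs_L2 (f n)) \<longlonglongrightarrow> 0"
    using tendsto_fst[OF U(2)] assms by (simp add: Uf H12_defs)
  have limX: "(\<lambda>n. abs_L2 (dX (f n))) \<longlonglongrightarrow> H12_dx u"
    using tendsto_fst[OF tendsto_snd[OF U(2)]] by (simp add: Uf H12_defs)
  have limY: "(\<lambda>n. abs_L2 (dY (dY (f n)))) \<longlonglongrightarrow> H12_dyy u"
    using tendsto_snd[OF tendsto_snd[OF U(2)]] by (simp add: Uf H12_defs)
  \<comment> \<open>The absolute values absorb the sign: moving \<open>dX\<close> across takes one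
    integration by parts, moving \<open>dY\<close> twice takes two.\<close>
  have *: "v = 0" if lim: "(\<lambda>n. abs_L2 (D (f n))) \<longlonglongrightarrow> v"
    and D: "\<And>m n. \<bar>abs_L2 (D (f n)) \<bullet> abs_L2 (D (f m))\<bar> = \<bar>abs_L2 (f n) \<bullet> w m\<bar>" for v D w
  proof -
    have "v \<bullet> abs_L2 (D (f m)) = 0" for m
    proof -
      have "(\<lambda>n. \<bar>abs_L2 (f n) \<bullet> w m\<bar>) \<longlonglongrightarrow> \<bar>0 \<bullet> w m\<bar>"
        by (intro tendsto_intros lim0)
      moreover have "(\<lambda>n. \<bar>abs_L2 (D (f n)) \<bullet> abs_L2 (D (f m))\<bar>) \<longlonglongrightarrow> \<bar>v \<bullet> abs_L2 (D (f m))\<bar>"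
        by (intro tendsto_intros lim)
      ultimately show ?thesis
        using LIMSEQ_unique by (fastforce simp: D)
    qed
    moreover have "(\<lambda>m. v \<bullet> abs_L2 (D (f m))) \<longlonglongrightarrow> v \<bullet> v"
      by (intro tendsto_intros lim)
    ultimately show ?thesis
      by (simp add: LIMSEQ_const_iff)
  qed
  have "H12_dx u = 0"
    by (rule *[where w = "\<lambda>m. abs_L2 (dX (dX (f m)))", OF limX])
      (simp add: test_functions_parts(1)[OF f test_functions_dX[OF f]])
  moreover have "H12_dyy u = 0"
    by (rule *[where D = "\<lambda>f. dY (dY f)" and w = "\<lambda>m. abs_L2 (dY (dY (dY (dY (f m)))))", OF limY])
      (simp add: test_functions_parts(2)[OF test_functions_dY[OF f]] test_functions_parts(2)[OF f]
        test_functions_dY f)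
  ultimately show ?thesis
    using assms by (intro H12_eqI) (simp_all add: H12_defs zero_H12.rep_eq)
qed

section \<open>The equation as an evolution equation in the dual\<close>

lemma H12_components_linear [simp]:
  "H12_L2 (u + v) = H12_L2 u + H12_L2 v" "H12_L2 (u - v) = H12_L2 u - H12_L2 v" "H12_L2 (r *\<^sub>R u) = r *\<^sub>R H12_L2 u"
  "H12_dx (u + v) = H12_dx u + H12_dx v" "H12_dx (u - v) = H12_dx u - H12_dx v" "H12_dx (r *\<^sub>R u) = r *\<^sub>R H12_dx u"
  "H12_dyy (u + v) = H12_dyy u + H12_dyy v" "H12_dyy (u - v) = H12_dyy u - H12_dyy v" "H12_dyy (r *\<^sub>R u) = r *\<^sub>R H12_dyy u"
  using bounded_linear.linear[OF bounded_linear_H12_L2] bounded_linear.linear[OF bounded_linear_H12_dx]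
    bounded_linear.linear[OF bounded_linear_H12_dyy]
  by (simp_all add: linear_add linear_diff linear_scale)

section \<open>The truncated problem as an instance of the abstract evolution\<close>

definition H12_form :: "H12 \<Rightarrow> H12 \<Rightarrow> real" where
  "H12_form u v = H12_dx u \<bullet> H12_dx v + H12_dyy u \<bullet> H12_dyy v"

lemma H12_form_self: "H12_form u u = (norm (H12_dx u))\<^sup>2 + (norm (H12_dyy u))\<^sup>2"
  by (simp add: H12_form_def power2_norm_eq_inner)

lemma bounded_bilinear_H12_form: "bounded_bilinear H12_form"
proof
  have "norm (H12_form u v) \<le> norm u * norm v * 2" for u v
  proof -
    have "norm (H12_form u v) \<le> \<bar>H12_dx u \<bullet> H12_dx v\<bar> + \<bar>H12_dyy u \<bullet> H12_dyy v\<bar>"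
      unfolding H12_form_def by (simp add: abs_triangle_ineq)
    also have "\<dots> \<le> norm (H12_dx u) * norm (H12_dx v) + norm (H12_dyy u) * norm (H12_dyy v)"
      by (intro add_mono Cauchy_Schwarz_ineq2)
    also have "\<dots> \<le> norm u * norm v + norm u * norm v"
      by (intro add_mono mult_mono norm_H12_components) auto
    finally show ?thesis by simp
  qed
  then show "\<exists>K. \<forall>u v. norm (H12_form u v) \<le> norm u * norm v * K"
    by blast
qed (simp_all add: H12_form_def inner_add_left inner_add_right algebra_simps)

lemma norm_H12_sq_le: "(norm u)\<^sup>2 \<le> 3 * ((norm (H12_L2 u))\<^sup>2 + H12_form u u)"
proof -
  have *: "(a + b + c)\<^sup>2 \<le> 3 * (c\<^sup>2 + (a\<^sup>2 + b\<^sup>2))" for a b c :: real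
    using sum_squares_ge_zero[of "a - b" "b - c"] zero_le_square[of "a - c"]
    by (simp add: power2_eq_square algebra_simps)
  show ?thesis
    unfolding norm_H12_def H12_form_self by (rule *)
qed

lemma H12_form_le_norm_sq: "H12_form u u + (norm (H12_L2 u))\<^sup>2 \<le> (norm u)\<^sup>2"
proof -
  have *: "a\<^sup>2 + b\<^sup>2 + c\<^sup>2 \<le> (a + b + c)\<^sup>2" if "0 \<le> a" "0 \<le> b" "0 \<le> c" for a b c :: real
    using that by (simp add: power2_eq_square algebra_simps)
  show ?thesis
    unfolding norm_H12_def H12_form_self by (rule *) auto
qed

definition trunc_op :: "real \<Rightarrow> real \<Rightarrow> L2 \<Rightarrow> L2" where
  "trunc_op p K = lipschitz_gradient.nem (trunc_power p K)"

definition trunc_pot :: "real \<Rightarrow> real \<Rightarrow> L2 \<Rightarrow> real" where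
  "trunc_pot p K = lipschitz_gradient.pot (trunc_potential p K)"

text \<open>The constant \<open>3\<close> relates the square of a sum of three norms to the sum of
  their squares, as in \<open>norm_H12_sq_le\<close>.\<close>

lemma truncated_schroedinger_form:
  assumes "2 < p" "0 < K"
  shows "schroedinger_form H12_L2 H12_form 3 (cscale_L2 \<i>) (cscale_H12 \<i>) (trunc_op p K) (trunc_pot p K)
    ((p - 1) * K powr (p - 2))"
proof -
  interpret lg: lipschitz_gradient "trunc_power p K" "trunc_potential p K" "(p - 1) * K powr (p - 2)"
    by (rule lipschitz_gradient_trunc[OF assms])
  have "hilbert_form H12_L2 H12_form 3"
  proof (intro hilbert_form.intro bounded_linear_H12_L2 bounded_bilinear_H12_form)
    show "H12_form u v = H12_form v u" for u v by (simp add: H12_form_def inner_commute)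
    show "0 \<le> H12_form u u" for u by (simp add: H12_form_self)
    show "(norm u)\<^sup>2 \<le> 3 * ((norm (H12_L2 u))\<^sup>2 + H12_form u u)" for u
      by (rule norm_H12_sq_le)
  qed (auto intro: H12_L2_eq_0D)
  then show ?thesis
  proof (intro schroedinger_form.intro schroedinger_form_axioms.intro)
    show "cscale_L2 \<i> (cscale_L2 \<i> X) = - X" for X
      by (simp add: cscale_L2_comp cscale_L2_minus1)
    show "H12_form (cscale_H12 \<i> u) (cscale_H12 \<i> v) = H12_form u v" for u v
      by (simp add: H12_form_def inner_cscale_ii)
    show "trunc_op p K X \<bullet> cscale_L2 \<i> X = 0" for X
      unfolding trunc_op_def by (rule lg.nem_inner_ii[OF trunc_power_ii])
  qed (simp_all add: bounded_linear_cscale_L2 inner_cscale_ii trunc_op_def trunc_pot_def lg.nem_lipschitz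
      lg.nem_0 lg.pot_0 lg.pot_gradient lg.L_pos)
qed

lemma AE_rep_trunc_op:
  assumes "2 < p" and K: "AE z in lborel. cmod (rep_L2 X z) \<le> K" "0 < K"
  shows "AE z in lborel. rep_L2 (trunc_op p K X) z = of_real (cmod (rep_L2 X z) powr (p - 2)) * rep_L2 X z"
proof -
  interpret lg: lipschitz_gradient "trunc_power p K" "trunc_potential p K" "(p - 1) * K powr (p - 2)"
    by (rule lipschitz_gradient_trunc[OF assms(1) K(2)])
  show ?thesis
    unfolding trunc_op_def using lg.AE_rep_nem[of X] K(1) by eventually_elim (simp add: trunc_power_eq)
qed

lemma trunc_pot_eq:
  assumes "2 < p" and K: "AE z in lborel. cmod (rep_L2 X z) \<le> K" "0 < K"
  shows "trunc_pot p K X = 1 / p * (LINT z|lborel. cmod (rep_L2 X z) powr p)"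
proof -
  interpret lg: lipschitz_gradient "trunc_power p K" "trunc_potential p K" "(p - 1) * K powr (p - 2)"
    by (rule lipschitz_gradient_trunc[OF assms(1) K(2)])
  have "lg.pot X = (LINT z|lborel. 1 / p * cmod (rep_L2 X z) powr p)"
    unfolding lg.pot_def
  proof (rule integral_cong_AE)
    show "AE z in lborel. trunc_potential p K (rep_L2 X z) = 1 / p * cmod (rep_L2 X z) powr p"
      using K(1) by eventually_elim (simp add: trunc_potential_eq assms(1))
  qed measurable
  then show ?thesis
    by (simp add: trunc_pot_def)
qed

text \<open>Below the truncation level the energy conserved by the abstract evolution is that of the
  original equation.\<close>

lemma energy_eq_trunc:
  assumes "2 < p" and K: "AE z in lborel. cmod (val u z) \<le> K" "0 < K"
  shows "energy p u = H12_form u u / 2 - trunc_pot p K (H12_L2 u)"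
  using trunc_pot_eq[OF assms(1) K[unfolded val_def]]
  by (simp add: energy_def H12_form_self val_def val_dx_def val_dyy_def norm_L2_rep add_divide_distrib)

lemma mass_eq_norm: "mass u = (norm (H12_L2 u))\<^sup>2"
  by (simp add: mass_def val_def norm_L2_rep)

lift_definition pair_dual :: "L2 \<Rightarrow> (H12 \<Rightarrow>\<^sub>L complex)" is "\<lambda>X v. L2_pair X (H12_L2 v)"
  by (rule bounded_linear_compose[OF bounded_bilinear.bounded_linear_right[OF bounded_bilinear_L2_pair] bounded_linear_H12_L2])

text \<open>\<open>Blinfun\<close> is meaningful only on bounded linear functions. The integral is
  recognised, for each \<open>v\<close>, as an application of \<open>pair_dual\<close>, which brings
  boundedness and linearity along.\<close>

lemma nonlinearity_dual_eq:
  assumes "2 < p" and K: "AE z in lborel. cmod (val u z) \<le> K" "0 < K"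
  shows "nonlinearity_dual p u = pair_dual (trunc_op p K (H12_L2 u))"
proof -
  have eq: "(LINT z|lborel. (of_real (cmod (val u z) powr (p - 2)) * val u z) * val v z)
      = blinfun_apply (pair_dual (trunc_op p K (H12_L2 u))) v" for v
  proof -
    have "blinfun_apply (pair_dual (trunc_op p K (H12_L2 u))) v
        = (LINT z|lborel. rep_L2 (trunc_op p K (H12_L2 u)) z * val v z)"
      by (simp add: pair_dual.rep_eq L2_pair_rep val_def)
    also have "\<dots> = (LINT z|lborel. (of_real (cmod (val u z) powr (p - 2)) * val u z) * val v z)"
    proof (rule integral_cong_AE)
      show "AE z in lborel. rep_L2 (trunc_op p K (H12_L2 u)) z * val v z
          = (of_real (cmod (val u z) powr (p - 2)) * val u z) * val v z"
        using AE_rep_trunc_op[OF assms(1) K[unfolded val_def]] by eventually_elim (simp add: val_def)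
    qed (unfold val_def, measurable)
    finally show ?thesis by simp
  qed
  show ?thesis
    unfolding nonlinearity_dual_def eq by (rule blinfun_apply_inverse)
qed

section \<open>The equation solved for the time derivative in the dual space\<close>

definition rhs :: "real \<Rightarrow> H12 \<Rightarrow> (H12 \<Rightarrow>\<^sub>L complex)" where
  "rhs p u = cscale_dual \<i> (dxx_dual u - dyyyy_dual u + nonlinearity_dual p u)"

lemma cscale_dual_apply [simp]: "blinfun_apply (cscale_dual c F) v = c * blinfun_apply F v"
  by (simp add: cscale_dual.rep_eq)

lemma equation_iff_rhs:
  "cscale_dual \<i> F + dxx_dual u - dyyyy_dual u + nonlinearity_dual p u = 0 \<longleftrightarrow> F = rhs p u"
proof -
  have "cscale_dual \<i> F + dxx_dual u - dyyyy_dual u + nonlinearity_dual p u = 0 \<longleftrightarrow>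
      (\<forall>v. \<i> * blinfun_apply F v + blinfun_apply (dxx_dual u - dyyyy_dual u + nonlinearity_dual p u) v = 0)"
    by (auto simp: blinfun_apply_inject[symmetric] fun_eq_iff blinfun.add_left blinfun.diff_left algebra_simps)
  also have "\<dots> \<longleftrightarrow> (\<forall>v. blinfun_apply F v = \<i> * blinfun_apply (dxx_dual u - dyyyy_dual u + nonlinearity_dual p u) v)"
  proof -
    have "\<i> * z + w = 0 \<longleftrightarrow> z = \<i> * w" for z w :: complex
      by (auto simp: complex_eq_iff)
    then show ?thesis by simp
  qed
  finally show ?thesis
    by (auto simp: rhs_def blinfun_apply_inject[symmetric] fun_eq_iff)
qed

lemma rhs_apply:
  assumes "2 < p" and K: "AE z in lborel. cmod (val u z) \<le> K" "0 < K"
  shows "blinfun_apply (rhs p u) v = \<i> * (- L2_pair (H12_dx u) (H12_dx v) - L2_pair (H12_dyy u) (H12_dyy v)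
    + L2_pair (trunc_op p K (H12_L2 u)) (H12_L2 v))"
  by (simp add: rhs_def nonlinearity_dual_eq[OF assms] blinfun.add_left blinfun.diff_left dxx_dual.rep_eq
      dyyyy_dual.rep_eq pair_dual.rep_eq)

text \<open>The \<open>+ 1\<close> lets the bound serve as a truncation level, which has to be
  positive, even for \<open>M = 0\<close>.\<close>

lemma val_bound:
  assumes "norm u \<le> M"
  shows "AE z in lborel. cmod (val u z) \<le> 7 * M + 1" 
proof -
  have "7 * norm u \<le> 7 * M + 1" using assms by simp
  with AE_norm_val_le[of u] show ?thesis
    by (auto elim: order_trans)
qed

lemma rhs_in_dual:
  assumes "2 < p"
  shows "rhs p u \<in> H12_dual"
proof -
  have K: "0 < 7 * norm u + 1"
    using norm_ge_zero[of u] by linarith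
  show ?thesis
    by (simp add: H12_dual_def rhs_apply[OF assms val_bound[OF order.refl] K] L2_pair_cscale_right algebra_simps)
qed

lemma norm_pair_dual_le:
  obtains C where "\<And>X. norm (pair_dual X) \<le> C * norm X" "0 \<le> C"
proof -
  interpret pair: bounded_bilinear L2_pair by (rule bounded_bilinear_L2_pair)
  obtain C where C: "0 \<le> C" "\<And>X Y. norm (L2_pair X Y) \<le> norm X * norm Y * C"
    using pair.nonneg_bounded by blast
  have "norm (pair_dual X) \<le> C * norm X" for X
  proof (rule norm_blinfun_bound)
    show "norm (blinfun_apply (pair_dual X) v) \<le> C * norm X * norm v" for v
    proof -
      have "norm (L2_pair X (H12_L2 v)) \<le> norm X * norm (H12_L2 v) * C" by (rule C)
      also have "\<dots> \<le> norm X * norm v * C"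
        using C(1) by (intro mult_right_mono mult_left_mono norm_H12_components) auto
      finally show ?thesis by (simp add: pair_dual.rep_eq mult_ac)
    qed
  qed (use C in auto)
  then show ?thesis using that C(1) by blast
qed

text \<open>On a ball one truncation level serves all elements, and there the truncated nonlinearity
  is Lipschitz in L2. The continuity of \<open>rhs\<close> deduced from this gives the continuity of
  the time derivative.\<close>

lemma norm_rhs_diff_le:
  assumes "2 < p"
  shows "\<exists>C. \<forall>u v. norm u \<le> M \<longrightarrow> norm v \<le> M \<longrightarrow> norm (rhs p u - rhs p v) \<le> C * norm (u - v)"
proof -
  interpret pair: bounded_bilinear L2_pair by (rule bounded_bilinear_L2_pair)
  define K where "K = \<bar>7 * M\<bar> + 1"
  have K: "0 < K" by (simp add: K_def)
  interpret nls: schroedinger_form H12_L2 H12_form 3 "cscale_L2 \<i>" "cscale_H12 \<i>" "trunc_op p K" "trunc_pot p K"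
    "(p - 1) * K powr (p - 2)"
    by (rule truncated_schroedinger_form[OF assms K])
  define L where "L = (p - 1) * K powr (p - 2)"
  obtain C where C: "0 \<le> C" "\<And>X Y. norm (L2_pair X Y) \<le> norm X * norm Y * C"
    using pair.nonneg_bounded by blast
  have "norm (rhs p u - rhs p v) \<le> (2 * C + L * C) * norm (u - v)" if u: "norm u \<le> M" and v: "norm v \<le> M" for u v
  proof (rule norm_blinfun_bound)
    show "0 \<le> (2 * C + L * C) * norm (u - v)"
      using C(1) nls.L_pos by (simp add: L_def)
    fix w
    define d where "d = u - v"
    define g where "g = trunc_op p K (H12_L2 u) - trunc_op p K (H12_L2 v)"
    have b: "AE z in lborel. cmod (val u z) \<le> K" "AE z in lborel. cmod (val v z) \<le> K"
      using val_bound[OF u] val_bound[OF v] by (auto simp: K_def)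
    have "blinfun_apply (rhs p u - rhs p v) w = \<i> * (- L2_pair (H12_dx d) (H12_dx w) - L2_pair (H12_dyy d) (H12_dyy w)
        + L2_pair g (H12_L2 w))"
      by (simp add: blinfun.diff_left rhs_apply[OF assms b(1) K] rhs_apply[OF assms b(2) K] d_def g_def
          pair.diff_left algebra_simps)
    then have "norm (blinfun_apply (rhs p u - rhs p v) w)
        \<le> norm (L2_pair (H12_dx d) (H12_dx w)) + norm (L2_pair (H12_dyy d) (H12_dyy w)) + norm (L2_pair g (H12_L2 w))"
      using norm_triangle_ineq[of "- L2_pair (H12_dx d) (H12_dx w) - L2_pair (H12_dyy d) (H12_dyy w)" "L2_pair g (H12_L2 w)"]
        norm_triangle_ineq4[of "- L2_pair (H12_dx d) (H12_dx w)" "L2_pair (H12_dyy d) (H12_dyy w)"]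
      by (simp add: norm_mult)
    also have "\<dots> \<le> norm d * norm w * C + norm d * norm w * C + (L * norm d) * norm w * C"
    proof (intro add_mono)
      show "norm (L2_pair (H12_dx d) (H12_dx w)) \<le> norm d * norm w * C"
        "norm (L2_pair (H12_dyy d) (H12_dyy w)) \<le> norm d * norm w * C"
        using C(1) by (auto intro!: order_trans[OF C(2)] mult_right_mono mult_mono norm_H12_components)
      have "norm g \<le> L * norm (H12_L2 u - H12_L2 v)"
        unfolding g_def L_def by (rule nls.g_lipschitz)
      also have "\<dots> \<le> L * norm d"
        using norm_H12_components(3)[of d] nls.L_pos by (intro mult_left_mono) (auto simp: d_def L_def)
      finally have "norm g \<le> L * norm d" .
      then show "norm (L2_pair g (H12_L2 w)) \<le> (L * norm d) * norm w * C"
        using C(1) nls.L_pos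
        by (intro order_trans[OF C(2)] mult_right_mono mult_mono norm_H12_components) (auto simp: L_def)
    qed
    also have "\<dots> = (2 * C + L * C) * norm (u - v) * norm w"
      by (simp add: d_def algebra_simps)
    finally show "norm (blinfun_apply (rhs p u - rhs p v) w) \<le> (2 * C + L * C) * norm (u - v) * norm w" .
  qed
  then show ?thesis by blast
qed

lemma isCont_rhs:
  assumes "2 < p"
  shows "isCont (rhs p) u"
proof -
  obtain C where "\<forall>v w. norm v \<le> norm u + 1 \<longrightarrow> norm w \<le> norm u + 1 \<longrightarrow> norm (rhs p v - rhs p w) \<le> C * norm (v - w)"
    using norm_rhs_diff_le[OF assms] by blast
  then have C: "norm (rhs p v - rhs p u) \<le> C * norm (v - u)" if "norm v \<le> norm u + 1" for v
    using that by simp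
  have "\<forall>\<^sub>F v in at u. norm (v - u) < 1"
    by (metis (mono_tags, lifting) dist_norm eventually_at zero_less_one)
  then have "\<forall>\<^sub>F v in at u. norm (rhs p v - rhs p u) \<le> C * norm (v - u)"
  proof eventually_elim
    case (elim v)
    then show ?case
      using norm_triangle_ineq2[of v u] by (intro C) linarith
  qed
  moreover have "((\<lambda>v. C * norm (v - u)) \<longlongrightarrow> C * norm (u - u)) (at u)"
    by (intro tendsto_intros)
  then have "((\<lambda>v. C * norm (v - u)) \<longlongrightarrow> 0) (at u)"
    by simp
  ultimately have "((\<lambda>v. rhs p v - rhs p u) \<longlongrightarrow> 0) (at u)"
    by (rule Lim_null_comparison)
  then show ?thesis
    by (simp add: continuous_at LIM_zero_iff)
qed

text \<open>A condition at a single time, relative to a set, so that restriction, translation and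
  gluing of solutions can be checked pointwise.\<close>

definition solves_at :: "real \<Rightarrow> real set \<Rightarrow> (real \<Rightarrow> H12) \<Rightarrow> real \<Rightarrow> bool" where
  "solves_at p S \<psi> t \<longleftrightarrow> continuous (at t within S) \<psi> \<and>
     ((\<lambda>s. embed_dual (\<psi> s)) has_vector_derivative rhs p (\<psi> t)) (at t within S)"

text \<open>The equation forces the derivative to be \<open>rhs p (\<psi> t)\<close>, so the C^1
  clause is recovered from the continuity of \<open>\<psi>\<close> and of
  \<open>rhs p\<close>.\<close>

lemma solves_cauchy_iff:
  assumes "2 < p"
  shows "solves_cauchy p \<psi>\<^sub>0 T \<psi> \<longleftrightarrow> \<psi> 0 = \<psi>\<^sub>0 \<and> (\<forall>t\<in>time_interval T. solves_at p (time_interval T) \<psi> t)"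
    (is "_ \<longleftrightarrow> ?R")
proof
  assume "solves_cauchy p \<psi>\<^sub>0 T \<psi>"
  then show ?R
    unfolding solves_cauchy_def solves_at_def equation_iff_rhs
    by (auto simp: continuous_on_eq_continuous_within)
next
  assume R: ?R
  have "continuous (at t within time_interval T) (\<lambda>t. rhs p (\<psi> t))" if "t \<in> time_interval T" for t
    unfolding continuous_within
    by (rule isCont_tendsto_compose[OF isCont_rhs[OF assms]])
      (use R that in \<open>simp add: solves_at_def continuous_within\<close>)
  then have "continuous_on (time_interval T) (\<lambda>t. rhs p (\<psi> t))"
    by (simp add: continuous_on_eq_continuous_within)
  then show "solves_cauchy p \<psi>\<^sub>0 T \<psi>"
    unfolding solves_cauchy_def equation_iff_rhs
    using R rhs_in_dual[OF assms]
    by (intro conjI exI[of _ "\<lambda>t. rhs p (\<psi> t)"]) (auto simp: solves_at_def continuous_on_eq_continuous_within)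
qed

section \<open>Uniqueness and local existence\<close>

lemma cnj_L2_cnj [simp]: "cnj_L2 (cnj_L2 X) = X"
proof (rule L2_eqI)
  show "AE z in lborel. rep_L2 (cnj_L2 (cnj_L2 X)) z = rep_L2 X z"
    using AE_rep_cnj_L2[of "cnj_L2 X"] AE_rep_cnj_L2[of X] by eventually_elim simp
qed

lemma cnj_L2_add: "cnj_L2 (X + Y) = cnj_L2 X + cnj_L2 Y"
  using cnj_L2_diff[of "X + Y" Y] by simp

lemma cnj_H12_add: "cnj_H12 (u + v) = cnj_H12 u + cnj_H12 v"
  by (rule H12_eqI) (simp_all add: cnj_L2_add)

lemma tendsto_cnj_H12: "(f \<longlongrightarrow> u) F \<Longrightarrow> ((\<lambda>s. cnj_H12 (f s)) \<longlongrightarrow> cnj_H12 u) F"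
  by (intro tendsto_H12I)
    (auto intro!: tendsto_cnj_L2 bounded_linear.tendsto[OF bounded_linear_H12_L2]
      bounded_linear.tendsto[OF bounded_linear_H12_dx] bounded_linear.tendsto[OF bounded_linear_H12_dyy])

lemma Re_ii_L2_pair: "Re (\<i> * L2_pair X Y) = - (X \<bullet> cscale_L2 \<i> (cnj_L2 Y))"
proof -
  have "Re (\<i> * L2_pair X Y) = Re (L2_pair X (cscale_L2 \<i> Y))"
    by (simp add: L2_pair_cscale_right)
  also have "\<dots> = X \<bullet> cscale_L2 (- \<i>) (cnj_L2 Y)"
    by (simp add: Re_L2_pair cnj_L2_cscale)
  also have "cscale_L2 (- \<i>) (cnj_L2 Y) = - cscale_L2 \<i> (cnj_L2 Y)"
    using cscale_L2_comp[of "- 1" \<i> "cnj_L2 Y"] by (simp add: cscale_L2_minus1)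
  finally show ?thesis by simp
qed

lemma Re_embed_dual: "Re (blinfun_apply (embed_dual u) v) = H12_L2 u \<bullet> H12_L2 (cnj_H12 v)"
  by (simp add: embed_dual.rep_eq Re_L2_pair)

lemma inner_cscale_ii_skew: "cscale_L2 \<i> X \<bullet> Y = - (X \<bullet> cscale_L2 \<i> Y)"
  using inner_cscale_ii[of "cscale_L2 \<i> X" Y] by (simp add: cscale_L2_comp cscale_L2_minus1)

text \<open>The right-hand side is the integrand of the weak equation \<open>sol_weak\<close> for
  the test element \<open>cnj_H12 v\<close>.\<close>

lemma Re_rhs_apply:
  assumes "2 < p" and K: "AE z in lborel. cmod (val u z) \<le> K" "0 < K"
  shows "Re (blinfun_apply (rhs p u) v) = H12_form u (cscale_H12 \<i> (cnj_H12 v))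
    + cscale_L2 \<i> (trunc_op p K (H12_L2 u)) \<bullet> H12_L2 (cnj_H12 v)"
proof -
  have "blinfun_apply (rhs p u) v = - (\<i> * L2_pair (H12_dx u) (H12_dx v)) - \<i> * L2_pair (H12_dyy u) (H12_dyy v)
    + \<i> * L2_pair (trunc_op p K (H12_L2 u)) (H12_L2 v)"
    unfolding rhs_apply[OF assms] by (simp add: algebra_simps)
  then have "Re (blinfun_apply (rhs p u) v) = - Re (\<i> * L2_pair (H12_dx u) (H12_dx v)) - Re (\<i> * L2_pair (H12_dyy u) (H12_dyy v))
    + Re (\<i> * L2_pair (trunc_op p K (H12_L2 u)) (H12_L2 v))"
    by (simp only: plus_complex.sel minus_complex.sel uminus_complex.sel)
  then show ?thesis
    unfolding Re_ii_L2_pair by (simp add: H12_form_def inner_cscale_ii_skew)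
qed

lemma bounded_linear_embed_dual: "bounded_linear (\<lambda>u. embed_dual u)"
proof -
  obtain C where C: "\<And>X. norm (pair_dual X) \<le> C * norm X" "0 \<le> C"
    using norm_pair_dual_le by blast
  have e: "embed_dual u = pair_dual (H12_L2 u)" for u
    by (rule blinfun_eqI) (simp add: embed_dual.rep_eq pair_dual.rep_eq)
  interpret pair: bounded_bilinear L2_pair by (rule bounded_bilinear_L2_pair)
  show ?thesis
  proof (rule bounded_linear_intro[where K = C])
    show "embed_dual (u + v) = embed_dual u + embed_dual v" for u v
      by (rule blinfun_eqI) (simp add: embed_dual.rep_eq blinfun.add_left pair.add_left)
    show "embed_dual (r *\<^sub>R u) = r *\<^sub>R embed_dual u" for r u
      by (rule blinfun_eqI) (simp add: embed_dual.rep_eq blinfun.scaleR_left pair.scaleR_left)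
    show "norm (embed_dual u) \<le> norm u * C" for u
      using C(1)[of "H12_L2 u"] mult_left_mono[OF norm_H12_components(3) C(2), of u]
      unfolding e by (simp add: mult.commute)
  qed
qed

lemma has_vector_derivative_quotient_tendsto:
  assumes "(f has_vector_derivative D) (at x within S)"
  shows "((\<lambda>y. (1 / (y - x)) *\<^sub>R (f y - f x)) \<longlongrightarrow> D) (at x within S)"
proof -
  have "((\<lambda>y. norm ((f y - f x) - (y - x) *\<^sub>R D) / norm (y - x)) \<longlongrightarrow> 0) (at x within S)"
    using assms unfolding has_vector_derivative_def has_derivative_iff_norm by blast
  moreover have "\<forall>\<^sub>F y in at x within S. norm ((f y - f x) - (y - x) *\<^sub>R D) / norm (y - x)
      = norm ((1 / (y - x)) *\<^sub>R (f y - f x) - D)"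
    unfolding eventually_at_filter
  proof (intro always_eventually allI impI)
    fix y assume "y \<noteq> x"
    then have "(1 / (y - x)) *\<^sub>R (f y - f x) - D = (1 / (y - x)) *\<^sub>R ((f y - f x) - (y - x) *\<^sub>R D)"
      by (simp add: scaleR_diff_right)
    then show "norm ((f y - f x) - (y - x) *\<^sub>R D) / norm (y - x) = norm ((1 / (y - x)) *\<^sub>R (f y - f x) - D)"
      by simp
  qed
  ultimately have "((\<lambda>y. norm ((1 / (y - x)) *\<^sub>R (f y - f x) - D)) \<longlongrightarrow> 0) (at x within S)"
    by (simp add: tendsto_cong)
  then have "((\<lambda>y. (1 / (y - x)) *\<^sub>R (f y - f x) - D) \<longlongrightarrow> 0) (at x within S)"
    by (rule tendsto_norm_zero_cancel)
  then show ?thesis by (simp add: LIM_zero_iff)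
qed

text \<open>Differentiating \<open>\<parallel>d\<parallel>\<^sub>2\<^sup>2\<close> only needs the time derivative of \<open>d\<close> in the dual, because
  \<open>\<parallel>d(s)\<parallel>\<^sup>2 - \<parallel>d(t)\<parallel>\<^sup>2\<close> is the pairing of \<open>d(s) - d(t)\<close> with \<open>d(s) + d(t)\<close>.\<close>

lemma has_vector_derivative_norm_H12_L2:
  assumes cont: "continuous (at t within S) d"
    and der: "((\<lambda>s. embed_dual (d s)) has_vector_derivative D) (at t within S)"
  shows "((\<lambda>s. (norm (H12_L2 (d s)))\<^sup>2) has_vector_derivative 2 * Re (blinfun_apply D (cnj_H12 (d t)))) (at t within S)"
proof -
  interpret e: bounded_linear embed_dual by (rule bounded_linear_embed_dual)
  have eq: "((norm (H12_L2 (d s)))\<^sup>2 - (norm (H12_L2 (d t)))\<^sup>2) / (s - t)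
      = Re (blinfun_apply ((1 / (s - t)) *\<^sub>R (embed_dual (d s) - embed_dual (d t))) (cnj_H12 (d s + d t)))" for s
  proof -
    have "Re (blinfun_apply (embed_dual (d s) - embed_dual (d t)) (cnj_H12 (d s + d t)))
        = H12_L2 (d s - d t) \<bullet> H12_L2 (d s + d t)"
      unfolding e.diff[symmetric] by (simp add: Re_embed_dual del: H12_components_linear)
    also have "\<dots> = (norm (H12_L2 (d s)))\<^sup>2 - (norm (H12_L2 (d t)))\<^sup>2"
      by (simp add: dot_square_norm inner_diff_left inner_add_right inner_commute[of "H12_L2 (d t)" "H12_L2 (d s)"])
    finally show ?thesis
      by (simp add: blinfun.scaleR_left)
  qed
  have "(d \<longlongrightarrow> d t) (at t within S)"
    using cont by (simp add: continuous_within)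
  then have "((\<lambda>s. cnj_H12 (d s + d t)) \<longlongrightarrow> cnj_H12 (d t + d t)) (at t within S)"
    by (intro tendsto_cnj_H12 tendsto_intros)
  then have "((\<lambda>s. blinfun_apply ((1 / (s - t)) *\<^sub>R (embed_dual (d s) - embed_dual (d t))) (cnj_H12 (d s + d t)))
      \<longlongrightarrow> blinfun_apply D (cnj_H12 (d t + d t))) (at t within S)"
    by (intro bounded_bilinear.tendsto[OF bounded_bilinear_blinfun_apply] has_vector_derivative_quotient_tendsto[OF der])
  then have "((\<lambda>s. ((norm (H12_L2 (d s)))\<^sup>2 - (norm (H12_L2 (d t)))\<^sup>2) / (s - t))
      \<longlongrightarrow> Re (blinfun_apply D (cnj_H12 (d t + d t)))) (at t within S)"
    unfolding eq by (rule tendsto_Re)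
  moreover have "Re (blinfun_apply D (cnj_H12 (d t + d t))) = 2 * Re (blinfun_apply D (cnj_H12 (d t)))"
    by (simp add: cnj_H12_add blinfun.add_right)
  ultimately show ?thesis
    by (simp add: has_field_derivative_iff flip: has_real_derivative_iff_has_vector_derivative)
qed

text \<open>The form terms cancel because \<open>a d (IX d) = 0\<close>, so only the nonlinearity
  enters the Gronwall estimate, and only through the L2 norm.\<close>

lemma solves_cauchy_unique:
  assumes p: "2 < p" and \<phi>: "solves_cauchy p \<psi>\<^sub>0 T \<phi>" and \<psi>: "solves_cauchy p \<psi>\<^sub>0 T \<psi>"
    and t: "t \<in> time_interval T"
  shows "\<phi> t = \<psi> t"
proof -
  interpret e: bounded_linear embed_dual by (rule bounded_linear_embed_dual)
  have t0: "0 \<le> t" using t by (simp add: time_interval_def)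
  have sub: "{0..t} \<subseteq> time_interval T"
  proof
    fix s assume "s \<in> {0..t}"
    then show "s \<in> time_interval T"
      using t le_less_trans[of "ereal s" "ereal t" T] by (simp add: time_interval_def)
  qed
  have c: "continuous_on {0..t} \<phi>" "continuous_on {0..t} \<psi>"
    using \<phi> \<psi> sub by (auto simp: solves_cauchy_def intro: continuous_on_subset)
  \<comment> \<open>Compactness bounds both given solutions on \<open>{0..t}\<close>. This yields
    one truncation level below which the truncated nonlinearity agrees with the power along both of
    them.\<close>
  have "compact (\<phi> ` {0..t} \<union> \<psi> ` {0..t})"
    using c by (intro compact_Un compact_continuous_image) auto
  then have "bounded (\<phi> ` {0..t} \<union> \<psi> ` {0..t})"
    by (rule compact_imp_bounded)
  then obtain M where "\<forall>u\<in>\<phi> ` {0..t} \<union> \<psi> ` {0..t}. norm u \<le> M"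
    unfolding bounded_iff by blast
  then have M: "norm (\<phi> s) \<le> M" "norm (\<psi> s) \<le> M" if "s \<in> {0..t}" for s
    using that by auto
  define K where "K = \<bar>7 * M\<bar> + 1"
  have K: "0 < K" by (simp add: K_def)
  interpret nls: schroedinger_form H12_L2 H12_form 3 "cscale_L2 \<i>" "cscale_H12 \<i>" "trunc_op p K" "trunc_pot p K"
    "(p - 1) * K powr (p - 2)"
    by (rule truncated_schroedinger_form[OF p K])
  define L where "L = (p - 1) * K powr (p - 2)"
  have L: "0 < L" unfolding L_def by (rule nls.L_pos)
  define d where "d s = \<phi> s - \<psi> s" for s
  define y where "y s = (norm (H12_L2 (d s)))\<^sup>2" for s
  have "y t \<le> (y 0 + 0 * t) * exp (2 * L * t)"
  proof (rule gronwall_linear[where y' = "\<lambda>s. 2 * Re (blinfun_apply (rhs p (\<phi> s) - rhs p (\<psi> s)) (cnj_H12 (d s)))"])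
    fix s assume "0 \<le> s" "s \<le> t"
    then have s: "s \<in> {0..t}" by simp
    then have sT: "s \<in> time_interval T" using sub by blast
    have at: "solves_at p (time_interval T) \<phi> s" "solves_at p (time_interval T) \<psi> s"
      using \<phi> \<psi> sT by (simp_all add: solves_cauchy_iff[OF p])
    have "((\<lambda>s. embed_dual (d s)) has_vector_derivative (rhs p (\<phi> s) - rhs p (\<psi> s))) (at s within time_interval T)"
      unfolding d_def e.diff using at by (intro has_vector_derivative_diff) (auto simp: solves_at_def)
    moreover have "continuous (at s within time_interval T) d"
      unfolding d_def using at by (intro continuous_intros) (auto simp: solves_at_def)
    ultimately have "(y has_vector_derivative 2 * Re (blinfun_apply (rhs p (\<phi> s) - rhs p (\<psi> s)) (cnj_H12 (d s)))) (at s within time_interval T)"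
      unfolding y_def by (intro has_vector_derivative_norm_H12_L2)
    then show "(y has_vector_derivative 2 * Re (blinfun_apply (rhs p (\<phi> s) - rhs p (\<psi> s)) (cnj_H12 (d s)))) (at s within {0..t})"
      using sub by (rule has_vector_derivative_within_subset)
    have b: "AE z in lborel. cmod (val (\<phi> s) z) \<le> K" "AE z in lborel. cmod (val (\<psi> s) z) \<le> K"
      using val_bound[OF M(1)[OF s]] val_bound[OF M(2)[OF s]] by (auto simp: K_def)
    define v where "v = cnj_H12 (cnj_H12 (d s))"
    have v: "v = d s"
      unfolding v_def by (rule H12_eqI) simp_all
    have "Re (blinfun_apply (rhs p (\<phi> s) - rhs p (\<psi> s)) (cnj_H12 (d s)))
        = (H12_form (\<phi> s) (cscale_H12 \<i> (d s)) - H12_form (\<psi> s) (cscale_H12 \<i> (d s)))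
          + (cscale_L2 \<i> (trunc_op p K (H12_L2 (\<phi> s))) \<bullet> H12_L2 (d s) - cscale_L2 \<i> (trunc_op p K (H12_L2 (\<psi> s))) \<bullet> H12_L2 (d s))"
      by (simp add: blinfun.diff_left Re_rhs_apply[OF p b(1) K] Re_rhs_apply[OF p b(2) K] v[unfolded v_def])
    also have "H12_form (\<phi> s) (cscale_H12 \<i> (d s)) - H12_form (\<psi> s) (cscale_H12 \<i> (d s)) = 0"
      using nls.form_IX_self[of "d s"] by (simp add: d_def nls.a.diff_left)
    also have "cscale_L2 \<i> (trunc_op p K (H12_L2 (\<phi> s))) \<bullet> H12_L2 (d s) - cscale_L2 \<i> (trunc_op p K (H12_L2 (\<psi> s))) \<bullet> H12_L2 (d s)
        = cscale_L2 \<i> (trunc_op p K (H12_L2 (\<phi> s)) - trunc_op p K (H12_L2 (\<psi> s))) \<bullet> H12_L2 (d s)"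
      by (simp add: nls.I.diff inner_diff_left)
    also have "\<dots> \<le> norm (trunc_op p K (H12_L2 (\<phi> s)) - trunc_op p K (H12_L2 (\<psi> s))) * norm (H12_L2 (d s))"
      using norm_cauchy_schwarz[of "cscale_L2 \<i> (trunc_op p K (H12_L2 (\<phi> s)) - trunc_op p K (H12_L2 (\<psi> s)))" "H12_L2 (d s)"]
      by simp
    also have "\<dots> \<le> L * norm (H12_L2 (d s)) * norm (H12_L2 (d s))"
      using nls.g_lipschitz[of "H12_L2 (\<phi> s)" "H12_L2 (\<psi> s)"]
      by (intro mult_right_mono) (auto simp: d_def L_def)
    finally show "2 * Re (blinfun_apply (rhs p (\<phi> s) - rhs p (\<psi> s)) (cnj_H12 (d s))) \<le> 2 * L * y s + 0"
      by (simp add: y_def power2_eq_square)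
  qed (use t0 L in auto)
  moreover have "y 0 = 0"
    using \<phi> \<psi> by (simp add: y_def d_def solves_cauchy_def)
  ultimately have "H12_L2 (d t) = 0"
    by (simp add: y_def)
  then have "d t = 0" by (rule H12_L2_eq_0D)
  then show ?thesis by (simp add: d_def)
qed

text \<open>Replacing \<open>v\<close> by its multiple by \<open>- \<i>\<close> turns imaginary
  parts into real parts. This lifts the real-valued weak equation to an identity in the
  dual.\<close>

lemma dual_eq_0I:
  assumes "D \<in> H12_dual" and "\<And>v. Re (blinfun_apply D v) = 0"
  shows "D = 0"
proof (rule blinfun_eqI)
  fix v
  have "blinfun_apply D (cscale_H12 (- \<i>) v) = - \<i> * blinfun_apply D v"
    using assms(1) by (simp add: H12_dual_def)
  then have "Im (blinfun_apply D v) = 0"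
    using assms(2)[of "cscale_H12 (- \<i>) v"] by simp
  then show "blinfun_apply D v = blinfun_apply 0 v"
    using assms(2)[of v] by (simp add: complex_eq_iff)
qed

lemma time_interval_real: "time_interval (ereal T) = {0..<T}"
  by (auto simp: time_interval_def)

text \<open>The order of the choices matters: \<open>R\<close> fixes \<open>M\<close>, then the
  level \<open>K\<close>, then \<open>L\<close>, then \<open>T\<close>. The bound of
  \<open>sol_short_time\<close> does not involve \<open>L\<close>, so the solution stays below the
  level fixed in advance.\<close>

lemma local_existence:
  assumes p: "2 < p" and R: "0 < R"
  shows "\<exists>T>0. \<forall>\<psi>\<^sub>0. norm \<psi>\<^sub>0 \<le> R \<longrightarrow> (\<exists>\<psi>. solves_cauchy p \<psi>\<^sub>0 (ereal T) \<psi> \<and>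
    (\<forall>t\<in>{0..<T}. mass (\<psi> t) = mass \<psi>\<^sub>0 \<and> energy p (\<psi> t) = energy p \<psi>\<^sub>0))"
proof -
  \<comment> \<open>Chosen for \<open>3 * (R^2 + 1) \<le> M^2\<close>, with \<open>3\<close> from
    \<open>norm_H12_sq_le\<close> and \<open>R^2 + 1\<close> from
    \<open>sol_short_time\<close>.\<close>
  define M where "M = 2 * (R + 1)"
  define K where "K = 7 * M + 1"
  have K: "0 < K" using R by (simp add: K_def M_def)
  interpret nls: schroedinger_form H12_L2 H12_form 3 "cscale_L2 \<i>" "cscale_H12 \<i>" "trunc_op p K" "trunc_pot p K"
    "(p - 1) * K powr (p - 2)"
    by (rule truncated_schroedinger_form[OF p K])
  define L where "L = (p - 1) * K powr (p - 2)"
  have L: "0 < L" unfolding L_def by (rule nls.L_pos)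
  \<comment> \<open>With \<open>r = R\<close> the hypothesis \<open>small\<close> of
    \<open>sol_short_time\<close> reads \<open>B * t \<le> 1\<close>; the choice
    \<open>T = 1 / (B + 1)\<close> guarantees it also for \<open>B = 0\<close>.\<close>
  define B where "B = (6 * L * R)\<^sup>2 * (5 / 2 * (R\<^sup>2 + 4 * L * R\<^sup>2) + 2 * L * R\<^sup>2)"
  have B: "0 \<le> B" unfolding B_def using L by (intro mult_nonneg_nonneg add_nonneg_nonneg) auto
  define T where "T = 1 / (B + 1)"
  have T: "0 < T" using B by (simp add: T_def)
  have "\<exists>\<psi>. solves_cauchy p \<psi>\<^sub>0 (ereal T) \<psi> \<and>
    (\<forall>t\<in>{0..<T}. mass (\<psi> t) = mass \<psi>\<^sub>0 \<and> energy p (\<psi> t) = energy p \<psi>\<^sub>0)" if \<psi>\<^sub>0: "norm \<psi>\<^sub>0 \<le> R" for \<psi>\<^sub>0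
  proof -
    define \<psi> where "\<psi> = nls.sol \<psi>\<^sub>0"
    have "(norm \<psi>\<^sub>0)\<^sup>2 \<le> R\<^sup>2" using \<psi>\<^sub>0 by (intro power_mono) auto
    then have init: "H12_form \<psi>\<^sub>0 \<psi>\<^sub>0 + (norm (H12_L2 \<psi>\<^sub>0))\<^sup>2 \<le> R\<^sup>2"
      using H12_form_le_norm_sq[of \<psi>\<^sub>0] by linarith
    have bound: "norm (\<psi> t) \<le> M" if "t \<in> {0..<T}" for t
    proof -
      have "B * t \<le> B * T" using that B by (intro mult_left_mono) auto
      also have "\<dots> \<le> 1" using B by (simp add: T_def field_simps)
      finally have "B * t \<le> 1" .
      then have "H12_form (\<psi> t) (\<psi> t) + (norm (H12_L2 (\<psi> t)))\<^sup>2 \<le> R\<^sup>2 + 1"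
        unfolding \<psi>_def using that R
        by (intro nls.sol_short_time init) (auto simp: B_def L_def mult.assoc)
      then have "(norm (\<psi> t))\<^sup>2 \<le> 3 * (R\<^sup>2 + 1)"
        using norm_H12_sq_le[of "\<psi> t"] by simp
      also have "\<dots> \<le> M\<^sup>2"
        using R by (simp add: M_def power2_eq_square algebra_simps)
      finally show ?thesis
        by (rule power2_le_imp_le) (use R in \<open>simp add: M_def\<close>)
    qed
    have val: "AE z in lborel. cmod (val (\<psi> t) z) \<le> K" if "t \<in> {0..<T}" for t
      unfolding K_def by (rule val_bound[OF bound[OF that]])
    have init_eq: "\<psi> 0 = \<psi>\<^sub>0" by (simp add: \<psi>_def nls.sol_0)
    have cont: "continuous_on {0..<T} \<psi>"
      unfolding \<psi>_def by (rule continuous_on_subset[OF nls.continuous_on_sol]) auto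
    define f where "f t = rhs p (\<psi> t)" for t
    have "continuous (at t within {0..<T}) f" if "t \<in> {0..<T}" for t
      unfolding f_def continuous_within
      by (rule isCont_tendsto_compose[OF isCont_rhs[OF p]])
        (use cont that in \<open>simp add: continuous_on_def\<close>)
    then have cont_f: "continuous_on {0..<T} f"
      by (simp add: continuous_on_eq_continuous_within)
    \<comment> \<open>The weak equation gives equality of the real parts; complex linearity of both
      sides gives the rest.\<close>
    have eq: "embed_dual (\<psi> t) = embed_dual \<psi>\<^sub>0 + integral {0..t} f" if t: "t \<in> {0..<T}" for t
    proof -
      have sub: "{0..t} \<subseteq> {0..<T}" using t by auto
      have int: "f integrable_on {0..t}"
        by (intro integrable_continuous_real continuous_on_subset[OF cont_f sub])
      have int_apply: "blinfun_apply (integral {0..t} f) v = integral {0..t} (\<lambda>s. blinfun_apply (f s) v)"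
        and int_v: "(\<lambda>s. blinfun_apply (f s) v) integrable_on {0..t}" for v
        using integral_linear[OF int blinfun.bounded_linear_left, of v]
          integrable_linear[OF int blinfun.bounded_linear_left, of v] by (simp_all add: o_def)
      define D where "D = embed_dual (\<psi> t) - embed_dual \<psi>\<^sub>0 - integral {0..t} f"
      have "D = 0"
      proof (rule dual_eq_0I)
        have "blinfun_apply (integral {0..t} f) (cscale_H12 c v) = c * blinfun_apply (integral {0..t} f) v" for c v
        proof -
          have "blinfun_apply (f s) (cscale_H12 c v) = c * blinfun_apply (f s) v" for s
            using rhs_in_dual[OF p, of "\<psi> s"] by (simp add: f_def H12_dual_def)
          then show ?thesis
            by (simp add: int_apply)
        qed
        then show "D \<in> H12_dual"
          by (simp add: H12_dual_def D_def blinfun.diff_left embed_dual.rep_eq L2_pair_cscale_right right_diff_distrib)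
        fix v
        have "Re (blinfun_apply (integral {0..t} f) v) = integral {0..t} (\<lambda>s. Re (blinfun_apply (f s) v))"
          unfolding int_apply using integral_linear[OF int_v bounded_linear_Re, of v] by (simp add: o_def)
        also have "\<dots> = integral {0..t} (\<lambda>s. H12_form (\<psi> s) (cscale_H12 \<i> (cnj_H12 v))
            + cscale_L2 \<i> (trunc_op p K (H12_L2 (\<psi> s))) \<bullet> H12_L2 (cnj_H12 v))"
          by (rule Henstock_Kurzweil_Integration.integral_cong)
            (use sub in \<open>auto simp: f_def Re_rhs_apply[OF p val K] simp del: cnj_H12\<close>)
        also have "\<dots> = H12_L2 (\<psi> t) \<bullet> H12_L2 (cnj_H12 v) - H12_L2 \<psi>\<^sub>0 \<bullet> H12_L2 (cnj_H12 v)"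
          unfolding \<psi>_def using nls.sol_weak[of t \<psi>\<^sub>0 "cnj_H12 v"] t by (simp del: cnj_H12)
        finally show "Re (blinfun_apply D v) = 0"
          by (simp add: D_def blinfun.diff_left Re_embed_dual)
      qed
      then show ?thesis by (simp add: D_def algebra_simps)
    qed
    have der: "((\<lambda>s. embed_dual (\<psi> s)) has_vector_derivative f t) (at t within {0..<T})" if t: "t \<in> {0..<T}" for t
    proof -
      obtain t1 where t1: "t < t1" "t1 < T" using t dense[of t T] by auto
      have "((\<lambda>u. integral {0..u} f) has_vector_derivative f t) (at t within {0..t1})"
        using t t1 by (intro integral_has_vector_derivative continuous_on_subset[OF cont_f]) auto
      moreover have "at t within {0..<T} = at t within {0..t1}"
        by (rule at_within_nhd[of _ "{..<t1}"]) (use t1 in auto)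
      ultimately have "((\<lambda>u. embed_dual \<psi>\<^sub>0 + integral {0..u} f) has_vector_derivative f t) (at t within {0..<T})"
        using has_vector_derivative_add[OF has_vector_derivative_const] by fastforce
      then show ?thesis
        by (rule has_vector_derivative_transform[OF t, rotated]) (rule eq)
    qed
    have "solves_cauchy p \<psi>\<^sub>0 (ereal T) \<psi>"
      unfolding solves_cauchy_iff[OF p] time_interval_real solves_at_def
      using init_eq cont der by (auto simp: continuous_on_eq_continuous_within f_def)
    moreover have "mass (\<psi> t) = mass \<psi>\<^sub>0 \<and> energy p (\<psi> t) = energy p \<psi>\<^sub>0" if t: "t \<in> {0..<T}" for t
    proof
      have t0: "0 \<le> t" and z: "0 \<in> {0..<T}" using t T by auto
      show "mass (\<psi> t) = mass \<psi>\<^sub>0"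
        by (simp add: mass_eq_norm \<psi>_def nls.emb_sol[OF t0] nls.norm_evol[OF t0])
      show "energy p (\<psi> t) = energy p \<psi>\<^sub>0"
        using nls.sol_energy[OF t0, of \<psi>\<^sub>0] energy_eq_trunc[OF p val[OF t] K] energy_eq_trunc[OF p val[OF z] K]
        by (simp add: init_eq) (simp add: \<psi>_def)
    qed
    ultimately show ?thesis by blast
  qed
  with T show ?thesis by blast
qed

section \<open>Continuation and the maximal solution\<close>

lemma solves_at_mono:
  "solves_at p S \<psi> t \<Longrightarrow> S' \<subseteq> S \<Longrightarrow> solves_at p S' \<psi> t"
  unfolding solves_at_def using continuous_within_subset has_vector_derivative_within_subset by blast

text \<open>Continuity and derivative at \<open>t\<close> see only a neighbourhood, so the function
  and the time set can be exchanged together when pieces are glued.\<close>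

lemma solves_at_transform:
  assumes "solves_at p S \<psi> t" "t \<in> S" "open U" "t \<in> U" "S \<inter> U = S' \<inter> U"
    and eq: "\<And>s. s \<in> S \<inter> U \<Longrightarrow> \<phi> s = \<psi> s"
  shows "solves_at p S' \<phi> t"
proof -
  have tU: "t \<in> S \<inter> U" using assms by blast
  have at: "at t within S' = at t within (S \<inter> U)"
    by (rule at_within_nhd[OF assms(4,3)]) (use assms(5) in auto)
  have \<psi>: "continuous (at t within (S \<inter> U)) \<psi>"
    "((\<lambda>s. embed_dual (\<psi> s)) has_vector_derivative rhs p (\<psi> t)) (at t within (S \<inter> U))"
    using solves_at_mono[OF assms(1), of "S \<inter> U"] by (auto simp: solves_at_def)
  have "\<forall>\<^sub>F s in at t within (S \<inter> U). \<psi> s = \<phi> s"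
    using eq by (auto simp: eventually_at_filter intro!: always_eventually)
  then have "(\<phi> \<longlongrightarrow> \<psi> t) (at t within (S \<inter> U))"
    using \<psi>(1) unfolding continuous_within by (rule Lim_transform_eventually[rotated])
  moreover have "((\<lambda>s. embed_dual (\<phi> s)) has_vector_derivative rhs p (\<psi> t)) (at t within (S \<inter> U))"
    by (rule has_vector_derivative_transform[OF tU _ \<psi>(2)]) (simp add: eq)
  ultimately show ?thesis
    unfolding solves_at_def continuous_within at eq[OF tU] by blast
qed

lemma solves_at_shift:
  assumes "solves_at p ((\<lambda>s. s - t0) ` S) \<psi> (t - t0)"
  shows "solves_at p S (\<lambda>s. \<psi> (s - t0)) t"
proof -
  have "continuous (at t within S) (\<psi> \<circ> (\<lambda>s. s - t0))"
    by (rule continuous_within_compose) (use assms in \<open>auto simp: solves_at_def intro!: continuous_intros\<close>)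
  moreover have "((\<lambda>s. s - t0) has_vector_derivative 1) (at t within S)"
    by (auto intro!: derivative_eq_intros)
  from vector_diff_chain_within[OF this, of "\<lambda>s. embed_dual (\<psi> s)" "rhs p (\<psi> (t - t0))"]
  have "((\<lambda>s. embed_dual (\<psi> (s - t0))) has_vector_derivative rhs p (\<psi> (t - t0))) (at t within S)"
    using assms by (simp add: solves_at_def o_def)
  ultimately show ?thesis
    by (simp add: solves_at_def o_def)
qed

lemma time_interval_mono: "S \<le> T \<Longrightarrow> time_interval S \<subseteq> time_interval T"
  by (auto simp: time_interval_def)

lemma solves_cauchy_mono:
  assumes "2 < p" "solves_cauchy p \<psi>\<^sub>0 T \<psi>" "S \<le> T"
  shows "solves_cauchy p \<psi>\<^sub>0 S \<psi>"
  using assms(2) time_interval_mono[OF assms(3)] unfolding solves_cauchy_iff[OF assms(1)]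
  by (auto intro: solves_at_mono)

text \<open>The new piece starts at an interior time \<open>t0\<close>, not at the endpoint: the two
  pieces overlap and agree there by uniqueness, and no one-sided derivatives have to be matched at
  the seam.\<close>

lemma solves_cauchy_continue:
  assumes p: "2 < p" and \<psi>: "solves_cauchy p \<psi>\<^sub>0 T \<psi>" and t0: "t0 \<in> time_interval T"
    and \<phi>: "solves_cauchy p (\<psi> t0) (ereal S) \<phi>"
  shows "\<exists>\<eta>. solves_cauchy p \<psi>\<^sub>0 (ereal (t0 + S)) \<eta>"
proof (cases "ereal (t0 + S) \<le> T")
  case True
  then show ?thesis
    using solves_cauchy_mono[OF p \<psi>] by blast
next
  case False
  have t0': "0 \<le> t0" "ereal t0 < T" using t0 by (auto simp: time_interval_def)
  obtain \<tau> where \<tau>: "T = ereal \<tau>"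
    using False t0' by (cases T) auto
  have \<tau>': "t0 < \<tau>" "\<tau> < t0 + S"
    using False t0' by (auto simp: \<tau>)
  have \<psi>at: "solves_at p {0..<\<tau>} \<psi> t" if "t \<in> {0..<\<tau>}" for t
    using \<psi> that by (simp add: solves_cauchy_iff[OF p] \<tau> time_interval_real)
  have \<phi>at: "solves_at p {0..<S} \<phi> t" if "t \<in> {0..<S}" for t
    using \<phi> that by (simp add: solves_cauchy_iff[OF p] time_interval_real)
  have \<phi>0: "\<phi> 0 = \<psi> t0" and \<psi>0: "\<psi> 0 = \<psi>\<^sub>0"
    using \<phi> \<psi> by (simp_all add: solves_cauchy_def)
  have overlap: "\<phi> (s - t0) = \<psi> s" if s: "t0 \<le> s" "s < \<tau>" for s
  proof -
    have 1: "solves_cauchy p (\<psi> t0) (ereal (\<tau> - t0)) (\<lambda>s. \<psi> (s - (- t0)))"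
      unfolding solves_cauchy_iff[OF p] time_interval_real
    proof (intro conjI ballI)
      fix t assume t: "t \<in> {0..<\<tau> - t0}"
      show "solves_at p {0..<\<tau> - t0} (\<lambda>s. \<psi> (s - (- t0))) t"
      proof (rule solves_at_shift, rule solves_at_mono[OF \<psi>at])
        show "t - (- t0) \<in> {0..<\<tau>}" using t t0' by auto
        show "(\<lambda>s. s - - t0) ` {0..<\<tau> - t0} \<subseteq> {0..<\<tau>}" using t0' by auto
      qed
    qed simp
    have 2: "solves_cauchy p (\<psi> t0) (ereal (\<tau> - t0)) \<phi>"
      by (rule solves_cauchy_mono[OF p \<phi>]) (use \<tau>' in simp)
    show ?thesis
      using solves_cauchy_unique[OF p 2 1, of "s - t0"] s by (simp add: time_interval_real)
  qed
  define \<eta> where "\<eta> s = (if s < \<tau> then \<psi> s else \<phi> (s - t0))" for s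
  have "solves_at p {0..<t0 + S} \<eta> t" if t: "t \<in> {0..<t0 + S}" for t
  proof (cases "t < \<tau>")
    case True
    show ?thesis
      by (rule solves_at_transform[OF \<psi>at, of t "{..<\<tau>}"]) (use True t \<tau>' in \<open>auto simp: \<eta>_def\<close>)
  next
    case False
    \<comment> \<open>A time \<open>t \<ge> \<tau>\<close> is interior to \<open>{t0<..}\<close>,
      where by \<open>overlap\<close> the function \<open>\<eta>\<close> is the shifted
      \<open>\<phi>\<close> throughout.\<close>
    have img: "(\<lambda>s. s - t0) ` {t0..<t0 + S} \<subseteq> {0..<S}" by auto
    have "solves_at p {t0..<t0 + S} (\<lambda>s. \<phi> (s - t0)) t"
      by (rule solves_at_shift, rule solves_at_mono[OF \<phi>at img]) (use t False \<tau>' in auto)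
    then show ?thesis
      by (rule solves_at_transform[of _ _ _ _ "{t0<..}"]) (use t t0' False \<tau>' overlap in \<open>auto simp: \<eta>_def\<close>)
  qed
  moreover have "\<eta> 0 = \<psi>\<^sub>0"
    using \<tau>' t0' \<psi>0 by (simp add: \<eta>_def)
  ultimately have "solves_cauchy p \<psi>\<^sub>0 (ereal (t0 + S)) \<eta>"
    by (simp add: solves_cauchy_iff[OF p] time_interval_real)
  then show ?thesis by blast
qed

text \<open>The supremum is attained: for each \<open>t\<close> take a solution living beyond
  \<open>t\<close> and read off the diagonal value \<open>F t t\<close>; uniqueness makes the
  choices consistent.\<close>

lemma maximal_solution:
  assumes p: "2 < p"
  shows "\<exists>\<psi>. solves_cauchy p \<psi>\<^sub>0 (max_existence_time p \<psi>\<^sub>0) \<psi>"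
proof -
  define T where "T = max_existence_time p \<psi>\<^sub>0"
  have "\<exists>\<psi> S. ereal t < S \<and> solves_cauchy p \<psi>\<^sub>0 S \<psi>" if "t \<in> time_interval T" for t
  proof -
    have "ereal t < T" using that by (simp add: time_interval_def)
    then show ?thesis
      unfolding T_def max_existence_time_def less_Sup_iff by blast
  qed
  then obtain F S where F: "\<And>t. t \<in> time_interval T \<Longrightarrow> ereal t < S t \<and> solves_cauchy p \<psi>\<^sub>0 (S t) (F t)"
    by metis
  have S_le: "S t \<le> T" if "t \<in> time_interval T" for t
  proof -
    have "0 \<le> ereal t" "ereal t < S t" using that F[OF that] by (auto simp: time_interval_def)
    then have "0 < S t" by (rule le_less_trans)
    then show ?thesis
      unfolding T_def max_existence_time_def using F[OF that] by (intro Sup_upper) blast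
  qed
  \<comment> \<open>The default \<open>\<psi>\<^sub>0\<close> secures the initial value also if
    \<open>0\<close> were outside \<open>time_interval T\<close>; that \<open>T\<close> is positive
    is shown only in \<open>blowup_alternative\<close>.\<close>
  define \<psi> where "\<psi> t = (if t \<in> time_interval T then F t t else \<psi>\<^sub>0)" for t
  have eq: "\<psi> s = F t s" if t: "t \<in> time_interval T" and s: "s \<in> time_interval (S t)" for s t
  proof -
    have sT: "s \<in> time_interval T"
      using s time_interval_mono[OF S_le[OF t]] by blast
    have 1: "solves_cauchy p \<psi>\<^sub>0 (min (S s) (S t)) (F s)" "solves_cauchy p \<psi>\<^sub>0 (min (S s) (S t)) (F t)"
      using F[OF sT] F[OF t] by (auto intro: solves_cauchy_mono[OF p])
    have "s \<in> time_interval (min (S s) (S t))"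
      using s F[OF sT] by (simp add: time_interval_def)
    from solves_cauchy_unique[OF p 1 this] have "F s s = F t s" .
    then show ?thesis using sT by (simp add: \<psi>_def)
  qed
  have "solves_at p (time_interval T) \<psi> t" if t: "t \<in> time_interval T" for t
  proof -
    obtain t1 where t1: "ereal t < ereal t1" "ereal t1 < S t"
      using F[OF t] ereal_dense2 by blast
    have t0: "0 \<le> t" using t by (simp add: time_interval_def)
    have mem: "s \<in> time_interval (S t)" "s \<in> time_interval T" if "0 \<le> s" "s < t1" for s
    proof -
      have "ereal s < S t"
        using that t1(2) by (meson ereal_less_eq(3) le_less_trans less_imp_le)
      then show "s \<in> time_interval (S t)" using that by (simp add: time_interval_def)
      then show "s \<in> time_interval T" using time_interval_mono[OF S_le[OF t]] by blast
    qed
    have tS: "t \<in> time_interval (S t)" using mem(1)[OF t0] t1(1) by simp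
    have "solves_at p (time_interval (S t)) (F t) t"
      using F[OF t] tS by (simp add: solves_cauchy_iff[OF p])
    then show ?thesis
    proof (rule solves_at_transform[of _ _ _ _ "{..<t1}"])
      show "time_interval (S t) \<inter> {..<t1} = time_interval T \<inter> {..<t1}"
        using mem by (auto simp: time_interval_def)
    qed (use tS t1 eq[OF t] in auto)
  qed
  moreover have "\<psi> 0 = \<psi>\<^sub>0"
    using F[of 0] by (auto simp: \<psi>_def solves_cauchy_def)
  ultimately show ?thesis
    unfolding solves_cauchy_iff[OF p] T_def by blast
qed

text \<open>If the norm were below \<open>Z\<close> at some \<open>t\<close> with
  \<open>T - S < t < T\<close>, continuing from \<open>t\<close> by the existence time
  \<open>S\<close> for that size would pass \<open>T\<close>. This excludes every such
  \<open>t\<close>, so the norm tends to infinity instead of being merely unbounded.\<close>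

lemma blowup_alternative:
  assumes p: "2 < p" and \<psi>: "solves_cauchy p \<psi>\<^sub>0 (max_existence_time p \<psi>\<^sub>0) \<psi>"
    and fin: "max_existence_time p \<psi>\<^sub>0 < \<infinity>"
  shows "filterlim (\<lambda>t. norm (\<psi> t)) at_top (at_left (real_of_ereal (max_existence_time p \<psi>\<^sub>0)))"
proof -
  have pos: "0 < max_existence_time p \<psi>\<^sub>0"
  proof -
    obtain S where "0 < S" "\<exists>\<phi>. solves_cauchy p \<psi>\<^sub>0 (ereal S) \<phi>"
    proof -
      have "0 < norm \<psi>\<^sub>0 + 1"
        using norm_ge_zero[of \<psi>\<^sub>0] by linarith
      from local_existence[OF p this] that show ?thesis
        by (metis less_add_one less_imp_le)
    qed
    then have "ereal S \<le> max_existence_time p \<psi>\<^sub>0"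
      unfolding max_existence_time_def by (intro Sup_upper) auto
    moreover have "0 < ereal S" using \<open>0 < S\<close> by simp
    ultimately show ?thesis by (rule less_le_trans[rotated])
  qed
  obtain T where T: "max_existence_time p \<psi>\<^sub>0 = ereal T" "0 < T"
    using pos fin by (cases "max_existence_time p \<psi>\<^sub>0") auto
  have "\<forall>\<^sub>F t in at_left T. Z \<le> norm (\<psi> t)" for Z
  proof -
    obtain S where S: "0 < S" "\<And>\<phi>\<^sub>0. norm \<phi>\<^sub>0 \<le> max Z 1 \<Longrightarrow> \<exists>\<phi>. solves_cauchy p \<phi>\<^sub>0 (ereal S) \<phi>"
    proof -
      have "0 < max Z 1" by simp
      from local_existence[OF p this] that show ?thesis by metis
    qed
    define b where "b = max 0 (T - S)"
    have "Z \<le> norm (\<psi> t)" if t: "b < t" "t < T" for t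
    proof (rule ccontr)
      assume "\<not> Z \<le> norm (\<psi> t)"
      then obtain \<phi> where \<phi>: "solves_cauchy p (\<psi> t) (ereal S) \<phi>"
        using S(2)[of "\<psi> t"] by fastforce
      have "t \<in> time_interval (max_existence_time p \<psi>\<^sub>0)"
        using t by (simp add: T time_interval_real b_def)
      then obtain \<eta> where "solves_cauchy p \<psi>\<^sub>0 (ereal (t + S)) \<eta>"
        using solves_cauchy_continue[OF p \<psi> _ \<phi>] by blast
      then have "ereal (t + S) \<le> max_existence_time p \<psi>\<^sub>0"
        unfolding max_existence_time_def using t S(1)
        by (intro Sup_upper) (auto simp: b_def)
      then show False
        using t by (simp add: T b_def)
    qed
    moreover have "b < T" using T S by (simp add: b_def)
    ultimately show ?thesis
      unfolding eventually_at_left[OF \<open>b < T\<close>] by blast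
  qed
  then show ?thesis
    by (simp add: filterlim_at_top T)
qed

lemma local_well_posedness:
  assumes p: "2 < p" and R: "0 < R"
  shows "\<exists>T::real. T > 0 \<and> (\<forall>\<psi>\<^sub>0 :: H12. norm \<psi>\<^sub>0 \<le> R \<longrightarrow>
    (\<exists>\<psi>. solves_cauchy p \<psi>\<^sub>0 T \<psi> \<and>
       (\<forall>\<phi>. solves_cauchy p \<psi>\<^sub>0 T \<phi> \<longrightarrow> (\<forall>t\<in>{0..<T}. \<phi> t = \<psi> t)) \<and>
       (\<forall>t\<in>{0..<T}. mass (\<psi> t) = mass \<psi>\<^sub>0 \<and> energy p (\<psi> t) = energy p \<psi>\<^sub>0)))"
proof -
  obtain T where T: "T > 0"
    and ex: "\<And>\<psi>\<^sub>0. norm \<psi>\<^sub>0 \<le> R \<Longrightarrow> \<exists>\<psi>. solves_cauchy p \<psi>\<^sub>0 (ereal T) \<psi> \<and>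
      (\<forall>t\<in>{0..<T}. mass (\<psi> t) = mass \<psi>\<^sub>0 \<and> energy p (\<psi> t) = energy p \<psi>\<^sub>0)"
    using local_existence[OF p R] by blast
  show ?thesis
  proof (intro exI[of _ T] conjI T allI impI)
    fix \<psi>\<^sub>0 :: H12 assume "norm \<psi>\<^sub>0 \<le> R"
    from ex[OF this] obtain \<psi> where \<psi>: "solves_cauchy p \<psi>\<^sub>0 (ereal T) \<psi>"
      "\<forall>t\<in>{0..<T}. mass (\<psi> t) = mass \<psi>\<^sub>0 \<and> energy p (\<psi> t) = energy p \<psi>\<^sub>0" by blast
    show "\<exists>\<psi>. solves_cauchy p \<psi>\<^sub>0 T \<psi> \<and>
       (\<forall>\<phi>. solves_cauchy p \<psi>\<^sub>0 T \<phi> \<longrightarrow> (\<forall>t\<in>{0..<T}. \<phi> t = \<psi> t)) \<and>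
       (\<forall>t\<in>{0..<T}. mass (\<psi> t) = mass \<psi>\<^sub>0 \<and> energy p (\<psi> t) = energy p \<psi>\<^sub>0)"
    proof (intro exI[of _ \<psi>] conjI allI impI ballI)
      show "\<phi> t = \<psi> t" if "solves_cauchy p \<psi>\<^sub>0 T \<phi>" "t \<in> {0..<T}" for \<phi> t
        using solves_cauchy_unique[OF p that(1) \<psi>(1)] that(2) by (simp only: time_interval_real)
    qed (use \<psi> in auto)
  qed
qed

lemma maximal_well_posedness:
  assumes p: "2 < p"
  shows "\<exists>\<psi>. solves_cauchy p \<psi>\<^sub>0 (max_existence_time p \<psi>\<^sub>0) \<psi> \<and>
       (\<forall>\<phi>. solves_cauchy p \<psi>\<^sub>0 (max_existence_time p \<psi>\<^sub>0) \<phi> \<longrightarrow>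
          (\<forall>t\<in>time_interval (max_existence_time p \<psi>\<^sub>0). \<phi> t = \<psi> t)) \<and>
       (max_existence_time p \<psi>\<^sub>0 = \<infinity> \<or>
        max_existence_time p \<psi>\<^sub>0 < \<infinity> \<and>
        filterlim (\<lambda>t. norm (\<psi> t)) at_top
          (at_left (real_of_ereal (max_existence_time p \<psi>\<^sub>0))))"
proof -
  obtain \<psi> where \<psi>: "solves_cauchy p \<psi>\<^sub>0 (max_existence_time p \<psi>\<^sub>0) \<psi>"
    using maximal_solution[OF p] by blast
  have "max_existence_time p \<psi>\<^sub>0 = \<infinity> \<or> max_existence_time p \<psi>\<^sub>0 < \<infinity>"
    by (cases "max_existence_time p \<psi>\<^sub>0") auto
  then show ?thesis
    using \<psi> solves_cauchy_unique[OF p _ \<psi>] blowup_alternative[OF p \<psi>] by blast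
qed

theorem theorem1p1:
  fixes p :: real
  assumes "p > 2"
  shows "\<forall>R>0. \<exists>T::real. T > 0 \<and> (\<forall>\<psi>\<^sub>0 :: H12. norm \<psi>\<^sub>0 \<le> R \<longrightarrow>
    (\<exists>\<psi>. solves_cauchy p \<psi>\<^sub>0 T \<psi> \<and>
       (\<forall>\<phi>. solves_cauchy p \<psi>\<^sub>0 T \<phi> \<longrightarrow> (\<forall>t\<in>{0..<T}. \<phi> t = \<psi> t)) \<and>
       (\<forall>t\<in>{0..<T}. mass (\<psi> t) = mass \<psi>\<^sub>0 \<and> energy p (\<psi> t) = energy p \<psi>\<^sub>0)) \<and>
    (\<exists>\<psi>. solves_cauchy p \<psi>\<^sub>0 (max_existence_time p \<psi>\<^sub>0) \<psi> \<and>
       (\<forall>\<phi>. solves_cauchy p \<psi>\<^sub>0 (max_existence_time p \<psi>\<^sub>0) \<phi> \<longrightarrow>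
          (\<forall>t\<in>time_interval (max_existence_time p \<psi>\<^sub>0). \<phi> t = \<psi> t)) \<and>
       (max_existence_time p \<psi>\<^sub>0 = \<infinity> \<or>
        max_existence_time p \<psi>\<^sub>0 < \<infinity> \<and>
        filterlim (\<lambda>t. norm (\<psi> t)) at_top
          (at_left (real_of_ereal (max_existence_time p \<psi>\<^sub>0))))))"
  by (intro allI impI)
    (simp only: maximal_well_posedness[OF assms] simp_thms local_well_posedness[OF assms])

end
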